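(* Let $G$ be a finite subgroup of the multiplicative group $\mathbb{K}^\times$ of a field $\mathbb{K}$, and let $\mathcal{C}^G_\times$ be the smallest class of gain graphs with gain group $G$ satisfying: (i) the null graph belongs to $\mathcal{C}^G_\times$; (ii) $K_2^G\in\mathcal{C}^G_\times$; (iii) if $\{\pm1\}\subseteq G$, then $K_3^{\{\pm1\}}$ (the loopless gain graph on $3$ vertices with all edges of gains $\pm1$) belongs to $\mathcal{C}^G_\times$; (iv) if $\{\pm1\}\subseteq G$, then every connected loopless gain graph $\Gamma$ all of whose edges have gains in $\{\pm1\}$, such that the edges of gain $1$ form a chordal graph, the edges of gain $-1$ form a star $\{u,v_1\}_{-1},\dots,\{u,v_r\}_{-1}$, and $v_1,\dots,v_r$ are pairwise joined by edges of gain $1$, belongs to $\mathcal{C}^G_\times$; (v) if $\Gamma$ has a bias-simplicial vertex $v$ and $\Gamma\setminus v\in\mathcal{C}^G_\times$, then $\Gamma\in\mathcal{C}^G_\times$; (vi) if $V_\Gamma=V_1\cup V_2$ with $\Gamma[V_1],\Gamma[V_2]\in\mathcal{C}^G_\times$, $E_\Gamma=E_{\Gamma[V_1]}\cup E_{\Gamma[V_2]}$, and $\Gamma[V_1\cap V_2]\simeq\mathring{K}_n^G$ for some $n\ge0$, then $\Gamma\in\mathcal{C}^G_\times$. Then for every $\Gamma\in\mathcal{C}^G_\times$ the arrangement $\mathcal{A}_\times(\Gamma)$ is divisionally free.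
   Context: A gain graph $\Gamma=(V_\Gamma,E_\Gamma,L_\Gamma,G_\Gamma)$ consists of a finite vertex set, a set $L_\Gamma\subseteq V_\Gamma$ of loops, a group $G_\Gamma$, and a finite set $E_\Gamma$ of edges $\{u,v\}_g$ (classes of triples $(u,v,g)$, $u\ne v$, $g\in G_\Gamma$, with $(u,v,g)\sim(v,u,g^{-1})$). $\Gamma[W]$ is the induced subgraph on $W$ (loops $W\cap L_\Gamma$, edges of $E_\Gamma$ with both ends in $W$), and $\Gamma\setminus v=\Gamma[V_\Gamma\setminus\{v\}]$. $K_n^G$ is the loopless gain graph on $[n]$ with all edges $\{i,j\}_g$ ($i\ne j$, $g\in G$); $\mathring{K}_n^G$ is $K_n^G$ with a loop at each vertex ($n=0$ gives the null graph); so $\Gamma[V_1\cap V_2]\simeq \mathring{K}_n^G$ means every vertex of $V_1\cap V_2$ has a loop and all edges $\{u,v\}_g$, $u\ne v\in V_1\cap V_2$, $g\in G$, are present. A simple graph is chordal if every cycle of length at least $4$ has a chord. A vertex $v$ is bias simplicial if: (a) whenever $\{u,v\}_g,\{v,w\}_h\in E_\Gamma$ with $u\ne w$, then $\{u,w\}_{gh}\in E_\Gamma$; (b) if $\{u,v\}_g,\{u,v\}_h\in E_\Gamma$ with $g\ne h$, then $u\in L_\Gamma$; (c) if $\{u,v\}_g\in E_\Gamma$ and $v\in L_\Gamma$, then $u\in L_\Gamma$. For a gain graph $\Gamma$ with vertex set $[N]$ (after labeling) and gain group $G\le\mathbb{K}^\times$, $\mathcal{A}_\times(\Gamma)$ is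 the arrangement in $\mathbb{K}^N$ consisting of the hyperplanes $\{x_i-gx_j=0\}$ for $\{i,j\}_g\in E_\Gamma$ and $\{x_i=0\}$ for $i\in L_\Gamma$. For a simple matroid $M$ on $E$ with rank $r$ and lattice of flats $L(M)$, $\chi(M,t)=\sum_{X\in L(M)}\mu(X)t^{r(E)-r(X)}$ ($\mu$ the Möbius function from the bottom), computed for contractions from their lattice of flats. A divisional flag of $M$ of rank $n$ is a chain of flats $\varnothing=X_0\subseteq\dots\subseteq X_n=E$ with $r(X_i)=i$ and $\chi(M/X_{i+1},t)\mid\chi(M/X_i,t)$. The linear dependence matroid $M(\mathcal{A})$ of a central arrangement $\mathcal{A}$ is the matroid on $\mathcal{A}$ where $\{H_1,\dots,H_k\}$ is independent iff $\operatorname{codim}(H_1\cap\dots\cap H_k)=k$; $\mathcal{A}$ is divisionally free if $M(\mathcal{A})$ has a divisional flag. *)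

theory Defs
  imports
    "HOL-Library.Function_Algebras"
    "HOL-Computational_Algebra.Polynomial"
begin

section \<open>Gain graphs with gains in the multiplicative group of a field\<close>

definition mult_subgroup :: "'k::field set \<Rightarrow> bool" where
  "mult_subgroup G \<longleftrightarrow> 0 \<notin> G \<and> 1 \<in> G \<and> (\<forall>g\<in>G. \<forall>h\<in>G. g * h \<in> G) \<and> (\<forall>g\<in>G. inverse g \<in> G)"

text \<open>The edge with ends \<open>u\<close>, \<open>v\<close> and gain \<open>g\<close> is the class of the triple \<open>(u, v, g)\<close> under
  \<open>(u, v, g) \<sim> (v, u, inverse g)\<close>.\<close>

definition gedge :: "'v \<Rightarrow> 'v \<Rightarrow> 'k::field \<Rightarrow> ('v \<times> 'v \<times> 'k) set" where
  "gedge u v g = {(u, v, g), (v, u, inverse g)}"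

text \<open>The gain group is not a component of the record; it is the parameter \<open>G\<close> of
  \<open>gain_graph_over\<close> and of the constructions below.\<close>

record ('v, 'k) gain_graph =
  gverts :: "'v set"
  gedges :: "('v \<times> 'v \<times> 'k) set set"
  gloops :: "'v set"

definition gain_graph_over :: "'k::field set \<Rightarrow> ('v, 'k) gain_graph \<Rightarrow> bool" where
  "gain_graph_over G \<Gamma> \<longleftrightarrow>
     finite (gverts \<Gamma>) \<and> gloops \<Gamma> \<subseteq> gverts \<Gamma> \<and> finite (gedges \<Gamma>) \<and>
     gedges \<Gamma> \<subseteq> {gedge u v g | u v g. u \<in> gverts \<Gamma> \<and> v \<in> gverts \<Gamma> \<and> u \<noteq> v \<and> g \<in> G}"

definition induced_gain_graph :: "('v, 'k::field) gain_graph \<Rightarrow> 'v set \<Rightarrow> ('v, 'k) gain_graph" where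
  "induced_gain_graph \<Gamma> W =
     \<lparr> gverts = W,
       gedges = {e \<in> gedges \<Gamma>. \<exists>u\<in>W. \<exists>v\<in>W. \<exists>g. e = gedge u v g},
       gloops = W \<inter> gloops \<Gamma> \<rparr>"

text \<open>With \<open>card V = n\<close>, the next two are \<open>K\<^sub>n\<^sup>G\<close> and its looped version, up to the names of
  the vertices.\<close>

definition complete_gain_graph :: "'k::field set \<Rightarrow> 'v set \<Rightarrow> ('v, 'k) gain_graph" where
  "complete_gain_graph G V =
     \<lparr> gverts = V,
       gedges = {gedge u v g | u v g. u \<in> V \<and> v \<in> V \<and> u \<noteq> v \<and> g \<in> G},
       gloops = {} \<rparr>"

definition looped_complete_gain_graph :: "'k::field set \<Rightarrow> 'v set \<Rightarrow> ('v, 'k) gain_graph" where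
  "looped_complete_gain_graph G V = (complete_gain_graph G V) \<lparr> gloops := V \<rparr>"

definition connected_gain_graph :: "('v, 'k::field) gain_graph \<Rightarrow> bool" where
  "connected_gain_graph \<Gamma> \<longleftrightarrow>
     (\<forall>u\<in>gverts \<Gamma>. \<forall>v\<in>gverts \<Gamma>. (\<lambda>x y. \<exists>g. gedge x y g \<in> gedges \<Gamma>)\<^sup>*\<^sup>* u v)"

text \<open>A simple graph is given by its (symmetric, irreflexive) adjacency relation; a cycle is the
  list of its distinct vertices in cyclic order.\<close>

definition chordal :: "('v \<Rightarrow> 'v \<Rightarrow> bool) \<Rightarrow> bool" where
  "chordal adj \<longleftrightarrow>
     (\<forall>xs. let n = length xs in
        n \<ge> 4 \<and> distinct xs \<and> (\<forall>i<n. adj (xs ! i) (xs ! (Suc i mod n))) \<longrightarrow>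
        (\<exists>i<n. \<exists>j<n. i \<noteq> j \<and> j \<noteq> Suc i mod n \<and> i \<noteq> Suc j mod n \<and> adj (xs ! i) (xs ! j)))"

definition bias_simplicial :: "('v, 'k::field) gain_graph \<Rightarrow> 'v \<Rightarrow> bool" where
  "bias_simplicial \<Gamma> v \<longleftrightarrow>
     v \<in> gverts \<Gamma> \<and>
     (\<forall>u w g h. gedge u v g \<in> gedges \<Gamma> \<and> gedge v w h \<in> gedges \<Gamma> \<and> u \<noteq> w \<longrightarrow>
        gedge u w (g * h) \<in> gedges \<Gamma>) \<and>
     (\<forall>u g h. gedge u v g \<in> gedges \<Gamma> \<and> gedge u v h \<in> gedges \<Gamma> \<and> g \<noteq> h \<longrightarrow> u \<in> gloops \<Gamma>) \<and>
     (\<forall>u g. gedge u v g \<in> gedges \<Gamma> \<and> v \<in> gloops \<Gamma> \<longrightarrow> u \<in> gloops \<Gamma>)"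

text \<open>In \<open>chordal_star\<close>, \<open>u\<close> is the centre and \<open>S\<close> the set of leaves of the star of edges of
  gain \<open>-1\<close>.\<close>

inductive gain_class :: "'k::field set \<Rightarrow> ('v, 'k) gain_graph \<Rightarrow> bool" for G :: "'k set" where
  null: "gain_class G \<lparr> gverts = {}, gedges = {}, gloops = {} \<rparr>"
| complete2: "card V = 2 \<Longrightarrow> gain_class G (complete_gain_graph G V)"
| complete3: "{1, -1} \<subseteq> G \<Longrightarrow> card V = 3 \<Longrightarrow> gain_class G (complete_gain_graph {1, -1} V)"
| chordal_star:
    "{1, -1} \<subseteq> G \<Longrightarrow> gain_graph_over {1, -1} \<Gamma> \<Longrightarrow> gloops \<Gamma> = {} \<Longrightarrow> connected_gain_graph \<Gamma> \<Longrightarrow>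
     chordal (\<lambda>x y. gedge x y 1 \<in> gedges \<Gamma>) \<Longrightarrow>
     u \<in> gverts \<Gamma> \<Longrightarrow> S \<subseteq> gverts \<Gamma> - {u} \<Longrightarrow>
     {e \<in> gedges \<Gamma>. \<exists>x y. e = gedge x y (-1)} = (\<lambda>v. gedge u v (-1)) ` S \<Longrightarrow>
     (\<forall>v\<in>S. \<forall>w\<in>S. v \<noteq> w \<longrightarrow> gedge v w 1 \<in> gedges \<Gamma>) \<Longrightarrow>
     gain_class G \<Gamma>"
| simplicial:
    "gain_graph_over G \<Gamma> \<Longrightarrow> bias_simplicial \<Gamma> v \<Longrightarrow>
     gain_class G (induced_gain_graph \<Gamma> (gverts \<Gamma> - {v})) \<Longrightarrow> gain_class G \<Gamma>"
| gluing:
    "gain_graph_over G \<Gamma> \<Longrightarrow> gverts \<Gamma> = V1 \<union> V2 \<Longrightarrow>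
     gain_class G (induced_gain_graph \<Gamma> V1) \<Longrightarrow> gain_class G (induced_gain_graph \<Gamma> V2) \<Longrightarrow>
     gedges \<Gamma> = gedges (induced_gain_graph \<Gamma> V1) \<union> gedges (induced_gain_graph \<Gamma> V2) \<Longrightarrow>
     induced_gain_graph \<Gamma> (V1 \<inter> V2) = looped_complete_gain_graph G (V1 \<inter> V2) \<Longrightarrow>
     gain_class G \<Gamma>"


section \<open>Matroids and divisional flags\<close>

record 'a matroid =
  ground :: "'a set"
  indep :: "'a set \<Rightarrow> bool"

definition matroid_rank :: "'a matroid \<Rightarrow> 'a set \<Rightarrow> nat" where
  "matroid_rank M A = Max {card I | I. I \<subseteq> A \<and> indep M I}"

definition matroid_flats :: "'a matroid \<Rightarrow> 'a set set" where
  "matroid_flats M =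
     {F. F \<subseteq> ground M \<and> (\<forall>x \<in> ground M - F. matroid_rank M (insert x F) > matroid_rank M F)}"

definition matroid_basis_of :: "'a matroid \<Rightarrow> 'a set \<Rightarrow> 'a set \<Rightarrow> bool" where
  "matroid_basis_of M X B \<longleftrightarrow>
     B \<subseteq> X \<and> indep M B \<and> (\<forall>C. B \<subseteq> C \<and> C \<subseteq> X \<and> indep M C \<longrightarrow> C = B)"

definition matroid_contract :: "'a matroid \<Rightarrow> 'a set \<Rightarrow> 'a matroid" where
  "matroid_contract M X =
     \<lparr> ground = ground M - X,
       indep = (\<lambda>I. I \<subseteq> ground M - X \<and> (\<exists>B. matroid_basis_of M X B \<and> indep M (I \<union> B))) \<rparr>"

text \<open>\<open>bot_moebius L X\<close> is the value at \<open>X\<close> of the Moebius function from the bottom \<open>\<Inter>L\<close> of a family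
  \<open>L\<close> of finite sets ordered by inclusion; \<open>finite X\<close> only serves termination.\<close>

function bot_moebius :: "'a set set \<Rightarrow> 'a set \<Rightarrow> int" where
  "bot_moebius L X =
     (if X = \<Inter>L then 1 else - (\<Sum>Y \<in> {Y \<in> L. Y \<subset> X \<and> finite X}. bot_moebius L Y))"
  by pat_completeness auto
termination
  by (relation "measure (\<lambda>(L, X). card X)") (auto intro: psubset_card_mono)

declare bot_moebius.simps [simp del]

definition matroid_charpoly :: "'a matroid \<Rightarrow> int poly" where
  "matroid_charpoly M =
     (\<Sum>X \<in> matroid_flats M.
        monom (bot_moebius (matroid_flats M) X)
              (matroid_rank M (ground M) - matroid_rank M X))"

definition divisional_flag :: "'a matroid \<Rightarrow> nat \<Rightarrow> (nat \<Rightarrow> 'a set) \<Rightarrow> bool" where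
  "divisional_flag M n X \<longleftrightarrow>
     X 0 = {} \<and> X n = ground M \<and>
     (\<forall>i\<le>n. X i \<in> matroid_flats M \<and> matroid_rank M (X i) = i) \<and>
     (\<forall>i<n. X i \<subseteq> X (Suc i) \<and>
        matroid_charpoly (matroid_contract M (X (Suc i))) dvd
        matroid_charpoly (matroid_contract M (X i)))"


section \<open>Central arrangements\<close>

text \<open>The space of all functions \<open>'v \<Rightarrow> 'k\<close> with pointwise operations; \<open>coord_space V\<close> is its
  subspace \<open>K\<^sup>V\<close>, with the coordinates indexed by \<open>V\<close> and set to zero elsewhere.\<close>

global_interpretation fun_space: vector_space "\<lambda>(c::'k::field) (x::'v \<Rightarrow> 'k) v. c * x v"
  by unfold_locales (auto simp: fun_eq_iff algebra_simps)

definition coord_space :: "'v set \<Rightarrow> ('v \<Rightarrow> 'k::field) set" where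
  "coord_space V = {x. \<forall>v. v \<notin> V \<longrightarrow> x v = 0}"

definition codim :: "'v set \<Rightarrow> ('v \<Rightarrow> 'k::field) set \<Rightarrow> nat" where
  "codim V W = fun_space.dim (coord_space V :: ('v \<Rightarrow> 'k) set) - fun_space.dim W"

text \<open>\<open>A\<close> is a set of hyperplanes of \<open>coord_space V\<close>; intersecting with \<open>coord_space V\<close> makes the
  empty intersection the whole space.\<close>

definition linear_matroid :: "'v set \<Rightarrow> ('v \<Rightarrow> 'k::field) set set \<Rightarrow> ('v \<Rightarrow> 'k) set matroid" where
  "linear_matroid V A =
     \<lparr> ground = A,
       indep = (\<lambda>S. S \<subseteq> A \<and> finite S \<and> codim V (coord_space V \<inter> \<Inter>S) = card S) \<rparr>"

definition divisionally_free :: "'v set \<Rightarrow> ('v \<Rightarrow> 'k::field) set set \<Rightarrow> bool" where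
  "divisionally_free V A \<longleftrightarrow> (\<exists>n X. divisional_flag (linear_matroid V A) n X)"

definition mult_arrangement :: "('v, 'k::field) gain_graph \<Rightarrow> ('v \<Rightarrow> 'k) set set" where
  "mult_arrangement \<Gamma> =
     {{x \<in> coord_space (gverts \<Gamma>). x i - g * x j = 0} | i j g. gedge i j g \<in> gedges \<Gamma>} \<union>
     {{x \<in> coord_space (gverts \<Gamma>). x i = 0} | i. i \<in> gloops \<Gamma>}"

end

theory Submission
  imports Defs
begin

text \<open>Write \<open>\<chi> Z\<close> for the characteristic polynomial of the contraction by a flat \<open>Z\<close>; over the flats
  \<open>Z' \<supseteq> Z\<close>, the \<open>\<chi> Z'\<close> sum up to \<open>t ^ (r E - r Z)\<close>, and this determines them. If \<open>T\<close> is a modular flat,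
  summing over the flats with a given trace on \<open>T\<close> compares \<open>\<chi>\<close> with its analogue for \<open>T\<close>. Hence a chain
  of flats with the required divisibilities that ends in a complement of \<open>T\<close> can be continued by any
  divisional flag of \<open>T\<close>.

  A bias-simplicial vertex gives a modular coatom, and in a gluing the part on \<open>V\<^sub>2\<close> is modular. In the
  second case the chain must come from a flag of the part on \<open>V\<^sub>1\<close> that reaches a complement of the
  looped complete subgraph on \<open>V\<^sub>1 \<inter> V\<^sub>2\<close>. So the induction over the class proves more: for every vertex
  set \<open>W\<close> carrying a looped complete subgraph there is a flag that stays disjoint from that subgraph
  as long as the rank allows.

  The loopless base cases consist of a chordal graph of gain-\<open>1\<close> edges, which is handled by removing
  simplicial vertices (Dirac), and of further hyperplanes that miss the all-ones vector and turn the
  chordal part into a modular coatom.\<close>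

section \<open>Matroid rank functions and modular flats\<close>

text \<open>The obstacle is the gluing. A flag of the part on V1 transfers to the whole graph only
  along flats that contain no hyperplane of the part on V2: for these, enlarging the ground set
  multiplies the characteristic polynomial by a fixed factor. A flag that picks up a hyperplane of
  the common part too early gives no such control, and divisional freeness alone does not prevent
  this. The rank bound in the strengthened claim is the best possible: the looped complete subgraph
  on W is a modular flat of rank |W|, so a flat disjoint from it has corank at least |W|. Its
  modularity rests on the loops together with all gains of G: they make any solution of the
  equations on W extend consistently to the other vertices. Only sums over larger flats are used, so
  restricting to a flat T merely shrinks the ground set and keeps the rank function.\<close>

definition rank_flats :: "'a set \<Rightarrow> ('a set \<Rightarrow> nat) \<Rightarrow> 'a set set" where
  "rank_flats E r = {F. F \<subseteq> E \<and> (\<forall>x \<in> E - F. r F < r (insert x F))}"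

definition rank_cl :: "'a set \<Rightarrow> ('a set \<Rightarrow> nat) \<Rightarrow> 'a set \<Rightarrow> 'a set" where
  "rank_cl E r S = {x \<in> E. r (insert x S) = r S}"

text \<open>For a flat \<open>Z\<close> this is the characteristic polynomial of the contraction by \<open>Z\<close>, defined by Moebius
  inversion: over the flats \<open>Z' \<supseteq> Z\<close>, the \<open>chi E r Z'\<close> sum up to \<open>t ^ (r E - r Z)\<close>.\<close>

function chi :: "'a set \<Rightarrow> ('a set \<Rightarrow> nat) \<Rightarrow> 'a set \<Rightarrow> int poly" where
  "chi E r Z = monom 1 (r E - r Z) -
     (\<Sum>Z' \<in> {Z' \<in> rank_flats E r. Z \<subset> Z' \<and> finite E}. chi E r Z')"
  by pat_completeness auto
termination
  by (relation "measure (\<lambda>(E, r, Z). card (E - Z))")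
     (auto simp: rank_flats_def intro!: psubset_card_mono)

declare chi.simps [simp del]

definition modular_flat :: "'a set \<Rightarrow> ('a set \<Rightarrow> nat) \<Rightarrow> 'a set \<Rightarrow> bool" where
  "modular_flat E r T \<longleftrightarrow> T \<in> rank_flats E r \<and>
     (\<forall>F \<in> rank_flats E r. r (F \<union> T) + r (F \<inter> T) = r F + r T)"

definition rank_flag :: "'a set \<Rightarrow> ('a set \<Rightarrow> nat) \<Rightarrow> (nat \<Rightarrow> 'a set) \<Rightarrow> bool" where
  "rank_flag E r X \<longleftrightarrow> X 0 = {} \<and> X (r E) = E \<and>
     (\<forall>i\<le>r E. X i \<in> rank_flats E r \<and> r (X i) = i) \<and>
     (\<forall>i<r E. X i \<subseteq> X (Suc i) \<and> chi E r (X (Suc i)) dvd chi E r (X i))"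

text \<open>The last axiom is submodularity in local form: an element without effect on a set has no
  effect on any larger set. For hyperplanes this is immediate, since a hyperplane containing an
  intersection contains every smaller one. The axioms constrain \<open>r\<close> only on subsets of
  \<open>E\<close>, so that deletion keeps \<open>r\<close> and shrinks \<open>E\<close>.\<close>

locale matroid_rank_function =
  fixes E :: "'a set" and r :: "'a set \<Rightarrow> nat"
  assumes finite_ground: "finite E"
    and rank_empty: "r {} = 0"
    and rank_insert_ge: "S \<subseteq> E \<Longrightarrow> x \<in> E \<Longrightarrow> r S \<le> r (insert x S)"
    and rank_insert_le: "S \<subseteq> E \<Longrightarrow> x \<in> E \<Longrightarrow> r (insert x S) \<le> Suc (r S)"
    and rank_insert_eq_mono:
      "S \<subseteq> S' \<Longrightarrow> S' \<subseteq> E \<Longrightarrow> x \<in> E \<Longrightarrow> r (insert x S) = r S \<Longrightarrow> r (insert x S') = r S'"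
begin

lemma restrict: "T \<subseteq> E \<Longrightarrow> matroid_rank_function T r"
proof
  assume T: "T \<subseteq> E"
  show "finite T" using T finite_ground finite_subset by blast
  show "r {} = 0" by (rule rank_empty)
  show "r S \<le> r (insert x S)" "r (insert x S) \<le> Suc (r S)" if "S \<subseteq> T" "x \<in> T" for S x
    using that T by (auto intro!: rank_insert_ge rank_insert_le)
  show "r (insert x S') = r S'"
    if "S \<subseteq> S'" "S' \<subseteq> T" "x \<in> T" "r (insert x S) = r S" for S S' x
    using that T by (intro rank_insert_eq_mono[of S S' x]) auto
qed

lemma finite_sub: "S \<subseteq> E \<Longrightarrow> finite S"
  using finite_ground finite_subset by blast

text \<open>Diminishing returns: each element of \<open>C\<close>, added in turn, raises the rank of
  the larger set at most as much as that of the smaller. Submodularity is the instance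
  \<open>X = A \<inter> B\<close>, \<open>X' = A\<close>, \<open>C = B\<close>.\<close>

lemma rank_Un_diff_mono:
  assumes "X \<subseteq> X'" "X' \<subseteq> E" "C \<subseteq> E"
  shows "r (X' \<union> C) + r X \<le> r (X \<union> C) + r X'"
  using finite_sub[OF assms(3)] assms(3)
proof (induction C rule: finite_induct)
  case (insert c C)
  have "r (insert c (X' \<union> C)) = r (X' \<union> C)" if "r (insert c (X \<union> C)) = r (X \<union> C)"
    using rank_insert_eq_mono[of "X \<union> C" "X' \<union> C" c] that assms insert.prems by blast
  moreover have "r (X \<union> C) \<le> r (insert c (X \<union> C))"
    using rank_insert_ge[of "X \<union> C" c] assms insert.prems by auto
  moreover have "r (insert c (X' \<union> C)) \<le> Suc (r (X' \<union> C))"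
    using rank_insert_le[of "X' \<union> C" c] assms insert.prems by auto
  ultimately show ?case using insert.IH insert.prems by simp linarith
qed simp

lemma rank_submodular:
  "A \<subseteq> E \<Longrightarrow> B \<subseteq> E \<Longrightarrow> r (A \<union> B) + r (A \<inter> B) \<le> r A + r B"
  using rank_Un_diff_mono[of "A \<inter> B" A B] by (simp add: Un_absorb1 sup_commute)

lemma rank_mono:
  assumes "A \<subseteq> B" "B \<subseteq> E"
  shows "r A \<le> r B"
proof -
  have "A \<subseteq> E" using assms by auto
  have "r A \<le> r (A \<union> C)" if "C \<subseteq> E" for C
    using finite_sub[OF that] that
  proof (induction C rule: finite_induct)
    case (insert c C)
    then have "r (A \<union> C) \<le> r (insert c (A \<union> C))"
      using \<open>A \<subseteq> E\<close> by (intro rank_insert_ge) auto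
    then show ?case using insert by simp
  qed simp
  from this[of B] show ?thesis using assms by (simp add: Un_absorb1)
qed

lemma rank_Un_cl:
  assumes "S \<subseteq> E" "A \<subseteq> rank_cl E r S"
  shows "r (S \<union> A) = r S"
proof -
  have "A \<subseteq> E" using assms(2) by (auto simp: rank_cl_def)
  from finite_sub[OF this] assms(2) show ?thesis
  proof (induction A rule: finite_induct)
    case (insert x A)
    then have "r (insert x S) = r S" "x \<in> E" "S \<union> A \<subseteq> E"
      using assms by (auto simp: rank_cl_def)
    then show ?case
      using insert rank_insert_eq_mono[of S "S \<union> A" x] by auto
  qed simp
qed

lemma cl_subset: "rank_cl E r S \<subseteq> E"
  by (auto simp: rank_cl_def)

lemma cl_extensive: "S \<subseteq> E \<Longrightarrow> S \<subseteq> rank_cl E r S"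
  by (auto simp: rank_cl_def insert_absorb)

lemma rank_cl [simp]: "S \<subseteq> E \<Longrightarrow> r (rank_cl E r S) = r S"
  using rank_Un_cl[of S "rank_cl E r S"] cl_extensive[of S] by (simp add: Un_absorb1)

lemma rank_cl_Un:
  assumes "S \<subseteq> E" "A \<subseteq> E"
  shows "r (rank_cl E r S \<union> A) = r (S \<union> A)"
proof (rule antisym)
  have "r (rank_cl E r S \<union> A) + r S \<le> r (S \<union> A) + r (rank_cl E r S)"
    using rank_Un_diff_mono[of S "rank_cl E r S" A] assms cl_extensive cl_subset by blast
  then show "r (rank_cl E r S \<union> A) \<le> r (S \<union> A)" using assms by simp
  show "r (S \<union> A) \<le> r (rank_cl E r S \<union> A)"
    by (rule rank_mono) (use assms cl_extensive cl_subset in blast)+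
qed

lemma flat_subset: "F \<in> rank_flats E r \<Longrightarrow> F \<subseteq> E"
  by (simp add: rank_flats_def)

lemma finite_flats: "finite (rank_flats E r)"
  by (rule finite_subset[of _ "Pow E"]) (auto simp: rank_flats_def finite_ground)

lemma cl_flat: 
  assumes "S \<subseteq> E" shows "rank_cl E r S \<in> rank_flats E r"
  unfolding rank_flats_def
proof (safe)
  fix x assume x: "x \<in> E" "x \<notin> rank_cl E r S"
  have "r (insert x (rank_cl E r S)) = r (insert x S)"
    using rank_cl_Un[of S "{x}"] assms x by simp
  moreover have "r (insert x S) \<noteq> r S" using x by (auto simp: rank_cl_def)
  ultimately show "r (rank_cl E r S) < r (insert x (rank_cl E r S))"
    using rank_insert_ge[of S x] assms x by simp
qed (simp add: rank_cl_def)

lemma flat_memI: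
  assumes "F \<in> rank_flats E r" "S \<subseteq> F" "x \<in> E" "r (insert x S) = r S"
  shows "x \<in> F"
proof (rule ccontr)
  assume x: "x \<notin> F"
  have "r (insert x F) = r F"
    using assms rank_insert_eq_mono[of S F x] by (simp add: rank_flats_def)
  moreover have "r F < r (insert x F)" using assms x by (simp add: rank_flats_def)
  ultimately show False by simp
qed

lemma cl_least: "F \<in> rank_flats E r \<Longrightarrow> S \<subseteq> F \<Longrightarrow> rank_cl E r S \<subseteq> F"
  using flat_memI unfolding rank_cl_def by blast

lemma flat_eqI:
  assumes "F \<in> rank_flats E r" "F \<subseteq> F'" "F' \<subseteq> E" "r F' \<le> r F"
  shows "F' = F"
proof -
  have "x \<in> F" if "x \<in> F'" for x
  proof (rule flat_memI[OF assms(1) subset_refl])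
    have "r (insert x F) \<le> r F'" using assms that by (intro rank_mono) auto
    moreover have "r F \<le> r (insert x F)" using assms that by (intro rank_insert_ge) auto
    ultimately show "r (insert x F) = r F" using assms by simp
  qed (use that assms in auto)
  then show ?thesis using assms by auto
qed

lemma ground_flat: "E \<in> rank_flats E r"
  by (simp add: rank_flats_def)

lemma flat_restrict:
  assumes "F \<in> rank_flats E r" "T \<subseteq> E"
  shows "F \<inter> T \<in> rank_flats T r"
  unfolding rank_flats_def
proof (intro CollectI conjI ballI)
  fix x assume "x \<in> T - F \<inter> T"
  then have x: "x \<in> T" "x \<notin> F" by auto
  have "r (insert x (F \<inter> T)) \<noteq> r (F \<inter> T)"
    using flat_memI[OF assms(1), of "F \<inter> T" x] x assms by auto
  moreover have "r (F \<inter> T) \<le> r (insert x (F \<inter> T))"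
    by (rule rank_insert_ge) (use assms x in auto)
  ultimately show "r (F \<inter> T) < r (insert x (F \<inter> T))" by simp
qed simp

lemma flat_of_flat:
  assumes "T \<in> rank_flats E r" "F \<in> rank_flats T r"
  shows "F \<in> rank_flats E r"
  unfolding rank_flats_def
proof (intro CollectI conjI ballI)
  have sub: "F \<subseteq> T" "T \<subseteq> E" using assms by (auto simp: rank_flats_def)
  then show FE: "F \<subseteq> E" by simp
  fix x assume x: "x \<in> E - F"
  show "r F < r (insert x F)"
  proof (cases "x \<in> T")
    case True
    then show ?thesis using assms(2) x by (simp add: rank_flats_def)
  next
    case False
    then have "r (insert x F) \<noteq> r F" using flat_memI[OF assms(1) sub(1), of x] x by auto
    moreover have "r F \<le> r (insert x F)" using FE x by (intro rank_insert_ge) auto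
    ultimately show ?thesis by simp
  qed
qed

lemma flats_of_flat:
  "T \<in> rank_flats E r \<Longrightarrow> rank_flats T r = {F \<in> rank_flats E r. F \<subseteq> T}"
proof (intro equalityI subsetI)
  fix F assume T: "T \<in> rank_flats E r" and "F \<in> rank_flats T r"
  then show "F \<in> {F \<in> rank_flats E r. F \<subseteq> T}"
    using flat_of_flat[OF T] by (simp add: rank_flats_def)
next
  fix F assume T: "T \<in> rank_flats E r" and "F \<in> {F \<in> rank_flats E r. F \<subseteq> T}"
  then show "F \<in> rank_flats T r"
    using flat_restrict[of F T] flat_subset[OF T] by (simp add: Int_absorb2)
qed

section \<open>Upward sums of characteristic polynomials\<close>

lemma sum_chi_above:
  assumes "Y \<in> rank_flats E r"
  shows "(\<Sum>Z \<in> {Z \<in> rank_flats E r. Y \<subseteq> Z}. chi E r Z) = monom 1 (r E - r Y)"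
proof -
  have eq: "{Z \<in> rank_flats E r. Y \<subseteq> Z} = insert Y {Z \<in> rank_flats E r. Y \<subset> Z}"
    using assms by auto
  have "(\<Sum>Z \<in> {Z \<in> rank_flats E r. Y \<subseteq> Z}. chi E r Z)
      = chi E r Y + (\<Sum>Z \<in> {Z \<in> rank_flats E r. Y \<subset> Z}. chi E r Z)"
    unfolding eq by (rule sum.insert) (auto simp: finite_flats)
  then show ?thesis by (simp add: chi.simps[of E r Y] finite_ground)
qed

lemma sum_chi_above_cl:
  assumes "S \<subseteq> E"
  shows "(\<Sum>Z \<in> {Z \<in> rank_flats E r. S \<subseteq> Z}. chi E r Z) = monom 1 (r E - r S)"
proof -
  have "{Z \<in> rank_flats E r. S \<subseteq> Z} = {Z \<in> rank_flats E r. rank_cl E r S \<subseteq> Z}"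
    using cl_least cl_extensive[OF assms] by blast
  then show ?thesis using sum_chi_above[OF cl_flat[OF assms]] assms by simp
qed

section \<open>Modular flats\<close>

lemma modularD:
  assumes "modular_flat E r T"
  shows "T \<in> rank_flats E r" "T \<subseteq> E"
    "F \<in> rank_flats E r \<Longrightarrow> r (F \<union> T) + r (F \<inter> T) = r F + r T"
  using assms by (auto simp: modular_flat_def rank_flats_def)

text \<open>As in a modular lattice, joining \<open>Z\<close> with a flat \<open>W\<close> of
  \<open>T\<close> above its trace adds nothing else of \<open>T\<close>. Modularity is applied to
  \<open>Z\<close> and to the closure of \<open>Z \<union> W\<close>, whose joins with
  \<open>T\<close> have equal rank; with submodularity this leaves the trace of the closure no rank
  beyond that of \<open>W\<close>.\<close>

lemma modular_rank_Un:
  assumes T: "modular_flat E r T" and Z: "Z \<in> rank_flats E r"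
    and W: "W \<in> rank_flats T r" "Z \<inter> T \<subseteq> W"
  shows "r (Z \<union> W) + r (Z \<inter> T) = r Z + r W"
    and "rank_cl E r (Z \<union> W) \<inter> T = W"
proof -
  note TE = modularD(2)[OF T]
  have sub: "Z \<subseteq> E" "W \<subseteq> T" "W \<subseteq> E" using Z W TE by (auto simp: rank_flats_def)
  let ?F = "rank_cl E r (Z \<union> W)"
  have F: "?F \<in> rank_flats E r" by (rule cl_flat) (use sub in auto)
  have "r (?F \<union> T) = r (Z \<union> T)"
    using rank_cl_Un[of "Z \<union> W" T] sub TE by (simp add: Un_assoc Un_absorb1)
  moreover have "r (?F \<union> T) + r (?F \<inter> T) = r (Z \<union> W) + r T"
    using modularD(3)[OF T F] sub by simp
  moreover have "r (Z \<union> T) + r (Z \<inter> T) = r Z + r T" using modularD(3)[OF T Z] .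
  moreover have WF: "W \<subseteq> ?F \<inter> T" using cl_extensive[of "Z \<union> W"] sub by auto
  then have "r W \<le> r (?F \<inter> T)" by (rule rank_mono) (use TE in auto)
  moreover have "r (Z \<union> W) + r (Z \<inter> T) \<le> r Z + r W"
  proof -
    have "r (Z \<union> W) + r (Z \<inter> W) \<le> r Z + r W" using rank_submodular sub by simp
    moreover have "Z \<inter> W = Z \<inter> T" using sub W by auto
    ultimately show ?thesis by simp
  qed
  ultimately show 1: "r (Z \<union> W) + r (Z \<inter> T) = r Z + r W"
    and "?F \<inter> T = W"
  proof -
    interpret T: matroid_rank_function T r using TE by (rule restrict)
    assume a: "r (?F \<union> T) = r (Z \<union> T)"
      "r (?F \<union> T) + r (?F \<inter> T) = r (Z \<union> W) + r T"
      "r (Z \<union> T) + r (Z \<inter> T) = r Z + r T" "r W \<le> r (?F \<inter> T)"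
      "r (Z \<union> W) + r (Z \<inter> T) \<le> r Z + r W"
    then show "r (Z \<union> W) + r (Z \<inter> T) = r Z + r W" by linarith
    show "?F \<inter> T = W"
      by (rule T.flat_eqI[OF W(1) WF]) (use a in auto)
  qed
qed

text \<open>Taken over all flats of \<open>T\<close> above \<open>W\<close>, the fibres make up the
  flats above \<open>Z \<union> W\<close>, and modularity splits the resulting exponent into a part
  independent of \<open>W\<close> and \<open>r T - r W\<close>. So both sides have the same upward
  sums over the flats of \<open>T\<close>, and induction from the top of \<open>T\<close> removes
  the larger fibres.\<close>

lemma sum_chi_fibre:
  assumes T: "modular_flat E r T" and Z: "Z \<in> rank_flats E r"
    and "W \<in> rank_flats T r" "Z \<inter> T \<subseteq> W"
  shows "(\<Sum>Z' \<in> {Z' \<in> rank_flats E r. Z \<subseteq> Z' \<and> Z' \<inter> T = W}. chi E r Z')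
    = monom 1 (r E - r T - (r Z - r (Z \<inter> T))) * chi T r W"
  using assms(3,4)
proof (induction "card (T - W)" arbitrary: W rule: less_induct)
  case (less W)
  note TE = modularD(2)[OF T]
  interpret T: matroid_rank_function T r using TE by (rule restrict)
  have sub: "Z \<subseteq> E" "W \<subseteq> T" "W \<subseteq> E" using Z less.prems TE by (auto simp: rank_flats_def)
  \<comment> \<open>By modularity this is the corank of \<open>Z \<union> T\<close>; it is the same
    for every \<open>W\<close>.\<close>
  let ?c = "r E - r T - (r Z - r (Z \<inter> T))"
  let ?g = "\<lambda>W. \<Sum>Z' \<in> {Z' \<in> rank_flats E r. Z \<subseteq> Z' \<and> Z' \<inter> T = W}. chi E r Z'"
  let ?U = "{W' \<in> rank_flats T r. W \<subset> W'}"
  have U: "insert W ?U = {W' \<in> rank_flats T r. W \<subseteq> W'}" using less.prems by auto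
  have "sum ?g (insert W ?U) = (\<Sum>Z' \<in> {Z' \<in> rank_flats E r. Z \<union> W \<subseteq> Z'}. chi E r Z')"
  proof -
    have "sum ?g (insert W ?U) =
      sum (chi E r) (\<Union>W'\<in>insert W ?U. {Z' \<in> rank_flats E r. Z \<subseteq> Z' \<and> Z' \<inter> T = W'})"
      by (rule sum.UNION_disjoint[symmetric]) (auto simp: finite_flats T.finite_flats)
    also have "(\<Union>W'\<in>insert W ?U. {Z' \<in> rank_flats E r. Z \<subseteq> Z' \<and> Z' \<inter> T = W'})
        = {Z' \<in> rank_flats E r. Z \<union> W \<subseteq> Z'}"
      unfolding U using flat_restrict[OF _ TE] sub by auto
    finally show ?thesis .
  qed
  also have "\<dots> = monom 1 (r E - r (Z \<union> W))" by (rule sum_chi_above_cl) (use sub in auto)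
  also have "r E - r (Z \<union> W) = ?c + (r T - r W)"
  proof -
    have "r (Z \<union> W) + r (Z \<inter> T) = r Z + r W" by (rule modular_rank_Un) (fact T Z less.prems)+
    moreover have "r (Z \<union> T) + r (Z \<inter> T) = r Z + r T" using modularD(3)[OF T Z] .
    moreover have "r (Z \<union> T) \<le> r E" "r T \<le> r E" "r (Z \<inter> T) \<le> r Z" "r W \<le> r T"
      using sub TE by (auto intro!: rank_mono)
    ultimately show ?thesis by linarith
  qed
  also have "monom 1 \<dots> = monom 1 ?c * (monom 1 (r T - r W) :: int poly)"
    by (simp add: mult_monom)
  also have "monom 1 (r T - r W) = sum (chi T r) (insert W ?U)"
    using T.sum_chi_above[OF less.prems(1)] U by simp
  finally have *: "sum ?g (insert W ?U) = monom 1 ?c * sum (chi T r) (insert W ?U)" .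
  have "sum ?g ?U = (\<Sum>W'\<in>?U. monom 1 ?c * chi T r W')"
  proof (rule sum.cong[OF refl])
    fix W' assume W': "W' \<in> ?U"
    then have "W' \<subseteq> T" by (auto simp: rank_flats_def)
    then have "card (T - W') < card (T - W)"
      using W' T.finite_ground by (intro psubset_card_mono) auto
    then show "?g W' = monom 1 ?c * chi T r W'"
      using less.hyps[of W'] W' less.prems by auto
  qed
  moreover have "W \<notin> ?U" "finite ?U" using T.finite_flats by auto
  ultimately show ?case using *
    by (simp add: distrib_left sum_distrib_left)
qed

text \<open>If \<open>Z \<union> T\<close> spans, modularity gives any larger flat with the same
  trace the same rank as \<open>Z\<close>; so the fibre over the trace is \<open>Z\<close> alone and
  the power of \<open>t\<close> is 1.\<close>

lemma chi_eq_if_spanning: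
  assumes T: "modular_flat E r T" and Z: "Z \<in> rank_flats E r" and "r (Z \<union> T) = r E"
  shows "chi E r Z = chi T r (Z \<inter> T)"
proof -
  note TE = modularD(2)[OF T]
  have "{Z' \<in> rank_flats E r. Z \<subseteq> Z' \<and> Z' \<inter> T = Z \<inter> T} = {Z}"
  proof -
    have "Z' = Z" if "Z' \<in> rank_flats E r" "Z \<subseteq> Z'" "Z' \<inter> T = Z \<inter> T" for Z'
    proof (rule flat_eqI[OF Z that(2)])
      show "Z' \<subseteq> E" using that flat_subset by auto
      have "Z \<union> T \<subseteq> Z' \<union> T" "Z' \<union> T \<subseteq> E" using that flat_subset TE by auto
      then have "r (Z \<union> T) \<le> r (Z' \<union> T)" "r (Z' \<union> T) \<le> r E" by (auto intro!: rank_mono)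
      then have "r E = r (Z' \<union> T)" using assms(3) by simp
      then show "r Z' \<le> r Z"
        using modularD(3)[OF T that(1)] modularD(3)[OF T Z] assms(3) that by simp
    qed
    then show ?thesis using Z by auto
  qed
  moreover have "r E - r T - (r Z - r (Z \<inter> T)) = 0"
    using modularD(3)[OF T Z] assms(3) by simp
  ultimately show ?thesis
    using sum_chi_fibre[OF T Z flat_restrict[OF Z TE] subset_refl]
    by (simp add: one_pCons monom_0)
qed

text \<open>Stanley's modular factorization, in the form of a divisibility.\<close>

lemma chi_modular_dvd:
  assumes T: "modular_flat E r T" and "Z \<in> rank_flats E r"
  shows "chi T r (Z \<inter> T) dvd chi E r Z"
  using assms(2)
proof (induction "card (E - Z)" arbitrary: Z rule: less_induct)
  case (less Z)
  let ?U = "{Z' \<in> rank_flats E r. Z \<subset> Z' \<and> Z' \<inter> T = Z \<inter> T}"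
  have U: "{Z' \<in> rank_flats E r. Z \<subseteq> Z' \<and> Z' \<inter> T = Z \<inter> T} = insert Z ?U" using less.prems by auto
  have "finite ?U" using finite_flats by auto
  then have eq: "chi E r Z + sum (chi E r) ?U
      = monom 1 (r E - r T - (r Z - r (Z \<inter> T))) * chi T r (Z \<inter> T)"
    using sum_chi_fibre[OF T less.prems flat_restrict[OF less.prems modularD(2)[OF T]] subset_refl]
    unfolding U by simp
  \<comment> \<open>The other members of the fibre are larger flats with the same trace, so the
    induction hypothesis provides the same divisor for each of them.\<close>
  have "chi T r (Z \<inter> T) dvd sum (chi E r) ?U"
  proof (rule dvd_sum)
    fix Z' assume Z': "Z' \<in> ?U"
    then have "E - Z' \<subset> E - Z" using flat_subset[of Z'] by auto
    then have "card (E - Z') < card (E - Z)"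
      using finite_ground by (intro psubset_card_mono) auto
    from less.hyps[OF this] Z' show "chi T r (Z \<inter> T) dvd chi E r Z'" by auto
  qed
  moreover have "chi E r Z = monom 1 (r E - r T - (r Z - r (Z \<inter> T))) * chi T r (Z \<inter> T) - sum (chi E r) ?U"
    using eq by simp
  ultimately show ?case by simp
qed

text \<open>The polynomial is monic of degree \<open>r E - r Z\<close>, because all larger flats
  contribute lower degrees. Being nonzero is what allows a common factor to be cancelled from a
  divisibility when gluing.\<close>

lemma chi_neq_0: "Z \<in> rank_flats E r \<Longrightarrow> chi E r Z \<noteq> 0"
proof -
  have "coeff (chi E r Z) (r E - r Z) = 1 \<and> degree (chi E r Z) \<le> r E - r Z"
    if "Z \<in> rank_flats E r" for Z
    using that
  proof (induction "card (E - Z)" arbitrary: Z rule: less_induct)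
    case (less Z)
    let ?U = "{Z' \<in> rank_flats E r. Z \<subset> Z'}"
    have *: "degree (chi E r Z') < r E - r Z" if Z': "Z' \<in> ?U" for Z'
    proof -
      have "E - Z' \<subset> E - Z" using Z' flat_subset[of Z'] by auto
      then have "card (E - Z') < card (E - Z)"
        using finite_ground by (intro psubset_card_mono) auto
      from less.hyps[OF this] Z' have "degree (chi E r Z') \<le> r E - r Z'" by auto
      moreover have "r Z < r Z'"
        using flat_eqI[OF less.prems, of Z'] Z' flat_subset by force
      moreover have "r Z' \<le> r E" using Z' flat_subset by (auto intro!: rank_mono)
      ultimately show ?thesis by auto
    qed
    then have "coeff (sum (chi E r) ?U) (r E - r Z) = 0"
      by (auto simp: coeff_sum intro!: sum.neutral coeff_eq_0)
    moreover have "degree (sum (chi E r) ?U) \<le> r E - r Z"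
      by (intro degree_sum_le) (use * finite_flats in \<open>auto intro: less_imp_le\<close>)
    moreover have "chi E r Z = monom 1 (r E - r Z) - sum (chi E r) ?U"
      by (simp add: chi.simps[of E r Z] finite_ground)
    ultimately show ?case
      by (auto intro!: degree_diff_le degree_monom_le)
  qed
  then show "Z \<in> rank_flats E r \<Longrightarrow> chi E r Z \<noteq> 0" by force
qed

section \<open>Flags continued along a modular flat\<close>

lemma rank_flagD:
  assumes "rank_flag E r X"
  shows "X 0 = {}" "X (r E) = E" "i \<le> r E \<Longrightarrow> X i \<in> rank_flats E r" "i \<le> r E \<Longrightarrow> r (X i) = i"
    "i < r E \<Longrightarrow> X i \<subseteq> X (Suc i)" "i < r E \<Longrightarrow> chi E r (X (Suc i)) dvd chi E r (X i)"
  using assms by (auto simp: rank_flag_def)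

text \<open>The conditions on \<open>p\<close> make \<open>X p\<close> a complement of
  \<open>T\<close>. From there on every flat of the chain spans \<open>E\<close> together with
  \<open>T\<close>, hence has the same \<open>chi\<close> as its trace on \<open>T\<close>; these
  traces run through \<open>Y\<close>, whose divisibilities are reused.\<close>

lemma flag_extend:
  assumes T: "modular_flat E r T" and p: "p + r T = r E"
    and X: "X 0 = {}" "\<And>i. i \<le> p \<Longrightarrow> X i \<in> rank_flats E r" "\<And>i. i \<le> p \<Longrightarrow> r (X i) = i"
      "\<And>i. i < p \<Longrightarrow> X i \<subseteq> X (Suc i)"
      "\<And>i. i < p \<Longrightarrow> chi E r (X (Suc i)) dvd chi E r (X i)"
    and disj: "X p \<inter> T = {}" and Y: "rank_flag T r Y"
  defines "Z \<equiv> (\<lambda>i. if i \<le> p then X i else rank_cl E r (X p \<union> Y (i - p)))"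
  shows "rank_flag E r Z" and "\<And>i. p \<le> i \<Longrightarrow> i \<le> r E \<Longrightarrow> Z i \<inter> T = Y (i - p)"
proof -
  note TE = modularD(2)[OF T]
  interpret T: matroid_rank_function T r using TE by (rule restrict)
  note Yf = T.rank_flagD[OF Y]
  have Xp: "X p \<in> rank_flats E r" "r (X p) = p" "X p \<subseteq> E" using X flat_subset by auto
  \<comment> \<open>The two branches of \<open>Z\<close> agree at \<open>i = p\<close> since
    \<open>Y 0\<close> is empty.\<close>
  have Zp: "Z i = rank_cl E r (X p \<union> Y (i - p))" if "p \<le> i" for i
  proof (cases "i = p")
    case True
    have "rank_cl E r (X p) = X p"
      using cl_least[OF Xp(1) subset_refl] cl_extensive[OF Xp(3)] by auto
    then show ?thesis using True Yf(1) by (simp add: Z_def)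
  qed (use that in \<open>simp add: Z_def\<close>)
  have Yi: "Y (i - p) \<in> rank_flats T r" "r (Y (i - p)) = i - p" "Y (i - p) \<subseteq> T"
    if "i \<le> r E" for i
    using Yf(3,4)[of "i - p"] that p T.flat_subset by auto
  have tr: "r (X p \<union> Y (i - p)) = i" "Z i \<inter> T = Y (i - p)" if "p \<le> i" "i \<le> r E" for i
    using modular_rank_Un[OF T Xp(1) Yi(1)] Yi that disj Xp rank_empty Zp[OF that(1)] by auto
  show "Z i \<inter> T = Y (i - p)" if "p \<le> i" "i \<le> r E" for i using tr that by simp
  have flat: "Z i \<in> rank_flats E r \<and> r (Z i) = i" if "i \<le> r E" for i
  proof (cases "i \<le> p")
    case False
    have "X p \<union> Y (i - p) \<subseteq> E" using Xp Yi[OF that] TE by auto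
    then show ?thesis using Zp[of i] tr[of i] False that cl_flat by auto
  qed (auto simp: Z_def X)
  have spanning: "r (Z i \<union> T) = r E" if "p \<le> i" "i \<le> r E" for i
  proof (rule antisym)
    show "r (Z i \<union> T) \<le> r E"
      by (rule rank_mono) (use flat[OF that(2)] flat_subset TE in auto)
    show "r E \<le> r (Z i \<union> T)"
    proof -
      have "r E = r (X p \<union> T)" using modularD(3)[OF T Xp(1)] disj Xp p rank_empty by simp
      also have "\<dots> \<le> r (Z i \<union> T)"
        by (rule rank_mono)
          (use flat[OF that(2)] flat_subset TE Zp[OF that(1)] cl_extensive[of "X p \<union> Y (i - p)"] 
               Yi[OF that(2)] Xp in auto)
      finally show ?thesis .
    qed
  qed
  have step: "Z i \<subseteq> Z (Suc i) \<and> chi E r (Z (Suc i)) dvd chi E r (Z i)" if i: "i < r E" for i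
  proof (cases "i < p")
    case True then show ?thesis using X by (auto simp: Z_def)
  next
    case False
    then have pi: "p \<le> i" "p \<le> Suc i" "Suc i - p = Suc (i - p)" "i - p < r T" using p i by auto
    have Ysub: "Y (i - p) \<subseteq> Y (Suc (i - p))" using Yf(5) pi by simp
    have "X p \<union> Y (Suc i - p) \<subseteq> E" using Xp Yi[of "Suc i"] i TE by auto
    from cl_extensive[OF this] have "X p \<union> Y (i - p) \<subseteq> Z (Suc i)"
      using Zp[OF pi(2)] Ysub pi by auto
    then have "Z i \<subseteq> Z (Suc i)"
      using cl_least[of "Z (Suc i)"] flat[of "Suc i"] i Zp[OF pi(1)] by simp
    moreover have "chi E r (Z i) = chi T r (Y (i - p))"
      using chi_eq_if_spanning[OF T _ spanning[OF pi(1)]] flat[of i] tr(2)[OF pi(1)] i by simp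
    moreover have "chi E r (Z (Suc i)) = chi T r (Y (Suc (i - p)))"
      using chi_eq_if_spanning[OF T _ spanning[OF pi(2)]] flat[of "Suc i"] tr(2)[OF pi(2)] i pi
      by simp
    ultimately show ?thesis using Yf(6) pi by auto
  qed
  have "Z (r E) = E"
    using flat_eqI[of "Z (r E)" E] flat[of "r E"] flat_subset by auto
  moreover have "Z 0 = {}" by (simp add: Z_def X)
  ultimately show "rank_flag E r Z" using flat step by (simp add: rank_flag_def)
qed

section \<open>Modular coatoms\<close>

lemma cl_exchange:
  assumes "S \<subseteq> E" "x \<in> E" "y \<in> E" "y \<in> rank_cl E r (insert x S)" "y \<notin> rank_cl E r S"
  shows "x \<in> rank_cl E r (insert y S)"
proof -
  have a: "r (insert x (insert y S)) = r (insert x S)"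
    using assms(4) by (simp add: rank_cl_def insert_commute)
  have b: "r (insert y S) = Suc (r S)"
    using assms rank_insert_le[of S y] rank_insert_ge[of S y] by (simp add: rank_cl_def)
  have "r (insert y S) \<le> r (insert x (insert y S))"
    using assms by (intro rank_insert_ge) auto
  then show ?thesis using a b rank_insert_le[of S x] assms by (simp add: rank_cl_def)
qed

text \<open>If every line through two elements outside \<open>T\<close> meets \<open>T\<close>, then
  any flat \<open>F\<close> not inside \<open>T\<close> is generated by \<open>F \<inter> T\<close>
  and a single element of \<open>F - T\<close>. So each such \<open>F\<close> has rank one more than
  its trace, which is modularity for a flat of corank one.\<close>

lemma modular_coatomI:
  assumes T: "T \<in> rank_flats E r" and ne: "T \<noteq> E"
    and loopless: "\<And>x. x \<in> E \<Longrightarrow> r {x} = 1"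
    and lines: "\<And>x y. x \<in> E - T \<Longrightarrow> y \<in> E - T \<Longrightarrow> x \<noteq> y \<Longrightarrow> \<exists>z\<in>T. z \<in> rank_cl E r {x, y}"
  shows "modular_flat E r T" and "r E = Suc (r T)"
proof -
  have TE: "T \<subseteq> E" using T flat_subset by simp
  have key: "y \<in> rank_cl E r (insert x (F \<inter> T))"
    if F: "F \<in> rank_flats E r" and xy: "x \<in> F - T" "y \<in> F - T" "x \<noteq> y" for F x y
  proof -
    have FE: "F \<subseteq> E" using F flat_subset by simp
    obtain z where z: "z \<in> T" "z \<in> rank_cl E r {x, y}" using lines[of x y] xy FE by auto
    have zF: "z \<in> F" using cl_least[OF F, of "{x, y}"] xy z by auto
    \<comment> \<open>Otherwise \<open>x\<close> and \<open>z\<close> would be parallel, and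
      \<open>x\<close> would lie in \<open>T\<close> along with \<open>z\<close>; here it matters
      that singletons have rank one. Exchange then puts \<open>y\<close> on the line through
      \<open>z\<close> and \<open>x\<close>.\<close>
    have "z \<notin> rank_cl E r {x}"
    proof
      assume "z \<in> rank_cl E r {x}"
      then have "r {z, x} = r {x}" by (simp add: rank_cl_def)
      then have "r (insert x {z}) = r {z}" using loopless[of x] loopless[of z] xy FE z TE
        by (metis DiffD1 insert_commute subsetD)
      then have "x \<in> T" using flat_memI[OF T, of "{z}" x] z xy FE by auto
      then show False using xy by simp
    qed
    then have "y \<in> rank_cl E r (insert z {x})"
      using cl_exchange[of "{x}" y z] z xy FE zF by (auto simp: insert_commute)
    moreover have "rank_cl E r (insert z {x}) \<subseteq> rank_cl E r (insert x (F \<inter> T))"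
    proof (rule cl_least[OF cl_flat])
      show "insert x (F \<inter> T) \<subseteq> E" using FE xy by auto
      from cl_extensive[OF this] show "insert z {x} \<subseteq> rank_cl E r (insert x (F \<inter> T))"
        using zF z by auto
    qed
    ultimately show ?thesis by blast
  qed
  have rk: "r F = Suc (r (F \<inter> T))" if F: "F \<in> rank_flats E r" and nT: "\<not> F \<subseteq> T" for F
  proof -
    have FE: "F \<subseteq> E" using F flat_subset by simp
    obtain x where x: "x \<in> F - T" using nT by auto
    have sub: "insert x (F \<inter> T) \<subseteq> E" using x FE by auto
    have "F \<subseteq> rank_cl E r (insert x (F \<inter> T))"
      using key[OF F x] cl_extensive[OF sub] by blast
    then have "r F = r (insert x (F \<inter> T))"
      using rank_mono[of F] rank_mono[of "insert x (F \<inter> T)" F] sub FE x rank_cl[OF sub] cl_subset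
      by (metis (no_types, lifting) DiffD1 Int_lower1 antisym insert_subset)
    moreover have "r (insert x (F \<inter> T)) \<noteq> r (F \<inter> T)"
      using flat_memI[OF T, of "F \<inter> T" x] x FE by auto
    ultimately show ?thesis
      using rank_insert_le[of "F \<inter> T" x] rank_insert_ge[of "F \<inter> T" x] sub by auto
  qed
  show rE: "r E = Suc (r T)" using rk[OF ground_flat] ne TE by (auto simp: Int_absorb1)
  show "modular_flat E r T"
    unfolding modular_flat_def
  proof (intro conjI ballI T)
    fix F assume F: "F \<in> rank_flats E r"
    show "r (F \<union> T) + r (F \<inter> T) = r F + r T"
    proof (cases "F \<subseteq> T")
      case False
      then have "\<not> r (F \<union> T) \<le> r T"
        using flat_eqI[OF T, of "F \<union> T"] F flat_subset TE by auto
      moreover have "r (F \<union> T) \<le> r E" using F flat_subset TE by (intro rank_mono) auto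
      ultimately show ?thesis using rk[OF F False] rE by auto
    qed (simp add: Un_absorb1 Int_absorb2)
  qed
qed

text \<open>For corank one the chain up to the complement is a single step, from the empty flat to
  the closure of any \<open>h\<close> outside \<open>T\<close>. Its divisibility is modular
  factorization: \<open>chi\<close> of that closure equals \<open>chi T r {}\<close>, which divides
  \<open>chi E r {}\<close>. Recording \<open>h\<close> in the conclusion lets later arguments
  choose the first hyperplane.\<close>

lemma flag_coatom:
  assumes T: "modular_flat E r T" and rE: "r E = Suc (r T)"
    and loopless: "\<And>x. x \<in> E \<Longrightarrow> r {x} = 1"
    and h: "h \<in> E - T" and Y: "rank_flag T r Y"
  obtains Z where "rank_flag E r Z" "\<forall>i\<le>r T. Z (Suc i) \<inter> T = Y i \<and> h \<in> Z (Suc i)"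
proof -
  note TE = modularD(2)[OF T]
  define X where "X = (\<lambda>i::nat. if i = 0 then {} else rank_cl E r {h})"
  have e: "{} \<in> rank_flats E r" using loopless rank_empty by (simp add: rank_flats_def)
  have cl: "rank_cl E r {h} \<in> rank_flats E r" "r (rank_cl E r {h}) = 1"
    using cl_flat[of "{h}"] h loopless by auto
  have disj: "rank_cl E r {h} \<inter> T = {}"
  proof -
    have False if x: "x \<in> rank_cl E r {h}" "x \<in> T" for x
    proof -
      have "r (insert h {x}) = r {x}"
        using x h loopless[of h] loopless[of x] TE by (auto simp: rank_cl_def insert_commute)
      then have "h \<in> T" using flat_memI[OF modularD(1)[OF T], of "{x}" h] x h by auto
      then show False using h by simp
    qed
    then show ?thesis by auto
  qed
  have "chi E r (rank_cl E r {h}) = chi T r {}"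
  proof -
    have "r (rank_cl E r {h} \<union> T) = r E"
      using modularD(3)[OF T cl(1)] cl(2) disj rE rank_empty by simp
    then show ?thesis using chi_eq_if_spanning[OF T cl(1)] disj by simp
  qed
  also have "\<dots> dvd chi E r {}" using chi_modular_dvd[OF T e] by simp
  finally have dvd: "chi E r (rank_cl E r {h}) dvd chi E r {}" .
  let ?Z = "\<lambda>i. if i \<le> 1 then X i else rank_cl E r (X 1 \<union> Y (i - 1))"
  have X: "1 + r T = r E" "X 0 = {}" "\<And>i. i \<le> 1 \<Longrightarrow> X i \<in> rank_flats E r" "\<And>i. i \<le> 1 \<Longrightarrow> r (X i) = i"
      "\<And>i. i < 1 \<Longrightarrow> X i \<subseteq> X (Suc i)"
      "\<And>i. i < 1 \<Longrightarrow> chi E r (X (Suc i)) dvd chi E r (X i)" "X 1 \<inter> T = {}"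
    using e cl rank_empty dvd disj rE by (auto simp: X_def)
  have flag: "rank_flag E r ?Z" by (rule flag_extend(1)[OF T X Y])
  have tr: "?Z i \<inter> T = Y (i - 1)" if "1 \<le> i" "i \<le> r E" for i
    by (rule flag_extend(2)[OF T X Y that])
  show ?thesis
  proof
    show "rank_flag E r ?Z" by fact
    show "\<forall>i\<le>r T. ?Z (Suc i) \<inter> T = Y i \<and> h \<in> ?Z (Suc i)"
    proof (intro allI impI)
      fix i assume i: "i \<le> r T"
      interpret T: matroid_rank_function T r using TE by (rule restrict)
      have "Y i \<subseteq> E" using T.rank_flagD(3)[OF Y i] T.flat_subset TE by auto
      then have "h \<in> ?Z (Suc i)"
        using cl_extensive[of "{h}"] cl_extensive[of "rank_cl E r {h} \<union> Y i"] h cl_subset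
        by (auto simp: X_def)
      then show "?Z (Suc i) \<inter> T = Y i \<and> h \<in> ?Z (Suc i)" using tr[of "Suc i"] i rE by simp
    qed
  qed
qed

text \<open>Both sides satisfy the recursion of \<open>sum_chi_fibre\<close>: a flat of \<open>E\<close> that misses \<open>E\<^sub>2\<close> is a flat of
  \<open>E\<^sub>1\<close> that misses \<open>E\<^sub>1 \<inter> E\<^sub>2\<close>.\<close>

lemma chi_glue:
  assumes E: "E = E1 \<union> E2" and E1: "E1 \<in> rank_flats E r" and E2: "modular_flat E r E2"
    and E12: "modular_flat E1 r (E1 \<inter> E2)"
    and "Z \<in> rank_flats E1 r" "Z \<inter> E2 = {}"
  shows "chi E r Z * chi (E1 \<inter> E2) r {} = chi E1 r Z * chi E2 r {}"
  using assms(5,6)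
proof (induction "card (E1 - Z)" arbitrary: Z rule: less_induct)
  case (less Z)
  have sub: "E1 \<subseteq> E" "E2 \<subseteq> E" using E by auto
  interpret E1: matroid_rank_function E1 r using sub(1) by (rule restrict)
  let ?U = "{Z' \<in> rank_flats E r. Z \<subset> Z' \<and> Z' \<inter> E2 = {}}"
  have ZE: "Z \<in> rank_flats E r" by (rule flat_of_flat[OF E1 less.prems(1)])
  have ZE1: "Z \<subseteq> E1" using less.prems E1.flat_subset by auto
  have e1: "{} \<in> rank_flats E2 r" and e2: "{} \<in> rank_flats (E1 \<inter> E2) r"
    using flat_restrict[OF ZE sub(2)] E1.flat_restrict[OF less.prems(1), of "E1 \<inter> E2"]
      less.prems(2) ZE1 by (auto simp: Int_absorb2 Int_assoc[symmetric])
  have Un: "{Z' \<in> rank_flats E r. Z \<subseteq> Z' \<and> Z' \<inter> E2 = {}} = insert Z ?U"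
    using less.prems ZE by auto
  have "Z' \<subseteq> E1 \<and> Z' \<inter> (E1 \<inter> E2) = {} \<longleftrightarrow> Z' \<inter> E2 = {}" if "Z' \<in> rank_flats E r" for Z'
    using flat_subset[OF that] E by auto
  then have Un1: "{Z' \<in> rank_flats E1 r. Z \<subseteq> Z' \<and> Z' \<inter> (E1 \<inter> E2) = {}} = insert Z ?U"
    unfolding flats_of_flat[OF E1] using Un by blast
  have fin: "finite ?U" using finite_flats by auto
  have "chi E r Z + sum (chi E r) ?U = monom 1 (r E - r E2 - r Z) * chi E2 r {}"
    using sum_chi_fibre[OF E2 ZE e1] less.prems(2) fin rank_empty unfolding Un by simp
  moreover have "chi E1 r Z + sum (chi E1 r) ?U
      = monom 1 (r E1 - r (E1 \<inter> E2) - r Z) * chi (E1 \<inter> E2) r {}"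
    using E1.sum_chi_fibre[OF E12 less.prems(1) e2] less.prems(2) fin rank_empty ZE1
    unfolding Un1 by (simp add: Int_assoc[symmetric] Int_absorb2)
  \<comment> \<open>With this the two powers of \<open>t\<close> above coincide, so that
    cross-multiplication makes the right-hand sides equal.\<close>
  moreover have "r E - r E2 = r E1 - r (E1 \<inter> E2)"
    using modularD(3)[OF E2 E1] E by simp
  moreover have "sum (chi E r) ?U * chi (E1 \<inter> E2) r {} = sum (chi E1 r) ?U * chi E2 r {}"
    unfolding sum_distrib_right
  proof (rule sum.cong[OF refl])
    fix Z' assume "Z' \<in> ?U"
    then have Z': "Z' \<in> rank_flats E1 r" "Z \<subset> Z'" "Z' \<inter> E2 = {}" "Z' \<subseteq> E1"
      using E flats_of_flat[OF E1] flat_subset[of Z'] by auto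
    then have "card (E1 - Z') < card (E1 - Z)"
      using E1.finite_ground by (intro psubset_card_mono) auto
    from less.hyps[OF this] Z'
    show "chi E r Z' * chi (E1 \<inter> E2) r {} = chi E1 r Z' * chi E2 r {}" by auto
  qed
  ultimately show ?case by (simp add: algebra_simps) (smt (verit, best) add_right_cancel distrib_left mult.commute mult.left_commute)
qed

text \<open>By \<open>chi_glue\<close> the divisibilities of \<open>X\<close> carry over to
  \<open>E\<close> as long as \<open>X i\<close> misses \<open>E2\<close>, after cancelling a
  nonzero polynomial. At rank \<open>p\<close> the flat \<open>X p\<close> is a complement of
  \<open>E2\<close>, and the chain continues along \<open>Y\<close>. The traces on \<open>E2\<close>
  are exported because avoidance of a looped complete subgraph inside \<open>E2\<close> is read off
  from them.\<close>

lemma flag_glue: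
  assumes E: "E = E1 \<union> E2" and E1: "E1 \<in> rank_flats E r" and E2: "modular_flat E r E2"
    and E12: "modular_flat E1 r (E1 \<inter> E2)"
    and X: "rank_flag E1 r X" "\<And>i. i \<le> r E1 - r (E1 \<inter> E2) \<Longrightarrow> X i \<inter> E2 = {}"
    and Y: "rank_flag E2 r Y"
  obtains Z where "rank_flag E r Z"
    "\<And>i. i \<le> r E - r E2 \<Longrightarrow> Z i \<inter> E2 = {}"
    "\<And>i. r E - r E2 \<le> i \<Longrightarrow> i \<le> r E \<Longrightarrow> Z i \<inter> E2 = Y (i - (r E - r E2))"
proof -
  have sub: "E1 \<subseteq> E" "E2 \<subseteq> E" using E by auto
  interpret E1: matroid_rank_function E1 r using sub(1) by (rule restrict)
  interpret E12: matroid_rank_function "E1 \<inter> E2" r by (rule restrict) (use sub in auto)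
  define p where "p = r E1 - r (E1 \<inter> E2)"
  have rk: "r E + r (E1 \<inter> E2) = r E1 + r E2" using modularD(3)[OF E2 E1] E by simp
  have "r (E1 \<inter> E2) \<le> r E1" by (rule E1.rank_mono) auto
  then have p: "p + r E2 = r E" "p \<le> r E1" "r E - r E2 = p" using rk by (auto simp: p_def)
  note Xf = E1.rank_flagD[OF X(1)]
  have disj: "X i \<inter> E2 = {}" if "i \<le> p" for i using X(2) that by (simp add: p_def)
  have nz: "chi (E1 \<inter> E2) r {} \<noteq> 0"
    using E12.chi_neq_0[of "{}"] E1.flat_restrict[OF Xf(3)[of 0], of "E1 \<inter> E2"] Xf(1) by simp
  have dvd: "chi E r (X (Suc i)) dvd chi E r (X i)" if i: "i < p" for i
  proof -
    have "chi E1 r (X (Suc i)) dvd chi E1 r (X i)" using Xf(6) i p by simp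
    moreover have "chi E r (X i) * chi (E1 \<inter> E2) r {} = chi E1 r (X i) * chi E2 r {}"
      "chi E r (X (Suc i)) * chi (E1 \<inter> E2) r {} = chi E1 r (X (Suc i)) * chi E2 r {}"
      using i p by (auto intro!: chi_glue E E1 E2 E12 disj Xf)
    ultimately have "chi E r (X (Suc i)) * chi (E1 \<inter> E2) r {} dvd chi E r (X i) * chi (E1 \<inter> E2) r {}"
      by (simp add: mult_dvd_mono)
    then show ?thesis using nz by simp
  qed
  let ?Z = "\<lambda>i. if i \<le> p then X i else rank_cl E r (X p \<union> Y (i - p))"
  have Xs: "X 0 = {}" "\<And>i. i \<le> p \<Longrightarrow> X i \<in> rank_flats E r" "\<And>i. i \<le> p \<Longrightarrow> r (X i) = i"
      "\<And>i. i < p \<Longrightarrow> X i \<subseteq> X (Suc i)"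
      "\<And>i. i < p \<Longrightarrow> chi E r (X (Suc i)) dvd chi E r (X i)" "X p \<inter> E2 = {}"
    using Xf p dvd disj flat_of_flat[OF E1] by auto
  show ?thesis
  proof
    show "rank_flag E r ?Z" by (rule flag_extend(1)[OF E2 p(1) Xs Y])
    show "?Z i \<inter> E2 = {}" if "i \<le> r E - r E2" for i using that p disj by auto
    show "?Z i \<inter> E2 = Y (i - (r E - r E2))" if "r E - r E2 \<le> i" "i \<le> r E" for i
      using flag_extend(2)[OF E2 p(1) Xs Y, of i] that p by simp
  qed
qed

end


section \<open>Characteristic polynomials of contractions\<close>

context matroid_rank_function begin

text \<open>Connects the recursion from the top that defines \<open>chi\<close> with the Moebius
  function from the bottom: each power of \<open>t\<close> is expanded as an upward sum of
  \<open>chi\<close> and the sums are exchanged; the Moebius values below a flat \<open>Z\<close>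
  then add up to \<open>0\<close> unless \<open>Z\<close> is empty.\<close>

lemma sum_moebius_chi:
  assumes e: "{} \<in> rank_flats E r"
  shows "(\<Sum>Y \<in> rank_flats E r. monom (bot_moebius (rank_flats E r) Y) (r E - r Y)) = chi E r {}"
proof -
  let ?L = "rank_flats E r" and ?c = "bot_moebius (rank_flats E r)"
  have "\<Inter>?L = {}" using e by auto
  then have c: "(\<Sum>Y \<in> {Y \<in> ?L. Y \<subseteq> Z}. ?c Y) = (if Z = {} then 1 else 0)" if Z: "Z \<in> ?L" for Z
  proof (cases "Z = {}")
    case True
    then have "{Y \<in> ?L. Y \<subseteq> Z} = {{}}" using e by auto
    then show ?thesis using True \<open>\<Inter>?L = {}\<close> by (simp add: bot_moebius.simps[of ?L "{}"])
  next
    case False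
    have "finite Z" using flat_subset[OF Z] finite_sub by auto
    then have "?c Z = - (\<Sum>Y \<in> {Y \<in> ?L. Y \<subset> Z}. ?c Y)"
      using False \<open>\<Inter>?L = {}\<close> bot_moebius.simps[of ?L Z] by simp
    moreover have "{Y \<in> ?L. Y \<subseteq> Z} = insert Z {Y \<in> ?L. Y \<subset> Z}" using Z by auto
    ultimately show ?thesis using False finite_flats by simp
  qed
  have "(\<Sum>Y\<in>?L. monom (?c Y) (r E - r Y))
      = (\<Sum>Y\<in>?L. \<Sum>Z \<in> {Z \<in> ?L. Y \<subseteq> Z}. smult (?c Y) (chi E r Z))"
  proof (rule sum.cong[OF refl])
    fix Y assume Y: "Y \<in> ?L"
    have "monom (?c Y) (r E - r Y) = [:?c Y:] * monom 1 (r E - r Y)" by (simp add: smult_monom)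
    also have "\<dots> = [:?c Y:] * (\<Sum>Z \<in> {Z \<in> ?L. Y \<subseteq> Z}. chi E r Z)"
      by (simp only: sum_chi_above[OF Y])
    also have "\<dots> = (\<Sum>Z \<in> {Z \<in> ?L. Y \<subseteq> Z}. smult (?c Y) (chi E r Z))"
      unfolding sum_distrib_left by simp
    finally show "monom (?c Y) (r E - r Y) = (\<Sum>Z \<in> {Z \<in> ?L. Y \<subseteq> Z}. smult (?c Y) (chi E r Z))" .
  qed
  also have "\<dots> = (\<Sum>Z\<in>?L. \<Sum>Y \<in> {Y \<in> ?L. Y \<subseteq> Z}. smult (?c Y) (chi E r Z))"
    by (rule sum.swap_restrict) (auto simp: finite_flats)
  also have "\<dots> = (\<Sum>Z\<in>?L. smult (\<Sum>Y \<in> {Y \<in> ?L. Y \<subseteq> Z}. ?c Y) (chi E r Z))"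
    by (simp add: smult_sum)
  also have "\<dots> = (\<Sum>Z\<in>?L. if Z = {} then chi E r Z else 0)"
    by (rule sum.cong[OF refl]) (simp add: c)
  also have "\<dots> = chi E r {}" using e finite_flats by (simp add: sum.delta)
  finally show ?thesis .
qed

lemma contract_rank_function:
  assumes "X \<subseteq> E"
  shows "matroid_rank_function (E - X) (\<lambda>S. r (S \<union> X) - r X)"
proof
  have ge: "r X \<le> r (S \<union> X)" if "S \<subseteq> E - X" for S
    using that assms by (intro rank_mono) auto
  show "finite (E - X)" using finite_ground by simp
  fix S x assume S: "S \<subseteq> E - X" "x \<in> E - X"
  have "r (S \<union> X) \<le> r (insert x (S \<union> X))" "r (insert x (S \<union> X)) \<le> Suc (r (S \<union> X))"
    using S assms by (auto intro!: rank_insert_ge rank_insert_le)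
  then show "r (S \<union> X) - r X \<le> r (insert x S \<union> X) - r X"
    "r (insert x S \<union> X) - r X \<le> Suc (r (S \<union> X) - r X)"
    by auto
next
  fix S S' x
  assume a: "S \<subseteq> S'" "S' \<subseteq> E - X" "x \<in> E - X" "r (insert x S \<union> X) - r X = r (S \<union> X) - r X"
  have "r X \<le> r (insert x S \<union> X)" "r X \<le> r (S \<union> X)"
    using a assms by (auto intro!: rank_mono)
  then have "r (insert x (S \<union> X)) = r (S \<union> X)" using a(4) by simp
  moreover have "S \<union> X \<subseteq> S' \<union> X" "S' \<union> X \<subseteq> E" "x \<in> E" using a assms by auto
  ultimately have "r (insert x (S' \<union> X)) = r (S' \<union> X)"
    using rank_insert_eq_mono[of "S \<union> X" "S' \<union> X" x] by blast
  then show "r (insert x S' \<union> X) - r X = r (S' \<union> X) - r X" by simp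
qed simp

lemma contract_flats:
  assumes "X \<subseteq> E"
  shows "rank_flats (E - X) (\<lambda>S. r (S \<union> X) - r X) = (\<lambda>F. F - X) ` {F \<in> rank_flats E r. X \<subseteq> F}"
proof (intro equalityI subsetI)
  fix Y assume Y: "Y \<in> rank_flats (E - X) (\<lambda>S. r (S \<union> X) - r X)"
  then have YE: "Y \<subseteq> E - X" by (simp add: rank_flats_def)
  have "Y \<union> X \<in> rank_flats E r"
    unfolding rank_flats_def
  proof (intro CollectI conjI ballI)
    fix x assume "x \<in> E - (Y \<union> X)"
    then have "r (Y \<union> X) - r X < r (insert x Y \<union> X) - r X" using Y by (simp add: rank_flats_def)
    then show "r (Y \<union> X) < r (insert x (Y \<union> X))" by simp
  qed (use YE assms in auto)
  moreover have "Y = Y \<union> X - X" using YE by auto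
  ultimately show "Y \<in> (\<lambda>F. F - X) ` {F \<in> rank_flats E r. X \<subseteq> F}" by blast
next
  fix Y assume "Y \<in> (\<lambda>F. F - X) ` {F \<in> rank_flats E r. X \<subseteq> F}"
  then obtain F where F: "F \<in> rank_flats E r" "X \<subseteq> F" "Y = F - X" by auto
  show "Y \<in> rank_flats (E - X) (\<lambda>S. r (S \<union> X) - r X)"
    unfolding rank_flats_def
  proof (intro CollectI conjI ballI)
    show "Y \<subseteq> E - X" using F flat_subset by auto
    fix x assume "x \<in> E - X - Y"
    then have "x \<in> E - F" using F by auto
    then have "r F < r (insert x F)" using F by (simp add: rank_flats_def)
    moreover have "r X \<le> r F" using F flat_subset by (intro rank_mono) auto
    moreover have "Y \<union> X = F" using F by auto
    ultimately show "r (Y \<union> X) - r X < r (insert x Y \<union> X) - r X" by simp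
  qed
qed

text \<open>Flats above \<open>X\<close> correspond to flats of the contraction with equal coranks,
  so the two recursions are the same.\<close>

lemma contract_chi:
  assumes "X \<subseteq> E" "F \<in> rank_flats E r" "X \<subseteq> F"
  shows "chi (E - X) (\<lambda>S. r (S \<union> X) - r X) (F - X) = chi E r F"
  using assms(2,3)
proof (induction "card (E - F)" arbitrary: F rule: less_induct)
  case (less F)
  let ?r = "\<lambda>S. r (S \<union> X) - r X"
  let ?U = "{F' \<in> rank_flats E r. F \<subset> F'}"
  have "(\<Sum>Y \<in> {Y \<in> rank_flats (E - X) ?r. F - X \<subset> Y}. chi (E - X) ?r Y)
      = (\<Sum>F' \<in> ?U. chi (E - X) ?r (F' - X))"
  proof (rule sum.reindex_cong[of "\<lambda>F. F - X"])
    show "inj_on (\<lambda>F. F - X) ?U" using less.prems by (intro inj_onI) auto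
    have "F - X \<subset> F' - X \<longleftrightarrow> F \<subset> F'" if "X \<subseteq> F'" for F' using that less.prems by blast
    then have "{Y \<in> (\<lambda>F. F - X) ` {F \<in> rank_flats E r. X \<subseteq> F}. F - X \<subset> Y}
        = (\<lambda>F. F - X) ` {F' \<in> rank_flats E r. X \<subseteq> F' \<and> F \<subset> F'}"
      by (smt (verit, best) Collect_cong image_def mem_Collect_eq)
    moreover have "{F' \<in> rank_flats E r. X \<subseteq> F' \<and> F \<subset> F'} = ?U" using less.prems by auto
    ultimately show "{Y \<in> rank_flats (E - X) ?r. F - X \<subset> Y} = (\<lambda>F. F - X) ` ?U"
      unfolding contract_flats[OF assms(1)] by simp
  qed simp
  also have "\<dots> = (\<Sum>F' \<in> ?U. chi E r F')"
  proof (rule sum.cong[OF refl])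
    fix F' assume F': "F' \<in> ?U"
    then have "E - F' \<subset> E - F" using flat_subset[of F'] by auto
    then have "card (E - F') < card (E - F)"
      using finite_ground by (intro psubset_card_mono) auto
    then show "chi (E - X) ?r (F' - X) = chi E r F'" using less F' by auto
  qed
  moreover have "?r (E - X) - ?r (F - X) = r E - r F"
  proof -
    have "E - X \<union> X = E" "F - X \<union> X = F" using less.prems assms by auto
    moreover have "r X \<le> r F" using less.prems flat_subset by (intro rank_mono) auto
    moreover have "r F \<le> r E" using less.prems flat_subset by (intro rank_mono) auto
    ultimately show ?thesis by simp
  qed
  ultimately show ?case
    using finite_ground
    by (simp add: chi.simps[of "E - X" ?r "F - X"] chi.simps[of E r F])
qed

section \<open>From independent sets to rank functions\<close>

lemma basis_extend:
  assumes "S \<subseteq> E" "I \<subseteq> S" "r I = card I"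
  obtains B where "I \<subseteq> B" "B \<subseteq> S" "r B = card B" "r B = r S"
proof -
  have "\<exists>B. I \<subseteq> B \<and> B \<subseteq> I \<union> C \<and> r B = card B \<and> r B = r (I \<union> C)" if "C \<subseteq> S" for C
    using finite_sub[OF subset_trans[OF that assms(1)]] that
  proof (induction C rule: finite_induct)
    case empty
    then show ?case using assms by auto
  next
    case (insert c C)
    then obtain B where B: "I \<subseteq> B" "B \<subseteq> I \<union> C" "r B = card B" "r B = r (I \<union> C)" by auto
    have sub: "I \<union> C \<subseteq> E" "c \<in> E" using insert.prems assms by auto
    then have "B \<subseteq> E" using B by blast
    note sub = sub this
    show ?case
    proof (cases "r (insert c (I \<union> C)) = r (I \<union> C)")
      case True
      then show ?thesis using B by (intro exI[of _ B]) auto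
    next
      case False
      have "r (insert c B) \<noteq> r B"
        using rank_insert_eq_mono[of B "I \<union> C" c] B sub False by auto
      then have "r (insert c B) = Suc (r B)"
        using rank_insert_le[of B c] rank_insert_ge[of B c] sub by auto
      moreover have "r (insert c (I \<union> C)) = Suc (r (I \<union> C))"
        using False rank_insert_le[of "I \<union> C" c] rank_insert_ge[of "I \<union> C" c] sub by auto
      moreover have "c \<notin> B" using \<open>r (insert c B) \<noteq> r B\<close> by (auto simp: insert_absorb)
      ultimately show ?thesis using B finite_sub[OF sub(3)] 
        by (intro exI[of _ "insert c B"]) auto
    qed
  qed
  from this[of S] that assms show ?thesis by (auto simp: Un_absorb1)
qed

context
  fixes M :: "'a matroid"
  assumes ground: "ground M = E"
    and indep: "\<And>S. indep M S \<longleftrightarrow> S \<subseteq> E \<and> r S = card S"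
begin

lemma matroid_rank_eq:
  assumes "S \<subseteq> E" shows "matroid_rank M S = r S"
proof -
  obtain B where B: "B \<subseteq> S" "r B = card B" "r B = r S"
    using basis_extend[of S "{}"] assms rank_empty by auto
  show ?thesis
    unfolding matroid_rank_def
  proof (rule Max_eqI)
    show "finite {card I |I. I \<subseteq> S \<and> indep M I}"
      by (rule finite_subset[of _ "card ` Pow S"]) (use assms finite_sub in auto)
    have "indep M B" using B assms by (simp add: indep)
    then show "r S \<in> {card I |I. I \<subseteq> S \<and> indep M I}" using B by (intro CollectI exI[of _ B]) simp
    show "y \<le> r S" if y: "y \<in> {card I |I. I \<subseteq> S \<and> indep M I}" for y
    proof -
      obtain I where "y = card I" "I \<subseteq> S" "indep M I" using y by blast
      then have "y = card I" "I \<subseteq> S" "r I = card I" by (auto simp: indep)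
      then show ?thesis using rank_mono[of I S] assms by simp
    qed
  qed
qed

lemma matroid_flats_eq: "matroid_flats M = rank_flats E r"
proof -
  have "(matroid_rank M F < matroid_rank M (insert x F)) = (r F < r (insert x F))"
    if "F \<subseteq> E" "x \<in> E - F" for F x
    using that by (simp add: matroid_rank_eq)
  then show ?thesis unfolding matroid_flats_def rank_flats_def ground by blast
qed

lemma matroid_basis_iff:
  assumes "X \<subseteq> E"
  shows "matroid_basis_of M X B \<longleftrightarrow> B \<subseteq> X \<and> r B = card B \<and> r B = r X"
proof
  assume B: "matroid_basis_of M X B"
  then have b: "B \<subseteq> X" "r B = card B" by (auto simp: matroid_basis_of_def indep)
  obtain C where C: "B \<subseteq> C" "C \<subseteq> X" "r C = card C" "r C = r X"
    using basis_extend[OF assms b] .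
  then have "C = B" using B assms by (auto simp: matroid_basis_of_def indep)
  then show "B \<subseteq> X \<and> r B = card B \<and> r B = r X" using C by simp
next
  assume B: "B \<subseteq> X \<and> r B = card B \<and> r B = r X"
  have "C = B" if "B \<subseteq> C" "C \<subseteq> X" "indep M C" for C
  proof -
    have "card C \<le> card B" using that rank_mono[of C X] assms B indep by auto
    then show ?thesis using that finite_sub[of C] assms by (metis card_seteq subset_trans)
  qed
  then show "matroid_basis_of M X B" using B assms by (auto simp: matroid_basis_of_def indep)
qed

text \<open>The definition of contraction asks for some basis \<open>B\<close> of \<open>X\<close>;
  every basis has the same closure as \<open>X\<close>, so
  \<open>r (I \<union> B) = r (I \<union> X)\<close> and the choice does not matter.\<close>

lemma matroid_contract_indep:
  assumes "X \<subseteq> E"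
  shows "indep (matroid_contract M X) I \<longleftrightarrow> I \<subseteq> E - X \<and> r (I \<union> X) - r X = card I"
proof (cases "I \<subseteq> E - X")
  case True
  obtain B0 where B0: "B0 \<subseteq> X" "r B0 = card B0" "r B0 = r X"
    using basis_extend[of X "{}"] assms rank_empty by auto
  have "r (I \<union> B) = r (I \<union> X) \<and> card (I \<union> B) = card I + card B" if B: "B \<subseteq> X" "r B = r X" for B
  proof
    have "X \<subseteq> rank_cl E r B"
    proof
      fix x assume "x \<in> X"
      then have "insert x B \<subseteq> X" "B \<subseteq> insert x B" "insert x B \<subseteq> E" using B assms by auto
      then have "r (insert x B) \<le> r X" "r B \<le> r (insert x B)" using assms by (auto intro: rank_mono)
      then show "x \<in> rank_cl E r B" using B \<open>x \<in> X\<close> assms by (auto simp: rank_cl_def)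
    qed
    then have "rank_cl E r B = rank_cl E r X"
      using B cl_least[OF cl_flat, of X B] cl_least[OF cl_flat, of B X] assms
        cl_extensive[of X] by (metis subset_antisym subset_trans)
    then show "r (I \<union> B) = r (I \<union> X)"
      using rank_cl_Un[of B I] rank_cl_Un[of X I] B assms True
      by (metis Diff_subset Un_commute subset_trans)
    show "card (I \<union> B) = card I + card B"
      using True B assms finite_sub[of I] finite_sub[of B] by (intro card_Un_disjoint) auto
  qed
  moreover have "r X \<le> r (I \<union> X)" using True assms by (intro rank_mono) auto
  moreover have "indep (matroid_contract M X) I \<longleftrightarrow>
      (\<exists>B. (B \<subseteq> X \<and> r B = card B \<and> r B = r X) \<and> r (I \<union> B) = card (I \<union> B))"
  proof -
    have "I \<union> B \<subseteq> E" if "B \<subseteq> X" for B using that True assms by blast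
    then show ?thesis
      using True by (simp add: matroid_contract_def ground indep matroid_basis_iff[OF assms]) blast
  qed
  ultimately show ?thesis using B0 True
    by (metis add_diff_cancel_right' le_add_diff_inverse2)
qed (simp add: matroid_contract_def ground)

end

lemma charpoly_eq_chi:
  assumes M: "ground M = E" "\<And>S. indep M S \<longleftrightarrow> S \<subseteq> E \<and> r S = card S"
    and X: "X \<in> rank_flats E r"
  shows "matroid_charpoly (matroid_contract M X) = chi E r X"
proof -
  have XE: "X \<subseteq> E" using X flat_subset by auto
  let ?r = "\<lambda>S. r (S \<union> X) - r X" and ?N = "matroid_contract M X"
  interpret C: matroid_rank_function "E - X" ?r by (rule contract_rank_function[OF XE])
  have N: "ground ?N = E - X" "\<And>S. indep ?N S \<longleftrightarrow> S \<subseteq> E - X \<and> ?r S = card S"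
    using matroid_contract_indep[OF M XE] M by (auto simp: matroid_contract_def)
  \<comment> \<open>As \<open>X\<close> is a flat, the contraction has no element of rank
    \<open>0\<close>, and its Moebius function starts at the empty set.\<close>
  have "{} \<in> rank_flats (E - X) ?r" using contract_flats[OF XE] X by blast
  then have "matroid_charpoly ?N = chi (E - X) ?r {}"
    unfolding matroid_charpoly_def C.matroid_flats_eq[OF N]
    using C.sum_moebius_chi C.matroid_rank_eq[OF N]
    by (subst C.sum_moebius_chi[symmetric])
       (auto simp: N C.flat_subset intro!: sum.cong)
  also have "\<dots> = chi E r X" using contract_chi[OF XE X] by simp
  finally show ?thesis .
qed

lemma divisional_flag_of_rank_flag:
  assumes M: "ground M = E" "\<And>S. indep M S \<longleftrightarrow> S \<subseteq> E \<and> r S = card S"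
    and X: "rank_flag E r X"
  shows "divisional_flag M (r E) X"
proof -
  note Xf = rank_flagD[OF X]
  show ?thesis
    unfolding divisional_flag_def matroid_flats_eq[OF M]
    using Xf M charpoly_eq_chi[OF M] matroid_rank_eq[OF M] flat_subset
    by (auto simp: Suc_le_eq)
qed

end


section \<open>Simplicial vertices of chordal graphs\<close>

text \<open>\<open>S\<close> stands for the subgraph induced on it, so that chordality can remain a
  hypothesis on the whole relation while vertices are removed.\<close>

definition simplicial_in :: "('v \<Rightarrow> 'v \<Rightarrow> bool) \<Rightarrow> 'v set \<Rightarrow> 'v \<Rightarrow> bool" where
  "simplicial_in adj S v \<longleftrightarrow> v \<in> S \<and>
     (\<forall>x\<in>S. \<forall>y\<in>S. adj v x \<longrightarrow> adj v y \<longrightarrow> x \<noteq> y \<longrightarrow> adj x y)"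

text \<open>A shortest walk from \<open>x\<close> to \<open>y\<close> through \<open>C\<close>, closed up by \<open>a\<close>, would be a chordless cycle.\<close>

lemma chordal_separator_clique:
  assumes chordal: "chordal adj" and sym: "symp adj"
    and a: "adj x a" "adj y a" "a \<notin> C" "\<And>c. c \<in> C \<Longrightarrow> \<not> adj a c"
    and xy: "x \<notin> C" "y \<notin> C" "x \<noteq> y" "x \<noteq> a" "y \<noteq> a"
    and walk: "(x, y) \<in> {(s, t). adj s t \<and> s \<in> C \<union> {x, y} \<and> t \<in> C \<union> {x, y}}\<^sup>*"
  shows "adj x y"
proof (rule ccontr)
  assume nadj: "\<not> adj x y"
  define R where "R = {(s, t). adj s t \<and> s \<in> C \<union> {x, y} \<and> t \<in> C \<union> {x, y}}"
  define n where "n = (LEAST n. (x, y) \<in> R ^^ n)"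
  have ex: "\<exists>n. (x, y) \<in> R ^^ n" using walk unfolding R_def[symmetric] by (simp add: rtrancl_power)
  have n: "(x, y) \<in> R ^^ n" unfolding n_def by (rule LeastI_ex[OF ex])
  have least: "n \<le> k" if "(x, y) \<in> R ^^ k" for k unfolding n_def using that by (rule Least_le)
  obtain f where f: "f 0 = x" "f n = y" "\<And>i. i < n \<Longrightarrow> (f i, f (Suc i)) \<in> R"
    using n by (auto simp: relpow_fun_conv)
  have seg: "(f i, f (i + k)) \<in> R ^^ k" if "i + k \<le> n" for i k
    unfolding relpow_fun_conv by (rule exI[of _ "\<lambda>j. f (i + j)"]) (use that f(3) in auto)
  \<comment> \<open>Replacing the segment from \<open>f i\<close> to \<open>f j\<close> by a shorter
    walk would contradict the minimality of \<open>n\<close>; the cases \<open>k = 0\<close> and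
    \<open>k = 1\<close> exclude repeated vertices and chords.\<close>
  have short: "j - i \<le> k" if "i \<le> j" "j \<le> n" "(f i, f j) \<in> R ^^ k" for i j k
  proof -
    have "(x, f i) \<in> R ^^ i" using seg[of 0 i] that f(1) by simp
    moreover have "(f j, y) \<in> R ^^ (n - j)" using seg[of j "n - j"] that f(2) by simp
    ultimately have "(x, y) \<in> R ^^ i O R ^^ k O R ^^ (n - j)" using that(3) by blast
    then have "(x, y) \<in> R ^^ (i + (k + (n - j)))" by (simp only: relpow_add)
    from least[OF this] show ?thesis using that by linarith
  qed
  have inj: "f i \<noteq> f j" if "i < j" "j \<le> n" for i j
    using short[of i j 0] that by auto
  \<comment> \<open>Distinct nonadjacent ends force at least two steps, so the cycle through
    \<open>a\<close> has at least four vertices.\<close>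
  have n2: "2 \<le> n"
  proof (rule ccontr)
    assume "\<not> 2 \<le> n"
    then consider "n = 0" | "n = 1" by linarith
    then show False using n xy(3) nadj by cases (auto simp: R_def)
  qed
  have dom: "f i \<in> C \<union> {x, y}" if "i \<le> n" for i
    using f(3)[of i] f(2) that by (cases "i = n") (auto simp: R_def)
  have chordless: "j = Suc i" if "i < j" "j \<le> n" "adj (f i) (f j)" for i j
  proof -
    have "(f i, f j) \<in> R ^^ 1" using that dom[of i] dom[of j] by (auto simp: R_def)
    from short[OF _ that(2) this] that show ?thesis by simp
  qed
  have interior: "f i \<in> C" if "0 < i" "i < n" for i
    using dom[of i] inj[of 0 i] inj[of i n] f(1,2) that by auto
  have fa: "f i \<noteq> a" if "i \<le> n" for i using dom[OF that] a xy by auto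
  have adja: "i = 0 \<or> i = n" if "adj a (f i)" "i \<le> n" for i
    using interior[of i] a(4) that by force
  define xs where "xs = a # map f [0..<Suc n]"
  have len: "length xs = n + 2" by (simp add: xs_def)
  have nth: "xs ! 0 = a" "\<And>i. i \<le> n \<Longrightarrow> xs ! Suc i = f i" by (auto simp: xs_def nth_append simp del: upt_Suc)
  have "inj_on f {0..<Suc n}"
    by (rule inj_onI) (metis atLeastLessThan_iff inj less_Suc_eq_le linorder_neqE_nat)
  moreover have "a \<notin> f ` {0..<Suc n}" by (metis fa imageE atLeastLessThan_iff less_Suc_eq_le)
  ultimately have "distinct xs" by (simp add: xs_def distinct_map del: upt_Suc)
  moreover have "adj (xs ! i) (xs ! (Suc i mod length xs))" if "i < length xs" for i
  proof (cases i)
    case 0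
    then show ?thesis using nth a(1) sym f(1) n2 len by (auto dest: sympD)
  next
    case (Suc k)
    show ?thesis
    proof (cases "k = n")
      case True then show ?thesis using Suc len nth f a by simp
    next
      case False
      then have "k < n" using Suc that len by simp
      then show ?thesis using Suc len nth f(3)[of k] by (simp add: R_def)
    qed
  qed
  moreover have "4 \<le> length xs" using len n2 by simp
  ultimately have "\<exists>i<length xs. \<exists>j<length xs. i \<noteq> j \<and> j \<noteq> Suc i mod length xs
      \<and> i \<noteq> Suc j mod length xs \<and> adj (xs ! i) (xs ! j)"
    using chordal[unfolded chordal_def Let_def, rule_format, of xs] by blast
  then obtain i j where ij: "i < length xs" "j < length xs" "i \<noteq> j" "j \<noteq> Suc i mod length xs"
      "i \<noteq> Suc j mod length xs" "adj (xs ! i) (xs ! j)"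
    by blast
  have no: False if lt: "i < j" and "j < length xs" "j \<noteq> Suc i mod length xs" "i \<noteq> Suc j mod length xs"
    "adj (xs ! i) (xs ! j)" for i j
  proof (cases i)
    case 0
    obtain k where k: "j = Suc k" using lt by (cases j) auto
    have "k = 0 \<or> k = n" using adja[of k] lt that k 0 nth len by auto
    then show False using lt that k 0 len by auto
  next
    case (Suc i')
    then obtain k where k: "j = Suc k" using lt by (cases j) auto
    have "k = Suc i'" using chordless[of i' k] lt that k Suc nth len by auto
    then show False using lt that k Suc len by auto
  qed
  show False
  proof (cases "i < j")
    case True then show False using no[of i j] ij by blast
  next
    case False
    then have "j < i" using ij by simp
    then show False using no[of j i] ij sympD[OF sym] by blast
  qed
qed

text \<open>Dirac's argument. \<open>C\<close> is the component of \<open>b\<close> among the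
  non-neighbours of \<open>a\<close>; its boundary \<open>D\<close> consists of neighbours of
  \<open>a\<close> and is a clique by the separator lemma. Within \<open>S\<close>, vertices of
  \<open>C\<close> have all their neighbours in \<open>C \<union> D\<close>, which is smaller than
  \<open>S\<close> because it omits \<open>a\<close>; so a vertex of \<open>C\<close> that is
  simplicial there is simplicial in \<open>S\<close>. Asking for a vertex not adjacent to
  \<open>a\<close> is what keeps the induction hypothesis from returning a vertex of
  \<open>D\<close>.\<close>

lemma chordal_simplicial_avoiding:
  assumes chordal: "chordal adj" and sym: "symp adj" and "finite S"
    and "a \<in> S" "b \<in> S" "b \<noteq> a" "\<not> adj a b"
  shows "\<exists>v. simplicial_in adj S v \<and> v \<noteq> a \<and> \<not> adj a v"
  using assms(3-)
proof (induction "card S" arbitrary: S a b rule: less_induct)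
  case (less S a b)
  note symD = sympD[OF sym]
  define N where "N = {v \<in> S. v \<noteq> a \<and> \<not> adj a v}"
  define R where "R = {(s, t). adj s t \<and> s \<in> N \<and> t \<in> N}"
  define C where "C = {v. (b, v) \<in> R\<^sup>*}"
  define D where "D = {v \<in> S - C. \<exists>c\<in>C. adj v c}"
  have bN: "b \<in> N" using less.prems by (auto simp: N_def)
  have CN: "C \<subseteq> N"
  proof
    fix v assume "v \<in> C"
    then have "(b, v) \<in> R\<^sup>*" by (simp add: C_def)
    then show "v \<in> N" by cases (use bN in \<open>auto simp: R_def\<close>)
  qed
  have bC: "b \<in> C" by (simp add: C_def)
  have CR: "t \<in> C" if "s \<in> C" "adj s t" "t \<in> N" for s t
  proof -
    have "(s, t) \<in> R" using that CN by (auto simp: R_def)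
    then show ?thesis using that by (auto simp: C_def intro: rtrancl_into_rtrancl)
  qed
  have Da: "adj x a" "x \<noteq> a" if x: "x \<in> D" for x
  proof -
    obtain c where c: "c \<in> C" "adj x c" "x \<in> S" "x \<notin> C" using x by (auto simp: D_def)
    have "x \<notin> N" using CR[of c x] c symD by auto
    moreover have "x \<noteq> a" using c CN symD by (auto simp: N_def)
    ultimately show "adj x a" "x \<noteq> a" using c symD by (auto simp: N_def)
  qed
  have clique: "adj x y" if xy: "x \<in> D" "y \<in> D" "x \<noteq> y" for x y
  proof (rule chordal_separator_clique[OF chordal sym, of x a y C])
    let ?R = "{(s, t). adj s t \<and> s \<in> C \<union> {x, y} \<and> t \<in> C \<union> {x, y}}"
    obtain c d where c: "c \<in> C" "adj x c" "d \<in> C" "adj y d" using xy by (auto simp: D_def)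
    have bc: "(b, v) \<in> ?R\<^sup>* \<and> (v, b) \<in> ?R\<^sup>*" if "v \<in> C" for v
    proof -
      have "(b, v) \<in> R\<^sup>*" using that by (simp add: C_def)
      then show ?thesis
      proof (induction rule: rtrancl_induct)
        case (step u w)
        then have "u \<in> C" "w \<in> C" "adj u w"
          by (auto simp: C_def R_def intro: rtrancl_into_rtrancl)
        then have "(u, w) \<in> ?R" "(w, u) \<in> ?R" using symD by auto
        then show ?case using step.IH
          by (meson converse_rtrancl_into_rtrancl rtrancl_into_rtrancl)
      qed simp
    qed
    have "(x, c) \<in> ?R" "(d, y) \<in> ?R" using c symD by auto
    moreover have "(c, d) \<in> ?R\<^sup>*" using bc[OF c(1)] bc[OF c(3)] by (meson rtrancl_trans)
    ultimately show "(x, y) \<in> ?R\<^sup>*"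
      by (meson converse_rtrancl_into_rtrancl rtrancl_into_rtrancl)
  qed (use xy Da CN in \<open>auto simp: D_def N_def\<close>)
  let ?S = "C \<union> D"
  have sub: "?S \<subseteq> S - {a}" using CN Da by (auto simp: N_def D_def)
  then have card: "card ?S < card S" and fin: "finite ?S"
    using less.prems by (auto intro!: psubset_card_mono intro: finite_subset)
  have "\<exists>v\<in>C. simplicial_in adj ?S v"
  proof (cases "\<exists>c\<in>?S. \<exists>d\<in>?S. c \<noteq> d \<and> \<not> adj c d")
    case False
    then show ?thesis using bC by (intro bexI[of _ b]) (auto simp: simplicial_in_def)
  next
    case True
    \<comment> \<open>\<open>c\<close> is taken in \<open>D\<close> whenever some vertex of
      \<open>D\<close> has a non-neighbour. A simplicial vertex not adjacent to \<open>c\<close>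
      then lies outside \<open>D\<close>: if \<open>c\<close> is in \<open>D\<close>, this holds
      because \<open>D\<close> is a clique, and if not, because every vertex of \<open>D\<close> is
      adjacent to \<open>c\<close>.\<close>
    obtain c d where cd: "c \<in> ?S" "d \<in> ?S" "c \<noteq> d" "\<not> adj c d"
      "(\<exists>x\<in>D. \<exists>y\<in>?S. x \<noteq> y \<and> \<not> adj x y) \<longrightarrow> c \<in> D"
      using True by blast
    obtain v where v: "simplicial_in adj ?S v" "v \<noteq> c" "\<not> adj c v"
      using less.hyps[OF card fin cd(1,2) _ cd(4)] cd(3) by auto
    have "v \<notin> D"
    proof
      assume vD: "v \<in> D"
      then have "c \<notin> D" using clique[of c v] v by auto
      then have "adj v c" using cd(1,5) v(2) vD by blast
      then show False using v(3) symD by blast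
    qed
    then show ?thesis using v by (auto simp: simplicial_in_def)
  qed
  then obtain v where v: "v \<in> C" "simplicial_in adj ?S v" by blast
  have nb: "x \<in> ?S" if "x \<in> S" "adj v x" for x
    using that v(1) symD by (auto simp: D_def)
  have "simplicial_in adj S v"
    using v nb sub unfolding simplicial_in_def by blast
  then show ?case using v CN by (auto simp: N_def)
qed

lemma chordal_simplicial_exists:
  assumes "chordal adj" "symp adj" "finite S" "S \<noteq> {}"
  obtains v where "simplicial_in adj S v"
proof (cases "\<exists>a\<in>S. \<exists>b\<in>S. b \<noteq> a \<and> \<not> adj a b")
  case True
  then show ?thesis using chordal_simplicial_avoiding[OF assms(1-3)] that by blast
next
  case False
  obtain v where "v \<in> S" using assms(4) by auto
  moreover have "adj x y" if "x \<in> S" "y \<in> S" "x \<noteq> y" for x y using that False by auto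
  ultimately have "simplicial_in adj S v" by (simp add: simplicial_in_def)
  then show ?thesis by (rule that)
qed


section \<open>Arrangements of hyperplanes in a coordinate space\<close>

definition sols :: "'v set \<Rightarrow> ('v \<Rightarrow> 'k::field) set set \<Rightarrow> ('v \<Rightarrow> 'k) set" where
  "sols V S = coord_space V \<inter> \<Inter>S"

definition hyp_rank :: "'v set \<Rightarrow> ('v \<Rightarrow> 'k::field) set set \<Rightarrow> nat" where
  "hyp_rank V S = codim V (sols V S)"

text \<open>The functional is defined on all functions and only its kernel is cut down to
  \<open>coord_space V\<close>; the inequality excludes functionals that vanish on that
  space.\<close>

definition hyperplane_in :: "'v set \<Rightarrow> ('v \<Rightarrow> 'k::field) set \<Rightarrow> bool" where
  "hyperplane_in V H \<longleftrightarrow> H \<noteq> coord_space V \<and>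
     (\<exists>f. (\<forall>x y. f (x + y) = f x + f y) \<and> (\<forall>c x. f (\<lambda>v. c * x v) = c * f x) \<and>
       H = {x \<in> coord_space V. f x = 0})"

definition unit_vec :: "'v \<Rightarrow> 'v \<Rightarrow> 'k::field" where
  "unit_vec v = (\<lambda>w. if w = v then 1 else 0)"

section \<open>Dimension and codimension\<close>

lemma coord_space_span:
  assumes "finite V"
  shows "coord_space V \<subseteq> fun_space.span (unit_vec ` V :: ('v \<Rightarrow> 'k::field) set)"
  using assms
proof (induction V rule: finite_induct)
  case empty
  have "coord_space {} = {0 :: 'v \<Rightarrow> 'k}" by (auto simp: coord_space_def)
  then show ?case by (simp add: fun_space.span_zero)
next
  case (insert v V)
  show ?case
  proof
    fix x :: "'v \<Rightarrow> 'k" assume x: "x \<in> coord_space (insert v V)"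
    let ?x = "\<lambda>w. if w = v then 0 else x w"
    have "?x \<in> coord_space V" using x by (auto simp: coord_space_def)
    then have "?x \<in> fun_space.span (unit_vec ` insert v V)"
      using insert.IH fun_space.span_mono[of "unit_vec ` V" "unit_vec ` insert v V"] by auto
    moreover have "(\<lambda>w. x v * unit_vec v w) \<in> fun_space.span (unit_vec ` insert v V)"
      by (intro fun_space.span_scale fun_space.span_base) simp
    ultimately have "?x + (\<lambda>w. x v * unit_vec v w) \<in> fun_space.span (unit_vec ` insert v V)"
      by (rule fun_space.span_add)
    moreover have "?x + (\<lambda>w. x v * unit_vec v w) = x" by (auto simp: unit_vec_def)
    ultimately show "x \<in> fun_space.span (unit_vec ` insert v V)" by simp
  qed
qed

lemma finite_independent_coord:
  assumes "finite V" "fun_space.independent B" "B \<subseteq> coord_space V"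
  shows "finite B"
  using fun_space.independent_span_bound[of "unit_vec ` V" B] assms coord_space_span[OF assms(1)]
  by blast

lemma dim_le_coord_space:
  fixes U :: "('v \<Rightarrow> 'k::field) set"
  assumes "finite V" "U \<subseteq> coord_space V"
  shows "fun_space.dim U \<le> fun_space.dim (coord_space V :: ('v \<Rightarrow> 'k) set)"
proof -
  obtain B :: "('v \<Rightarrow> 'k) set" where B: "B \<subseteq> coord_space V" "fun_space.independent B"
    "coord_space V \<subseteq> fun_space.span B" "card B = fun_space.dim (coord_space V :: ('v \<Rightarrow> 'k) set)"
    by (rule fun_space.basis_exists)
  then show ?thesis
    using fun_space.dim_le_card[of U B] finite_independent_coord[OF assms(1) B(2,1)] assms by auto
qed

text \<open>A basis of the section together with \<open>w\<close> is a basis of \<open>U\<close>: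
  subtracting from \<open>x\<close> the multiple of \<open>w\<close> with the same value of
  \<open>f\<close> leaves a vector of the section.\<close>

lemma dim_hyperplane_section:
  fixes f :: "('v \<Rightarrow> 'k::field) \<Rightarrow> 'k"
  assumes "finite V" and U: "U \<subseteq> coord_space V" "fun_space.subspace U"
    and f: "\<And>x y. f (x + y) = f x + f y" "\<And>c x. f (\<lambda>v. c * x v) = c * f x"
    and w: "w \<in> U" "f w \<noteq> 0"
  shows "fun_space.dim U = Suc (fun_space.dim (U \<inter> {x. f x = 0}))"
proof -
  let ?W = "U \<inter> {x. f x = 0}"
  have W: "fun_space.subspace ?W"
  proof (rule fun_space.subspaceI)
    have "f 0 = 0" using f(2)[of 0 0] by (simp add: zero_fun_def)
    then show "0 \<in> ?W" using U(2) fun_space.subspace_0 by auto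
    show "x + y \<in> ?W" if "x \<in> ?W" "y \<in> ?W" for x y
      using that f(1) U(2) fun_space.subspace_add by auto
    show "(\<lambda>v. c * x v) \<in> ?W" if "x \<in> ?W" for c x
      using that f(2) U(2) fun_space.subspace_scale[of U x c] by auto
  qed
  obtain B where B: "B \<subseteq> ?W" "fun_space.independent B" "?W \<subseteq> fun_space.span B"
    "card B = fun_space.dim ?W"
    by (rule fun_space.basis_exists)
  have fin: "finite B" by (rule finite_independent_coord[OF assms(1) B(2)]) (use B U in auto)
  have "fun_space.span B \<subseteq> ?W" by (rule fun_space.span_minimal[OF B(1) W])
  then have wB: "w \<notin> fun_space.span B" using w by auto
  have "fun_space.independent (insert w B)" using fun_space.independent_insertI[OF wB B(2)] .
  moreover have "insert w B \<subseteq> U" using B w by auto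
  moreover have "U \<subseteq> fun_space.span (insert w B)"
  proof
    fix x assume x: "x \<in> U"
    define c where "c = f x / f w"
    have "x + (\<lambda>v. - c * w v) \<in> ?W"
    proof -
      have "(\<lambda>v. - c * w v) \<in> U" using U(2) w(1) by (rule fun_space.subspace_scale)
      moreover have "f (x + (\<lambda>v. - c * w v)) = f x + - c * f w" by (simp only: f)
      then have "f (x + (\<lambda>v. - c * w v)) = 0" using w(2) by (simp add: c_def)
      ultimately show ?thesis using x U(2) fun_space.subspace_add by auto
    qed
    then have "x + (\<lambda>v. - c * w v) \<in> fun_space.span (insert w B)"
      using B(3) fun_space.span_mono[of B "insert w B"] by auto
    moreover have "(\<lambda>v. c * w v) \<in> fun_space.span (insert w B)"
      by (intro fun_space.span_scale fun_space.span_base) simp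
    ultimately have "x + (\<lambda>v. - c * w v) + (\<lambda>v. c * w v) \<in> fun_space.span (insert w B)"
      by (rule fun_space.span_add)
    moreover have "x + (\<lambda>v. - c * w v) + (\<lambda>v. c * w v) = x" by (auto simp: fun_eq_iff)
    ultimately show "x \<in> fun_space.span (insert w B)" by (simp only:)
  qed
  ultimately have "card (insert w B) = fun_space.dim U"
    using fun_space.basis_card_eq_dim by blast
  moreover have "w \<notin> B" using wB fun_space.span_base by blast
  ultimately show ?thesis using fin B(4) by simp
qed

lemma coord_space_subspace: "fun_space.subspace (coord_space V :: ('v \<Rightarrow> 'k::field) set)"
  by (rule fun_space.subspaceI) (auto simp: coord_space_def)

lemma hyperplane_subspace:
  assumes "hyperplane_in V H" shows "fun_space.subspace H"
proof -
  obtain f where f: "\<And>x y. f (x + y) = f x + f y" "\<And>c x. f (\<lambda>v. c * x v) = c * f x"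
    "H = {x \<in> coord_space V. f x = 0}"
    using assms by (auto simp: hyperplane_in_def)
  have "f 0 = 0" using f(2)[of 0 0] by (simp add: zero_fun_def)
  then show ?thesis unfolding f(3)
    by (intro fun_space.subspaceI) (auto simp: f(1,2) coord_space_def)
qed

lemma sols_subspace:
  assumes "\<forall>H\<in>S. hyperplane_in V H" shows "fun_space.subspace (sols V S)"
proof -
  have "fun_space.subspace H" if "H \<in> insert (coord_space V) S" for H
    using that assms coord_space_subspace hyperplane_subspace by blast
  then have "fun_space.subspace (\<Inter>(insert (coord_space V) S))"
    using fun_space.subspace_Inter by blast
  then show ?thesis by (simp add: sols_def)
qed

lemma hyp_rank_insert:
  assumes "finite V" and S: "\<forall>H\<in>S. hyperplane_in V H" and H: "hyperplane_in V H"
  shows "hyp_rank V (insert H S) = (if sols V S \<subseteq> H then hyp_rank V S else Suc (hyp_rank V S))"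
proof (cases "sols V S \<subseteq> H")
  case True
  then have "sols V (insert H S) = sols V S" by (auto simp: sols_def)
  then show ?thesis using True by (simp add: hyp_rank_def)
next
  case False
  obtain f where f: "\<And>x y. f (x + y) = f x + f y" "\<And>c x. f (\<lambda>v. c * x v) = c * f x"
    "H = {x \<in> coord_space V. f x = 0}"
    using H by (auto simp: hyperplane_in_def)
  obtain w where w: "w \<in> sols V S" "w \<notin> H" using False by auto
  then have fw: "f w \<noteq> 0" by (auto simp: f(3) sols_def)
  have "fun_space.dim (sols V S) = Suc (fun_space.dim (sols V S \<inter> {x. f x = 0}))"
    by (rule dim_hyperplane_section[OF assms(1) _ sols_subspace[OF S] f(1,2) w(1) fw])
       (simp add: sols_def)
  moreover have "sols V S \<inter> {x. f x = 0} = sols V (insert H S)" by (auto simp: sols_def f(3))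
  \<comment> \<open>\<open>codim\<close> is a truncated difference, so raising it by one needs this
    bound.\<close>
  moreover have "fun_space.dim (sols V S) \<le> fun_space.dim (coord_space V :: ('a \<Rightarrow> 'b) set)"
    by (rule dim_le_coord_space[OF assms(1)]) (simp add: sols_def)
  ultimately show ?thesis using False by (simp add: hyp_rank_def codim_def)
qed

lemma hyp_rank_empty: "hyp_rank V {} = 0"
  by (simp add: hyp_rank_def sols_def codim_def)

lemma sols_antimono: "S \<subseteq> S' \<Longrightarrow> sols V S' \<subseteq> sols V S"
  by (auto simp: sols_def)

lemma hyp_rank_loopless:
  assumes "finite V" "hyperplane_in V H" shows "hyp_rank V {H} = 1"
proof -
  have "\<not> sols V {} \<subseteq> H" using assms(2) by (auto simp: sols_def hyperplane_in_def)
  then show ?thesis using hyp_rank_insert[of V "{}" H] assms by (simp add: hyp_rank_empty)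
qed

section \<open>The matroid of an arrangement\<close>

locale hyperplane_arrangement =
  fixes V :: "'v set" and E :: "('v \<Rightarrow> 'k::field) set set"
  assumes finite_V: "finite V" and finite_E: "finite E"
    and hyperplanes: "H \<in> E \<Longrightarrow> hyperplane_in V H"
begin

lemma rank_insert_iff:
  assumes "S \<subseteq> E" "H \<in> E"
  shows "hyp_rank V (insert H S) = (if sols V S \<subseteq> H then hyp_rank V S else Suc (hyp_rank V S))"
  using hyp_rank_insert[OF finite_V, of S H] assms hyperplanes by blast

lemma rank_function: "matroid_rank_function E (hyp_rank V)"
proof
  show "finite E" by (rule finite_E)
  show "hyp_rank V {} = 0" by (rule hyp_rank_empty)
  show "hyp_rank V S \<le> hyp_rank V (insert H S)" "hyp_rank V (insert H S) \<le> Suc (hyp_rank V S)"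
    if "S \<subseteq> E" "H \<in> E" for S H
    using rank_insert_iff[OF that] by auto
  show "hyp_rank V (insert H S') = hyp_rank V S'"
    if "S \<subseteq> S'" "S' \<subseteq> E" "H \<in> E" "hyp_rank V (insert H S) = hyp_rank V S" for S S' H
  proof -
    have "sols V S \<subseteq> H"
      using rank_insert_iff[of S H] that by (cases "sols V S \<subseteq> H") auto
    then have "sols V S' \<subseteq> H" using sols_antimono[OF that(1)] by auto
    then show ?thesis using rank_insert_iff[OF that(2,3)] by simp
  qed
qed

sublocale matroid_rank_function E "hyp_rank V"
  by (rule rank_function)

lemma rank_singleton: "H \<in> E \<Longrightarrow> hyp_rank V {H} = 1"
  by (rule hyp_rank_loopless[OF finite_V hyperplanes])

lemma mem_cl_iff:
  assumes "S \<subseteq> E"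
  shows "H \<in> rank_cl E (hyp_rank V) S \<longleftrightarrow> H \<in> E \<and> sols V S \<subseteq> H"
  using rank_insert_iff[OF assms, of H] by (cases "sols V S \<subseteq> H") (auto simp: rank_cl_def)

lemma flat_iff:
  "F \<in> rank_flats E (hyp_rank V) \<longleftrightarrow> F \<subseteq> E \<and> (\<forall>H\<in>E - F. \<not> sols V F \<subseteq> H)"
proof -
  have "hyp_rank V F < hyp_rank V (insert H F) \<longleftrightarrow> \<not> sols V F \<subseteq> H" if "F \<subseteq> E" "H \<in> E - F" for H
    using rank_insert_iff[OF that(1), of H] that by simp
  then show ?thesis unfolding rank_flats_def by blast
qed

text \<open>The geometric source of modularity. Hyperplanes in \<open>T\<close> see only the
  coordinates in \<open>W\<close>, and on these coordinates a flat \<open>F\<close> imposes nothing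
  beyond the equations of \<open>F \<inter> T\<close>. Hence, adding the elements of
  \<open>T\<close> one by one to \<open>F\<close> and to \<open>F \<inter> T\<close>, each raises
  the rank in both cases or in neither.\<close>

lemma modular_if_extension:
  assumes T: "T \<in> rank_flats E (hyp_rank V)"
    and dep: "\<And>H x y. H \<in> T \<Longrightarrow> x \<in> H \<Longrightarrow> y \<in> coord_space V \<Longrightarrow> (\<forall>w\<in>W. y w = x w) \<Longrightarrow> y \<in> H"
    and ext: "\<And>F x. F \<in> rank_flats E (hyp_rank V) \<Longrightarrow> x \<in> sols V (F \<inter> T) \<Longrightarrow>
      \<exists>y\<in>sols V F. \<forall>w\<in>W. y w = x w"
  shows "modular_flat E (hyp_rank V) T"
  unfolding modular_flat_def
proof (intro conjI ballI T)
  let ?r = "hyp_rank V"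
  fix F assume F: "F \<in> rank_flats E ?r"
  have sub: "F \<subseteq> E" "T \<subseteq> E" using F T flat_subset by auto
  have step: "sols V S \<subseteq> H" if S: "F \<inter> T \<subseteq> S" "S \<subseteq> T" "H \<in> T" "sols V (F \<union> S) \<subseteq> H" for S H
  proof
    fix x assume x: "x \<in> sols V S"
    then obtain y where y: "y \<in> sols V F" "\<forall>w\<in>W. y w = x w"
      using ext[OF F, of x] sols_antimono[OF S(1)] by blast
    have "y \<in> H'" if "H' \<in> S" for H'
      using dep[of H' x y] that S(2) x y by (auto simp: sols_def)
    then have "y \<in> H" using S(4) y(1) by (auto simp: sols_def)
    then show "x \<in> H" using dep[OF S(3), of y x] x y(2) by (auto simp: sols_def)
  qed
  have "?r (F \<union> C) + ?r (F \<inter> T) = ?r F + ?r (F \<inter> T \<union> C)" if "C \<subseteq> T" for C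
    using finite_sub[OF subset_trans[OF that sub(2)]] that
  proof (induction C rule: finite_induct)
    case (insert c C)
    have c: "c \<in> T" "c \<in> E" "F \<union> C \<subseteq> E" "F \<inter> T \<union> C \<subseteq> E" using insert.prems sub by auto
    have "sols V (F \<union> C) \<subseteq> c \<longleftrightarrow> sols V (F \<inter> T \<union> C) \<subseteq> c"
    proof
      assume "sols V (F \<union> C) \<subseteq> c"
      moreover have "F \<union> (F \<inter> T \<union> C) = F \<union> C" by auto
      ultimately show "sols V (F \<inter> T \<union> C) \<subseteq> c"
        using step[of "F \<inter> T \<union> C" c] insert.prems by auto
    next
      assume "sols V (F \<inter> T \<union> C) \<subseteq> c"
      then show "sols V (F \<union> C) \<subseteq> c" using sols_antimono[of "F \<inter> T \<union> C" "F \<union> C" V] by auto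
    qed
    then show ?case
      using insert.IH insert.prems rank_insert_iff[OF c(3,2)] rank_insert_iff[OF c(4,2)] by simp
  qed simp
  from this[of T] show "?r (F \<union> T) + ?r (F \<inter> T) = ?r F + ?r T"
    by (simp add: Un_absorb1)
qed

text \<open>In the matroid, \<open>H \<inter> H' \<subseteq> K\<close> says that \<open>K\<close>
  lies on the line spanned by \<open>H\<close> and \<open>H'\<close>.\<close>

lemma modular_coatom_if_lines:
  assumes T: "T \<in> rank_flats E (hyp_rank V)" and ne: "T \<noteq> E"
    and lines: "\<And>H H'. H \<in> E - T \<Longrightarrow> H' \<in> E - T \<Longrightarrow> H \<noteq> H' \<Longrightarrow> \<exists>K\<in>T. H \<inter> H' \<subseteq> K"
  shows "modular_flat E (hyp_rank V) T" and "hyp_rank V E = Suc (hyp_rank V T)"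
proof -
  have "\<exists>K\<in>T. K \<in> rank_cl E (hyp_rank V) {H, H'}" if "H \<in> E - T" "H' \<in> E - T" "H \<noteq> H'" for H H'
  proof -
    obtain K where "K \<in> T" "H \<inter> H' \<subseteq> K" using lines[OF \<open>H \<in> E - T\<close> \<open>H' \<in> E - T\<close> \<open>H \<noteq> H'\<close>] by auto
    moreover have "T \<subseteq> E" "{H, H'} \<subseteq> E" using T flat_subset that by auto
    ultimately show ?thesis by (auto simp: mem_cl_iff sols_def intro!: bexI[of _ K])
  qed
  then show "modular_flat E (hyp_rank V) T" "hyp_rank V E = Suc (hyp_rank V T)"
    using modular_coatomI[OF T ne rank_singleton] by blast+
qed

lemma divisionally_free_if_flag:
  assumes "rank_flag E (hyp_rank V) X"
  shows "divisionally_free V E"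
proof -
  have "ground (linear_matroid V E) = E"
    "indep (linear_matroid V E) S \<longleftrightarrow> S \<subseteq> E \<and> hyp_rank V S = card S" for S
    using finite_sub by (auto simp: linear_matroid_def hyp_rank_def sols_def)
  from divisional_flag_of_rank_flag[OF this assms] show ?thesis
    by (auto simp: divisionally_free_def)
qed

end


section \<open>Arrangements of gain graphs\<close>

definition hyp :: "'v set \<Rightarrow> 'v \<Rightarrow> 'v \<Rightarrow> 'k::field \<Rightarrow> ('v \<Rightarrow> 'k) set" where
  "hyp V i j g = {x \<in> coord_space V. x i - g * x j = 0}"

definition loop_hyp :: "'v set \<Rightarrow> 'v \<Rightarrow> ('v \<Rightarrow> 'k::field) set" where
  "loop_hyp V i = {x \<in> coord_space V. x i = 0}"

text \<open>Unlike \<open>mult_arrangement\<close>, the ambient coordinates \<open>V\<close> do not depend on the graph, so that the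
  arrangement of a subgraph is literally a subset.\<close>

definition arr :: "'v set \<Rightarrow> ('v, 'k::field) gain_graph \<Rightarrow> ('v \<Rightarrow> 'k) set set" where
  "arr V \<Gamma> = {hyp V i j g | i j g. gedge i j g \<in> gedges \<Gamma>} \<union> loop_hyp V ` gloops \<Gamma>"

lemma gedge_eq_iff:
  "gedge i j g = gedge u v h \<longleftrightarrow> i = u \<and> j = v \<and> g = h \<or> i = v \<and> j = u \<and> g = inverse h"
  by (auto simp: gedge_def doubleton_eq_iff)

lemma gedge_flip: "gedge i j g = gedge j i (inverse g)"
  by (simp add: gedge_eq_iff)

lemma gain_graph_over_mono:
  assumes "gain_graph_over H \<Gamma>" "H \<subseteq> G" shows "gain_graph_over G \<Gamma>"
proof -
  have "{gedge u v g | u v g. u \<in> gverts \<Gamma> \<and> v \<in> gverts \<Gamma> \<and> u \<noteq> v \<and> g \<in> H}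
      \<subseteq> {gedge u v g | u v g. u \<in> gverts \<Gamma> \<and> v \<in> gverts \<Gamma> \<and> u \<noteq> v \<and> g \<in> G}"
    using assms(2) by blast
  then show ?thesis using assms(1) unfolding gain_graph_over_def by (meson subset_trans)
qed

lemma induced_sel [simp]:
  "gverts (induced_gain_graph \<Gamma> U) = U"
  "gloops (induced_gain_graph \<Gamma> U) = U \<inter> gloops \<Gamma>"
  "gedge i j g \<in> gedges (induced_gain_graph \<Gamma> U) \<longleftrightarrow> gedge i j g \<in> gedges \<Gamma> \<and> i \<in> U \<and> j \<in> U"
  by (auto simp: induced_gain_graph_def gedge_eq_iff)

lemma hyp_flip: "g \<noteq> 0 \<Longrightarrow> hyp V i j g = hyp V j i (inverse g)"
  by (auto simp: hyp_def field_simps)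

lemma unit_vec_coord: "v \<in> V \<Longrightarrow> unit_vec v \<in> coord_space V"
  by (auto simp: unit_vec_def coord_space_def)

lemma unit_vec_hyp:
  "(unit_vec v :: 'v \<Rightarrow> 'k::field) \<in> hyp V i j g \<longleftrightarrow>
     (unit_vec v :: 'v \<Rightarrow> 'k) \<in> coord_space V \<and>
     (if i = v then if j = v then g = 1 else False else j = v \<longrightarrow> g = 0)"
  by (auto simp: hyp_def unit_vec_def)

lemma unit_vec_loop_hyp:
  "(unit_vec v :: 'v \<Rightarrow> 'k::field) \<in> loop_hyp V i \<longleftrightarrow>
     (unit_vec v :: 'v \<Rightarrow> 'k) \<in> coord_space V \<and> i \<noteq> v"
  by (auto simp: loop_hyp_def unit_vec_def)

lemma hyperplane_hyp:
  assumes "i \<in> V" "i \<noteq> j" shows "hyperplane_in V (hyp V i j g)"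
  unfolding hyperplane_in_def
proof (intro conjI exI[of _ "\<lambda>x. x i - g * x j"])
  have "unit_vec i \<notin> hyp V i j g" using assms by (simp add: unit_vec_hyp)
  then show "hyp V i j g \<noteq> coord_space V" using unit_vec_coord[OF assms(1)] by metis
qed (auto simp: hyp_def algebra_simps)

lemma hyperplane_loop_hyp:
  assumes "i \<in> V" shows "hyperplane_in V (loop_hyp V i)"
  unfolding hyperplane_in_def
proof (intro conjI exI[of _ "\<lambda>x. x i"])
  have "unit_vec i \<notin> loop_hyp V i" by (simp add: unit_vec_loop_hyp)
  then show "loop_hyp V i \<noteq> coord_space V" using unit_vec_coord[OF assms] by metis
qed (auto simp: loop_hyp_def)

lemma arr_induced_subset: "arr V (induced_gain_graph \<Gamma> U) \<subseteq> arr V \<Gamma>"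
  by (auto simp: arr_def)

locale gain_setting =
  fixes V :: "'v set" and G :: "'k::field set"
  assumes finite_V: "finite V" and finite_G: "finite G" and subgroup: "mult_subgroup G"
begin

abbreviation rk :: "('v \<Rightarrow> 'k) set set \<Rightarrow> nat" where "rk \<equiv> hyp_rank V"
abbreviation LC :: "'v set \<Rightarrow> ('v, 'k) gain_graph" where "LC \<equiv> looped_complete_gain_graph G"

definition looped_complete_in :: "('v, 'k) gain_graph \<Rightarrow> 'v set \<Rightarrow> bool" where
  "looped_complete_in \<Gamma> W \<longleftrightarrow> W \<subseteq> gloops \<Gamma> \<and>
     (\<forall>u\<in>W. \<forall>v\<in>W. \<forall>g\<in>G. u \<noteq> v \<longrightarrow> gedge u v g \<in> gedges \<Gamma>)"

definition graph_in :: "('v, 'k) gain_graph \<Rightarrow> bool" where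
  "graph_in \<Gamma> \<longleftrightarrow> gain_graph_over G \<Gamma> \<and> gverts \<Gamma> \<subseteq> V"

lemma G: "1 \<in> G" "0 \<notin> G" "g \<in> G \<Longrightarrow> h \<in> G \<Longrightarrow> g * h \<in> G" "g \<in> G \<Longrightarrow> inverse g \<in> G"
  using subgroup by (auto simp: mult_subgroup_def)

lemma edgeD:
  assumes "graph_in \<Gamma>" "gedge i j g \<in> gedges \<Gamma>"
  shows "i \<in> gverts \<Gamma>" "j \<in> gverts \<Gamma>" "i \<noteq> j" "g \<in> G" "g \<noteq> 0" "i \<in> V" "j \<in> V"
proof -
  obtain u v h where "gedge i j g = gedge u v h" "u \<in> gverts \<Gamma>" "v \<in> gverts \<Gamma>" "u \<noteq> v" "h \<in> G"
    using assms unfolding graph_in_def gain_graph_over_def by blast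
  then show 1: "i \<in> gverts \<Gamma>" "j \<in> gverts \<Gamma>" "i \<noteq> j" "g \<in> G"
    using G(4) by (auto simp: gedge_eq_iff)
  then show "g \<noteq> 0" "i \<in> V" "j \<in> V" using G(2) assms(1) by (auto simp: graph_in_def)
qed

lemma loopD: "graph_in \<Gamma> \<Longrightarrow> i \<in> gloops \<Gamma> \<Longrightarrow> i \<in> gverts \<Gamma> \<and> i \<in> V"
  by (auto simp: graph_in_def gain_graph_over_def)

lemma arr_cases [consumes 2, case_names edge loop]:
  assumes "graph_in \<Gamma>" "H \<in> arr V \<Gamma>"
  obtains i j g where "gedge i j g \<in> gedges \<Gamma>" "H = hyp V i j g"
    "i \<in> gverts \<Gamma>" "j \<in> gverts \<Gamma>" "i \<noteq> j" "g \<in> G" "g \<noteq> 0" "i \<in> V" "j \<in> V"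
  | i where "i \<in> gloops \<Gamma>" "H = loop_hyp V i" "i \<in> gverts \<Gamma>" "i \<in> V"
proof -
  from assms(2) consider i j g where "gedge i j g \<in> gedges \<Gamma>" "H = hyp V i j g"
    | i where "i \<in> gloops \<Gamma>" "H = loop_hyp V i"
    by (auto simp: arr_def)
  then show thesis
  proof cases
    case 1
    show thesis by (rule that(1)[OF 1 edgeD[OF assms(1) 1(1)]])
  next
    case 2
    then show thesis using that(2) loopD[OF assms(1)] by blast
  qed
qed

lemma arr_arrangement:
  assumes "graph_in \<Gamma>"
  shows "hyperplane_arrangement V (arr V \<Gamma>)"
proof
  show "finite V" by (rule finite_V)
  show "hyperplane_in V H" if "H \<in> arr V \<Gamma>" for H
    using assms that by (cases rule: arr_cases) (auto intro: hyperplane_hyp hyperplane_loop_hyp)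
  have "finite (gedges \<Gamma>)" "finite (gloops \<Gamma>)"
    using assms by (auto simp: graph_in_def gain_graph_over_def intro: finite_subset)
  moreover have "finite e" if "e \<in> gedges \<Gamma>" for e
    using assms that by (auto simp: graph_in_def gain_graph_over_def gedge_def)
  ultimately have "finite ((\<lambda>(i, j, g). hyp V i j g) ` \<Union>(gedges \<Gamma>))" by simp
  moreover have "{hyp V i j g | i j g. gedge i j g \<in> gedges \<Gamma>}
      \<subseteq> (\<lambda>(i, j, g). hyp V i j g) ` \<Union>(gedges \<Gamma>)"
  proof safe
    fix i j g assume "gedge i j g \<in> gedges \<Gamma>"
    moreover have "(i, j, g) \<in> gedge i j g" by (simp add: gedge_def)
    ultimately have "(i, j, g) \<in> \<Union>(gedges \<Gamma>)" by blast
    then show "hyp V i j g \<in> (\<lambda>(i, j, g). hyp V i j g) ` \<Union>(gedges \<Gamma>)" by force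
  qed
  ultimately show "finite (arr V \<Gamma>)"
    using \<open>finite (gloops \<Gamma>)\<close> by (auto simp: arr_def intro: finite_subset)
qed

lemma arr_edge: "gedge i j g \<in> gedges \<Gamma> \<Longrightarrow> hyp V i j g \<in> arr V \<Gamma>"
  by (auto simp: arr_def)

lemma arr_loop: "i \<in> gloops \<Gamma> \<Longrightarrow> loop_hyp V i \<in> arr V \<Gamma>"
  by (auto simp: arr_def)

lemma graph_in_induced:
  assumes "graph_in \<Gamma>" "U \<subseteq> gverts \<Gamma>"
  shows "graph_in (induced_gain_graph \<Gamma> U)"
proof -
  have "finite U" "finite (gedges (induced_gain_graph \<Gamma> U))" "U \<subseteq> V"
    using assms finite_subset[of U "gverts \<Gamma>"]
    by (auto simp: graph_in_def gain_graph_over_def induced_gain_graph_def)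
  moreover have "e \<in> {gedge u v g | u v g. u \<in> U \<and> v \<in> U \<and> u \<noteq> v \<and> g \<in> G}"
    if e: "e \<in> gedges (induced_gain_graph \<Gamma> U)" for e
  proof -
    obtain u v g where "e = gedge u v g" "u \<in> U" "v \<in> U" "e \<in> gedges \<Gamma>"
      using e by (auto simp: induced_gain_graph_def)
    then show ?thesis using edgeD[OF assms(1), of u v g] by blast
  qed
  ultimately show ?thesis unfolding graph_in_def gain_graph_over_def by auto
qed

lemma arr_depends:
  assumes "graph_in \<Gamma>" "H \<in> arr V \<Gamma>" "x \<in> H" "y \<in> coord_space V" "\<forall>w\<in>gverts \<Gamma>. y w = x w"
  shows "y \<in> H"
  using assms(1,2) by (cases rule: arr_cases) (use assms(3-) in \<open>auto simp: hyp_def loop_hyp_def\<close>)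

lemma unit_vec_arr:
  "graph_in \<Gamma> \<Longrightarrow> H \<in> arr V \<Gamma> \<Longrightarrow> v \<in> V - gverts \<Gamma> \<Longrightarrow> unit_vec v \<in> H"
  by (cases rule: arr_cases, assumption+) (auto simp: unit_vec_hyp unit_vec_loop_hyp unit_vec_coord)

text \<open>Unit vectors detect the coordinates that a hyperplane involves: for \<open>v\<close> in
  \<open>V\<close>, the vector \<open>unit_vec v\<close> lies on the hyperplanes of the graph whose
  equation does not mention \<open>v\<close>, and on no others.\<close>

lemma not_in_induced:
  assumes "graph_in \<Gamma>" "H \<in> arr V \<Gamma>" "H \<notin> arr V (induced_gain_graph \<Gamma> U)"
  shows "\<exists>v\<in>gverts \<Gamma> - U. unit_vec v \<notin> H"
  using assms(1,2)
proof (cases rule: arr_cases)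
  case (edge i j g)
  then have "i \<notin> U \<or> j \<notin> U" using assms(3) arr_edge[of i j g "induced_gain_graph \<Gamma> U"] by auto
  moreover have "unit_vec i \<notin> H" "unit_vec j \<notin> H" using edge by (auto simp: unit_vec_hyp)
  ultimately show ?thesis using edge by blast
next
  case (loop i)
  then have "i \<notin> U" using assms(3) arr_loop[of i "induced_gain_graph \<Gamma> U"] by auto
  then show ?thesis using loop by (auto simp: unit_vec_loop_hyp)
qed

text \<open>A hyperplane outside the subgraph involves a vertex \<open>v\<close> not in
  \<open>U\<close>, and \<open>unit_vec v\<close> satisfies all equations of the subgraph but not
  that one.\<close>

lemma induced_flat:
  assumes "graph_in \<Gamma>" "U \<subseteq> gverts \<Gamma>"
  shows "arr V (induced_gain_graph \<Gamma> U) \<in> rank_flats (arr V \<Gamma>) rk"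
proof -
  interpret hyperplane_arrangement V "arr V \<Gamma>" by (rule arr_arrangement[OF assms(1)])
  have "\<not> sols V (arr V (induced_gain_graph \<Gamma> U)) \<subseteq> H"
    if H: "H \<in> arr V \<Gamma> - arr V (induced_gain_graph \<Gamma> U)" for H
  proof -
    obtain v where v: "v \<in> gverts \<Gamma> - U" "unit_vec v \<notin> H"
      using not_in_induced[OF assms(1), of H U] H by blast
    have "v \<in> V" using v assms(1) by (auto simp: graph_in_def)
    then have "unit_vec v \<in> sols V (arr V (induced_gain_graph \<Gamma> U))"
      using unit_vec_arr[OF graph_in_induced[OF assms]] v unit_vec_coord[of v V]
      by (auto simp: sols_def)
    then show ?thesis using v by blast
  qed
  then show ?thesis unfolding flat_iff using arr_induced_subset[of V \<Gamma> U] by blast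
qed

section \<open>Looped complete subgraphs\<close>

lemma LC_sel [simp]:
  "gverts (LC W) = W" "gloops (LC W) = W"
  "gedge i j g \<in> gedges (LC W) \<longleftrightarrow> i \<in> W \<and> j \<in> W \<and> i \<noteq> j \<and> g \<in> G"
  using G(4) by (auto simp: looped_complete_gain_graph_def complete_gain_graph_def gedge_eq_iff)

lemma complete_over:
  assumes "finite W" "H \<subseteq> G" shows "gain_graph_over H (complete_gain_graph H W)"
proof -
  have "{gedge u v g | u v g. u \<in> W \<and> v \<in> W \<and> u \<noteq> v \<and> g \<in> H}
      \<subseteq> (\<lambda>(u, v, g). gedge u v g) ` (W \<times> W \<times> H)" by force
  then have "finite {gedge u v g | u v g. u \<in> W \<and> v \<in> W \<and> u \<noteq> v \<and> g \<in> H}"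
    using finite_subset assms finite_G by (metis (no_types, lifting) finite_SigmaI finite_imageI)
  then show ?thesis
    using assms by (auto simp: gain_graph_over_def complete_gain_graph_def)
qed

lemma graph_in_LC: "W \<subseteq> V \<Longrightarrow> graph_in (LC W)"
  using complete_over[of W G] finite_subset[OF _ finite_V]
  by (auto simp: graph_in_def gain_graph_over_def looped_complete_gain_graph_def
      complete_gain_graph_def)

lemma looped_complete_sub:
  assumes "graph_in \<Gamma>" "looped_complete_in \<Gamma> W"
  shows "W \<subseteq> gverts \<Gamma>" "W \<subseteq> V" "finite W"
  using assms loopD[OF assms(1)] finite_subset[OF _ finite_V, of W]
  by (auto simp: looped_complete_in_def)

lemma looped_complete_induced:
  assumes "graph_in \<Gamma>" "looped_complete_in \<Gamma> W"
  shows "induced_gain_graph \<Gamma> W = LC W"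
proof -
  have "gedges (induced_gain_graph \<Gamma> W) = gedges (LC W)"
  proof (intro equalityI subsetI)
    fix e assume "e \<in> gedges (induced_gain_graph \<Gamma> W)"
    then obtain u v g where "e = gedge u v g" "u \<in> W" "v \<in> W" "gedge u v g \<in> gedges \<Gamma>"
      by (auto simp: induced_gain_graph_def)
    then show "e \<in> gedges (LC W)" using edgeD[OF assms(1), of u v g] by simp
  next
    fix e assume "e \<in> gedges (LC W)"
    then obtain u v g where "e = gedge u v g" "u \<in> W" "v \<in> W" "u \<noteq> v" "g \<in> G"
      by (auto simp: looped_complete_gain_graph_def complete_gain_graph_def)
    then show "e \<in> gedges (induced_gain_graph \<Gamma> W)"
      using assms(2) by (simp add: looped_complete_in_def)
  qed
  moreover have "W \<inter> gloops \<Gamma> = W" using assms(2) by (auto simp: looped_complete_in_def)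
  ultimately show ?thesis
    by (intro gain_graph.equality) (simp_all add: looped_complete_gain_graph_def complete_gain_graph_def)
qed

lemma arr_LC_subset:
  "looped_complete_in \<Gamma> W \<Longrightarrow> arr V (LC W) \<subseteq> arr V \<Gamma>"
  unfolding arr_def looped_complete_in_def by auto blast

text \<open>A vertex \<open>v\<close> is linked to \<open>w \<in> W\<close> if the flat \<open>F\<close> forces \<open>z v = g * z w\<close>; such vertices get the
  value forced by \<open>x\<close>, and all others get \<open>0\<close>.\<close>

lemma looped_complete_extension:
  assumes \<Gamma>: "graph_in \<Gamma>" and W: "looped_complete_in \<Gamma> W"
    and F: "F \<in> rank_flats (arr V \<Gamma>) rk" and x: "x \<in> sols V (F \<inter> arr V (LC W))"
  shows "\<exists>y\<in>sols V F. \<forall>w\<in>W. y w = x w"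
proof -
  interpret hyperplane_arrangement V "arr V \<Gamma>" by (rule arr_arrangement[OF \<Gamma>])
  note WV = looped_complete_sub[OF \<Gamma> W]
  have xF: "x \<in> H" if "H \<in> arr V (LC W)" "sols V F \<subseteq> H" for H
    using x that F arr_LC_subset[OF W] unfolding flat_iff by (auto simp: sols_def)
  define link where "link v w g \<longleftrightarrow> w \<in> W \<and> g \<in> G \<and> (\<forall>z\<in>sols V F. z v = g * z w)" for v w g
  define y where "y v = (if v \<in> V \<and> (\<exists>w g. link v w g)
     then (case (SOME (w, g). link v w g) of (w, g) \<Rightarrow> g * x w) else 0)" for v
  have zero: "x w = 0" if "w \<in> W" "\<forall>z\<in>sols V F. z w = 0" for w
  proof -
    have "loop_hyp V w \<in> arr V (LC W)" using that(1) by (intro arr_loop) simp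
    moreover have "sols V F \<subseteq> loop_hyp V w" using that(2) by (auto simp: loop_hyp_def sols_def)
    ultimately have "x \<in> loop_hyp V w" by (rule xF)
    then show ?thesis by (simp add: loop_hyp_def)
  qed
  \<comment> \<open>Here completeness is used. Two links to the same \<open>w\<close> with different
    gains force \<open>z w = 0\<close>, so the loop at \<open>w\<close> belongs to \<open>F\<close>;
    links to distinct \<open>w\<close> and \<open>w'\<close> force an equation between these two,
    whose edge belongs to \<open>F\<close> as well. \<open>x\<close> satisfies both kinds of
    equations.\<close>
  have consistent: "g * x w = g' * x w'" if l: "link v w g" "link v w' g'" for v w g w' g'
  proof -
    have g: "g \<in> G" "g' \<in> G" "g \<noteq> 0" "w \<in> W" "w' \<in> W" using l G(2) by (auto simp: link_def)
    have eq: "g * z w = g' * z w'" if "z \<in> sols V F" for z using l that by (auto simp: link_def)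
    show ?thesis
    proof (cases "w = w'")
      case True
      then have "g = g' \<or> (\<forall>z\<in>sols V F. z w = 0)" using eq by force
      then show ?thesis using True zero g by auto
    next
      case False
      have "inverse g * g' \<in> G" using g G by blast
      then have "hyp V w w' (inverse g * g') \<in> arr V (LC W)" using False g by (simp add: arr_edge)
      moreover have "sols V F \<subseteq> hyp V w w' (inverse g * g')"
      proof
        fix z assume z: "z \<in> sols V F"
        then have "z w = inverse g * g' * z w'" using eq[OF z] g by (simp add: field_simps)
        then show "z \<in> hyp V w w' (inverse g * g')" using z by (simp add: hyp_def sols_def)
      qed
      ultimately have "x w = inverse g * g' * x w'" using xF by (auto simp: hyp_def)
      then show ?thesis using g by (simp add: field_simps)
    qed
  qed
  have y: "y v = g * x w" if l: "link v w g" "v \<in> V" for v w g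
  proof -
    obtain w' g' where s: "(SOME (w, g). link v w g) = (w', g')" by fastforce
    have "case (SOME (w, g). link v w g) of (w, g) \<Rightarrow> link v w g"
      by (rule someI[of "\<lambda>(w, g). link v w g" "(w, g)"]) (simp add: l)
    then have "link v w' g'" using s by simp
    then show ?thesis using consistent[OF l(1)] l s by (auto simp: y_def)
  qed
  have y0: "y v = 0" if "\<not> (\<exists>w g. link v w g)" for v using that by (simp add: y_def)
  have "y w = x w" if "w \<in> W" for w
    using y[of w w 1] that WV G(1) by (auto simp: link_def)
  moreover have "y \<in> H" if H: "H \<in> F" for H
  proof -
    have yV: "y \<in> coord_space V" by (simp add: y_def coord_space_def)
    have "H \<in> arr V \<Gamma>" using F H flat_subset by blast
    with \<Gamma> show ?thesis
    proof (cases rule: arr_cases)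
      case (edge i j g)
      have ij: "z i = g * z j" if "z \<in> sols V F" for z
        using that H edge by (auto simp: sols_def hyp_def)
      \<comment> \<open>A link at either end of an edge in \<open>F\<close> transfers to the other
        end, so both values are prescribed compatibly or both are \<open>0\<close>.\<close>
      have "y i = g * y j"
      proof (cases "\<exists>w h. link j w h")
        case True
        then obtain w h where l: "link j w h" by blast
        then have "link i w (g * h)" using ij edge G by (auto simp: link_def mult.assoc)
        then show ?thesis using y l edge by simp
      next
        case False
        have "\<not> (\<exists>w h. link i w h)"
        proof
          assume "\<exists>w h. link i w h"
          then obtain w h where l: "link i w h" by blast
          have "z j = inverse g * h * z w" if "z \<in> sols V F" for z
            using ij[OF that] l that edge by (simp add: link_def field_simps)
          moreover have "inverse g * h \<in> G" using G l edge by (auto simp: link_def)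
          ultimately have "link j w (inverse g * h)" using l by (auto simp: link_def)
          then show False using False by blast
        qed
        then show ?thesis using y0 False by simp
      qed
      then show ?thesis using yV edge by (simp add: hyp_def)
    next
      case (loop i)
      have zi: "z i = 0" if "z \<in> sols V F" for z
        using that H loop by (auto simp: sols_def loop_hyp_def)
      have "y i = 0"
      proof (cases "\<exists>w h. link i w h")
        case True
        then obtain w h where l: "link i w h" by blast
        then have "h \<noteq> 0" "w \<in> W" using G(2) by (auto simp: link_def)
        moreover have "h * z w = 0" if "z \<in> sols V F" for z
          using zi[OF that] l that by (simp add: link_def)
        ultimately have "\<forall>z\<in>sols V F. z w = 0" by simp
        then show ?thesis using y[OF l] zero \<open>w \<in> W\<close> loop by simp
      qed (use y0 in blast)
      then show ?thesis using yV loop by (simp add: loop_hyp_def)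
    qed
  qed
  moreover have "y \<in> coord_space V" by (simp add: y_def coord_space_def)
  ultimately show ?thesis by (intro bexI[of _ y]) (auto simp: sols_def)
qed

lemma looped_complete_modular:
  assumes \<Gamma>: "graph_in \<Gamma>" and W: "looped_complete_in \<Gamma> W"
  shows "modular_flat (arr V \<Gamma>) rk (arr V (LC W))"
proof -
  interpret hyperplane_arrangement V "arr V \<Gamma>" by (rule arr_arrangement[OF \<Gamma>])
  note sub = looped_complete_sub[OF \<Gamma> W]
  show ?thesis
  proof (rule modular_if_extension[where W = W])
    show "arr V (LC W) \<in> rank_flats (arr V \<Gamma>) rk"
      using induced_flat[OF \<Gamma> sub(1)] looped_complete_induced[OF assms] by simp
    show "y \<in> H" if "H \<in> arr V (LC W)" "x \<in> H" "y \<in> coord_space V" "\<forall>w\<in>W. y w = x w" for H x y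
      by (rule arr_depends[OF graph_in_LC[OF sub(2)] that(1-3)]) (use that in simp)
    show "\<exists>y\<in>sols V F. \<forall>w\<in>W. y w = x w"
      if "F \<in> rank_flats (arr V \<Gamma>) rk" "x \<in> sols V (F \<inter> arr V (LC W))" for F x
      by (rule looped_complete_extension[OF assms that])
  qed
qed

text \<open>The loops alone cut out the same subspace, and they are independent.\<close>

lemma rank_LC:
  assumes "W \<subseteq> V" shows "rk (arr V (LC W)) = card W"
proof -
  have loops: "rk (loop_hyp V ` U) = card U" if "U \<subseteq> V" for U
    using finite_subset[OF that finite_V] that
  proof (induction U rule: finite_induct)
    case (insert u U)
    have "(unit_vec u :: 'v \<Rightarrow> 'k) \<in> sols V (loop_hyp V ` U)"
      using insert by (auto simp: sols_def unit_vec_loop_hyp unit_vec_coord)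
    then have "\<not> sols V (loop_hyp V ` U) \<subseteq> (loop_hyp V u :: ('v \<Rightarrow> 'k) set)"
      by (auto simp: unit_vec_loop_hyp)
    moreover have "\<forall>H :: ('v \<Rightarrow> 'k) set \<in> loop_hyp V ` U. hyperplane_in V H"
      "hyperplane_in V (loop_hyp V u :: ('v \<Rightarrow> 'k) set)"
      using insert.prems by (auto intro!: hyperplane_loop_hyp)
    ultimately have "rk (insert (loop_hyp V u) (loop_hyp V ` U)) = Suc (rk (loop_hyp V ` U))"
      by (simp only: hyp_rank_insert[OF finite_V] if_False)
    then show ?case using insert by simp
  qed (simp add: hyp_rank_empty)
  have "sols V (arr V (LC W)) = sols V (loop_hyp V ` W)"
  proof (rule antisym)
    show "sols V (arr V (LC W)) \<subseteq> sols V (loop_hyp V ` W)"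
      by (rule sols_antimono) (auto simp: arr_def)
    show "sols V (loop_hyp V ` W) \<subseteq> sols V (arr V (LC W))"
      by (auto simp: sols_def arr_def hyp_def loop_hyp_def)
  qed
  then show ?thesis using loops[OF assms] by (simp add: hyp_rank_def)
qed

text \<open>The strengthening that makes the induction over gluings work: the flag stays disjoint from the
  looped complete subgraph on \<open>W\<close> until it reaches a complement of it.\<close>

definition flag_avoiding :: "('v, 'k) gain_graph \<Rightarrow> 'v set \<Rightarrow> bool" where
  "flag_avoiding \<Gamma> W \<longleftrightarrow> (\<exists>X. rank_flag (arr V \<Gamma>) rk X \<and>
     (\<forall>i. i + card W \<le> rk (arr V \<Gamma>) \<longrightarrow> X i \<inter> arr V (LC W) = {}))"

lemma arr_LC_empty [simp]: "arr V (LC {}) = {}"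
  by (simp add: arr_def)

lemma flag_avoiding_empty: "flag_avoiding \<Gamma> {} \<longleftrightarrow> (\<exists>X. rank_flag (arr V \<Gamma>) rk X)"
  by (simp add: flag_avoiding_def)

lemma rank_flag_null: "rank_flag {} rk (\<lambda>_. {})"
  by (simp add: rank_flag_def hyp_rank_empty rank_flats_def)

text \<open>Only the flag on the \<open>V1\<close> side has to avoid \<open>V1 \<inter> V2\<close>;
  the one on the \<open>V2\<close> side supplies the avoidance of \<open>W\<close>. From rank
  \<open>rk ?E - rk ?E2\<close> on, the trace on the second part follows its own flag, with index
  and total rank shifted by the same amount, so the bound for \<open>W\<close> is inherited.\<close>

lemma flag_avoiding_glue:
  assumes \<Gamma>: "graph_in \<Gamma>" and verts: "gverts \<Gamma> = V1 \<union> V2"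
    and edges: "gedges \<Gamma> = gedges (induced_gain_graph \<Gamma> V1) \<union> gedges (induced_gain_graph \<Gamma> V2)"
    and lc: "looped_complete_in \<Gamma> (V1 \<inter> V2)"
    and f1: "flag_avoiding (induced_gain_graph \<Gamma> V1) (V1 \<inter> V2)"
    and f2: "flag_avoiding (induced_gain_graph \<Gamma> V2) W"
    and W: "looped_complete_in \<Gamma> W" "W \<subseteq> V2"
  shows "flag_avoiding \<Gamma> W"
proof -
  let ?W = "V1 \<inter> V2"
  let ?E = "arr V \<Gamma>" and ?E1 = "arr V (induced_gain_graph \<Gamma> V1)"
    and ?E2 = "arr V (induced_gain_graph \<Gamma> V2)"
  interpret hyperplane_arrangement V ?E by (rule arr_arrangement[OF \<Gamma>])
  have sub: "V1 \<subseteq> gverts \<Gamma>" "V2 \<subseteq> gverts \<Gamma>" "V1 \<subseteq> V" "V2 \<subseteq> V"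
    using verts \<Gamma> by (auto simp: graph_in_def)
  note \<Gamma>1 = graph_in_induced[OF \<Gamma> sub(1)] and \<Gamma>2 = graph_in_induced[OF \<Gamma> sub(2)]
  have lc1: "looped_complete_in (induced_gain_graph \<Gamma> V1) ?W"
    and lc2: "looped_complete_in (induced_gain_graph \<Gamma> V2) ?W"
    and lcW: "looped_complete_in (induced_gain_graph \<Gamma> V2) W"
    using lc W by (auto simp: looped_complete_in_def)
  have E: "?E = ?E1 \<union> ?E2"
  proof (intro equalityI subsetI)
    fix H assume "H \<in> ?E"
    with \<Gamma> show "H \<in> ?E1 \<union> ?E2"
    proof (cases rule: arr_cases)
      case (edge i j g)
      then have "gedge i j g \<in> gedges (induced_gain_graph \<Gamma> V1) \<or>
        gedge i j g \<in> gedges (induced_gain_graph \<Gamma> V2)" using edges by blast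
      then show ?thesis using edge(2) arr_edge by blast
    next
      case (loop i)
      then have "i \<in> gloops (induced_gain_graph \<Gamma> V1) \<or> i \<in> gloops (induced_gain_graph \<Gamma> V2)"
        using verts by auto
      then show ?thesis using loop(2) arr_loop by blast
    qed
  qed (use arr_induced_subset in blast)
  have E12: "?E1 \<inter> ?E2 = arr V (LC ?W)"
  proof (intro equalityI subsetI)
    \<comment> \<open>A hyperplane that arises in both parts involves only common vertices, as the
      unit vectors show.\<close>
    fix H assume H: "H \<in> ?E1 \<inter> ?E2"
    have "unit_vec v \<in> H" if "v \<in> V" "v \<notin> ?W" for v
      using H that unit_vec_arr[OF \<Gamma>1, of H v] unit_vec_arr[OF \<Gamma>2, of H v] by auto
    moreover have "H \<in> ?E" using H E by auto
    moreover have "gverts \<Gamma> \<subseteq> V" using \<Gamma> by (simp add: graph_in_def)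
    ultimately have "H \<in> arr V (induced_gain_graph \<Gamma> ?W)"
      using not_in_induced[OF \<Gamma>, of H ?W] by blast
    then show "H \<in> arr V (LC ?W)" using looped_complete_induced[OF \<Gamma> lc] by simp
  next
    fix H assume "H \<in> arr V (LC ?W)"
    then show "H \<in> ?E1 \<inter> ?E2" using arr_LC_subset[OF lc1] arr_LC_subset[OF lc2] by blast
  qed
  have E1: "?E1 \<in> rank_flats ?E rk" by (rule induced_flat[OF \<Gamma> sub(1)])
  interpret E1: hyperplane_arrangement V ?E1 by (rule arr_arrangement[OF \<Gamma>1])
  have mod12: "modular_flat ?E1 rk (?E1 \<inter> ?E2)"
    unfolding E12 by (rule looped_complete_modular[OF \<Gamma>1 lc1])
  have mod2: "modular_flat ?E rk ?E2"
  proof (rule modular_if_extension[where W = V2])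
    show "?E2 \<in> rank_flats ?E rk" by (rule induced_flat[OF \<Gamma> sub(2)])
    show "y \<in> H" if "H \<in> ?E2" "x \<in> H" "y \<in> coord_space V" "\<forall>w\<in>V2. y w = x w" for H x y
      by (rule arr_depends[OF \<Gamma>2 that(1-3)]) (use that in simp)
    fix F x assume F: "F \<in> rank_flats ?E rk" and x: "x \<in> sols V (F \<inter> ?E2)"
    have "F \<inter> ?E1 \<in> rank_flats ?E1 rk" by (rule flat_restrict[OF F arr_induced_subset])
    moreover have "x \<in> sols V (F \<inter> ?E1 \<inter> arr V (LC ?W))"
      using x sols_antimono[of "F \<inter> ?E1 \<inter> arr V (LC ?W)" "F \<inter> ?E2" V] E12 by auto
    ultimately obtain y where y: "y \<in> sols V (F \<inter> ?E1)" "\<forall>w\<in>?W. y w = x w"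
      using looped_complete_extension[OF \<Gamma>1 lc1] by blast
    \<comment> \<open>\<open>x\<close> is kept on \<open>V2\<close> and continued to
      \<open>V1\<close> by a solution that agrees with it on the common vertices; since every
      hyperplane belongs to one of the parts, the result satisfies all equations of
      \<open>F\<close>.\<close>
    define z where "z v = (if v \<in> V1 then y v else x v)" for v
    have zx: "\<forall>v\<in>V2. z v = x v" "\<forall>v\<in>V1. z v = y v" using y(2) by (auto simp: z_def)
    have z: "z \<in> coord_space V" using x y(1) by (auto simp: z_def sols_def coord_space_def)
    have "z \<in> H" if "H \<in> F" for H
    proof (cases "H \<in> ?E1")
      case True
      then show ?thesis using arr_depends[OF \<Gamma>1 True, of y z] y(1) that z zx by (auto simp: sols_def)
    next
      case False
      then have "H \<in> ?E2" using that F E flat_subset by blast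
      then show ?thesis using arr_depends[OF \<Gamma>2, of H x z] x that z zx by (auto simp: sols_def)
    qed
    then show "\<exists>y\<in>sols V F. \<forall>w\<in>V2. y w = x w" using z zx by (intro bexI[of _ z]) (auto simp: sols_def)
  qed
  obtain X where X: "rank_flag ?E1 rk X"
    "\<And>i. i + card ?W \<le> rk ?E1 \<Longrightarrow> X i \<inter> arr V (LC ?W) = {}"
    using f1 by (auto simp: flag_avoiding_def)
  obtain Y where Y: "rank_flag ?E2 rk Y"
    "\<And>i. i + card W \<le> rk ?E2 \<Longrightarrow> Y i \<inter> arr V (LC W) = {}"
    using f2 by (auto simp: flag_avoiding_def)
  have cardW: "rk (?E1 \<inter> ?E2) = card ?W" "rk (?E1 \<inter> ?E2) \<le> rk ?E1"
    unfolding E12 using rank_LC[of ?W] sub arr_LC_subset[OF lc1] by (auto intro: E1.rank_mono)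
  have disj: "X i \<inter> ?E2 = {}" if i: "i \<le> rk ?E1 - rk (?E1 \<inter> ?E2)" for i
  proof -
    have "X i \<subseteq> ?E1" using E1.rank_flagD(3)[OF X(1), of i] E1.flat_subset i by auto
    moreover have "i + card ?W \<le> rk ?E1" using i cardW by linarith
    then have "X i \<inter> (?E1 \<inter> ?E2) = {}" unfolding E12 by (rule X(2))
    ultimately show ?thesis by blast
  qed
  obtain Z where Z: "rank_flag ?E rk Z" "\<And>i. i \<le> rk ?E - rk ?E2 \<Longrightarrow> Z i \<inter> ?E2 = {}"
    "\<And>i. rk ?E - rk ?E2 \<le> i \<Longrightarrow> i \<le> rk ?E \<Longrightarrow> Z i \<inter> ?E2 = Y (i - (rk ?E - rk ?E2))"
    using flag_glue[OF E E1 mod2 mod12 X(1) disj Y(1)] by blast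
  have "rk ?E2 \<le> rk ?E" by (rule rank_mono) (auto simp: arr_induced_subset)
  have WE2: "arr V (LC W) \<subseteq> ?E2" by (rule arr_LC_subset[OF lcW])
  have "Z i \<inter> arr V (LC W) = {}" if i: "i + card W \<le> rk ?E" for i
  proof (cases "i \<le> rk ?E - rk ?E2")
    case True
    then show ?thesis using Z(2)[OF True] WE2 by blast
  next
    case False
    then have "Z i \<inter> ?E2 = Y (i - (rk ?E - rk ?E2))" using Z(3) i by simp
    moreover have "Y (i - (rk ?E - rk ?E2)) \<inter> arr V (LC W) = {}"
      using Y(2) i False \<open>rk ?E2 \<le> rk ?E\<close> by simp
    ultimately show ?thesis using WE2 by blast
  qed
  then show ?thesis using Z(1) by (auto simp: flag_avoiding_def)
qed

section \<open>Bias-simplicial vertices\<close>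

lemma arr_at_vertex:
  assumes \<Gamma>: "graph_in \<Gamma>" and H: "H \<in> arr V \<Gamma>" "H \<notin> arr V (induced_gain_graph \<Gamma> (gverts \<Gamma> - {v}))"
  obtains u g where "gedge u v g \<in> gedges \<Gamma>" "H = hyp V u v g"
  | "v \<in> gloops \<Gamma>" "H = loop_hyp V v"
  using \<Gamma> H(1)
proof (cases rule: arr_cases)
  case (edge i j g)
  then consider "i = v" | "j = v"
    using H(2) arr_edge[of i j g "induced_gain_graph \<Gamma> (gverts \<Gamma> - {v})"] by auto
  then show ?thesis
  proof cases
    case 1
    then show ?thesis using that(1)[of j "inverse g"] edge hyp_flip gedge_flip by metis
  next
    case 2
    then show ?thesis using that(1) edge by blast
  qed
next
  case (loop i)
  then show ?thesis
    using that(2) H(2) arr_loop[of i "induced_gain_graph \<Gamma> (gverts \<Gamma> - {v})"] by auto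
qed

context
  fixes \<Gamma> :: "('v, 'k) gain_graph" and v :: 'v
  assumes \<Gamma>: "graph_in \<Gamma>" and v: "bias_simplicial \<Gamma> v"
begin

abbreviation (input) del :: "('v, 'k) gain_graph" where
  "del \<equiv> induced_gain_graph \<Gamma> (gverts \<Gamma> - {v})"

lemma simplicialD:
  "gedge u v g \<in> gedges \<Gamma> \<Longrightarrow> gedge v w h \<in> gedges \<Gamma> \<Longrightarrow> u \<noteq> w \<Longrightarrow> gedge u w (g * h) \<in> gedges \<Gamma>"
  "gedge u v g \<in> gedges \<Gamma> \<Longrightarrow> gedge u v h \<in> gedges \<Gamma> \<Longrightarrow> g \<noteq> h \<Longrightarrow> u \<in> gloops \<Gamma>"
  "gedge u v g \<in> gedges \<Gamma> \<Longrightarrow> v \<in> gloops \<Gamma> \<Longrightarrow> u \<in> gloops \<Gamma>"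
  using v unfolding bias_simplicial_def by blast+

text \<open>The three conditions on a bias-simplicial vertex serve the three kinds of pairs of
  hyperplanes at \<open>v\<close>: two neighbours give an edge with the product gain, two gains to
  the same neighbour \<open>u\<close> give the loop at \<open>u\<close>, and so do an edge from
  \<open>u\<close> and a loop at \<open>v\<close>.\<close>

lemma simplicial_line:
  assumes "H \<in> arr V \<Gamma> - arr V del" "H' \<in> arr V \<Gamma> - arr V del" "H \<noteq> H'"
  shows "\<exists>K\<in>arr V del. H \<inter> H' \<subseteq> K"
proof -
  have edge_loop: "\<exists>K\<in>arr V del. hyp V u v g \<inter> loop_hyp V v \<subseteq> K"
    if "gedge u v g \<in> gedges \<Gamma>" "v \<in> gloops \<Gamma>" for u g
  proof
    show "loop_hyp V u \<in> arr V del"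
      using simplicialD(3)[OF that] edgeD[OF \<Gamma> that(1)] by (intro arr_loop) auto
  qed (auto simp: hyp_def loop_hyp_def)
  have edge_edge: "\<exists>K\<in>arr V del. hyp V u v g \<inter> hyp V w v h \<subseteq> K"
    if e: "gedge u v g \<in> gedges \<Gamma>" "gedge w v h \<in> gedges \<Gamma>" "hyp V u v g \<noteq> hyp V w v h" for u w g h
  proof (cases "u = w")
    case True
    then have "g \<noteq> h" using e by auto
    show ?thesis
    proof
      show "loop_hyp V u \<in> arr V del"
        using simplicialD(2)[of u g h] e True \<open>g \<noteq> h\<close> edgeD[OF \<Gamma> e(1)] by (intro arr_loop) auto
      show "hyp V u v g \<inter> hyp V w v h \<subseteq> loop_hyp V u"
        using True \<open>g \<noteq> h\<close> by (auto simp: hyp_def loop_hyp_def)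
    qed
  next
    case False
    have "gedge v w (inverse h) \<in> gedges \<Gamma>" using e(2) gedge_flip[of w v h] by simp
    from simplicialD(1)[OF e(1) this False] have "gedge u w (g * inverse h) \<in> gedges del"
      using edgeD[OF \<Gamma> e(1)] edgeD[OF \<Gamma> e(2)] by simp
    moreover have "hyp V u v g \<inter> hyp V w v h \<subseteq> hyp V u w (g * inverse h)"
      using edgeD(5)[OF \<Gamma> e(2)] by (auto simp: hyp_def field_simps)
    ultimately show ?thesis using arr_edge by blast
  qed
  have H: "H \<in> arr V \<Gamma>" "H \<notin> arr V del" "H' \<in> arr V \<Gamma>" "H' \<notin> arr V del" using assms by auto
  from \<Gamma> H(1,2) show ?thesis
  proof (cases rule: arr_at_vertex)
    case (1 u g)
    note e = 1
    from \<Gamma> H(3,4) show ?thesis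
    proof (cases rule: arr_at_vertex)
      case (1 w h)
      then show ?thesis using edge_edge e assms(3) by simp
    next
      case 2
      then show ?thesis using edge_loop e by simp
    qed
  next
    case 2
    note l = 2
    from \<Gamma> H(3,4) show ?thesis
    proof (cases rule: arr_at_vertex)
      case (1 w h)
      then show ?thesis using edge_loop[of w h] l by (simp add: Int_commute)
    next
      case 2
      then show ?thesis using l assms(3) by simp
    qed
  qed
qed

lemma graph_in_del: "graph_in del"
  by (rule graph_in_induced[OF \<Gamma>]) auto

lemma simplicial_modular:
  assumes "arr V del \<noteq> arr V \<Gamma>"
  shows "modular_flat (arr V \<Gamma>) rk (arr V del)" "rk (arr V \<Gamma>) = Suc (rk (arr V del))"
proof -
  interpret hyperplane_arrangement V "arr V \<Gamma>" by (rule arr_arrangement[OF \<Gamma>])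
  show "modular_flat (arr V \<Gamma>) rk (arr V del)" "rk (arr V \<Gamma>) = Suc (rk (arr V del))"
    using modular_coatom_if_lines[OF induced_flat[OF \<Gamma>] assms simplicial_line] by auto
qed

lemma simplicial_flag:
  assumes Y: "rank_flag (arr V del) rk Y" and H: "H \<in> arr V \<Gamma> - arr V del"
  obtains Z where "rank_flag (arr V \<Gamma>) rk Z"
    "\<forall>i\<le>rk (arr V del). Z (Suc i) \<inter> arr V del = Y i \<and> H \<in> Z (Suc i)"
proof -
  interpret hyperplane_arrangement V "arr V \<Gamma>" by (rule arr_arrangement[OF \<Gamma>])
  have ne: "arr V del \<noteq> arr V \<Gamma>" using H by auto
  obtain Z where Z: "rank_flag (arr V \<Gamma>) rk Z"
    "\<forall>i\<le>rk (arr V del). Z (Suc i) \<inter> arr V del = Y i \<and> H \<in> Z (Suc i)"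
    using flag_coatom[OF simplicial_modular[OF ne] rank_singleton H Y] by blast
  show ?thesis by (rule that[OF Z])
qed

text \<open>The new flag is shifted by one against \<open>Y\<close>, and the rank also grows by one,
  so the bound for avoidance is unchanged. If no hyperplane is added at \<open>v\<close>, the old
  flag serves.\<close>

lemma flag_avoiding_simplicial_notin:
  assumes W: "looped_complete_in \<Gamma> W" "v \<notin> W" and f: "flag_avoiding del W"
  shows "flag_avoiding \<Gamma> W"
proof (cases "arr V del = arr V \<Gamma>")
  case True
  then show ?thesis using f by (simp add: flag_avoiding_def)
next
  case False
  then obtain H where H: "H \<in> arr V \<Gamma> - arr V del" using arr_induced_subset by blast
  obtain Y where Y: "rank_flag (arr V del) rk Y"
    "\<And>i. i + card W \<le> rk (arr V del) \<Longrightarrow> Y i \<inter> arr V (LC W) = {}"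
    using f by (auto simp: flag_avoiding_def)
  obtain Z where Z: "rank_flag (arr V \<Gamma>) rk Z"
    "\<forall>i\<le>rk (arr V del). Z (Suc i) \<inter> arr V del = Y i \<and> H \<in> Z (Suc i)"
    using simplicial_flag[OF Y(1) H] by blast
  have "looped_complete_in del W"
    using W looped_complete_sub[OF \<Gamma> W(1)] by (auto simp: looped_complete_in_def)
  then have WT: "arr V (LC W) \<subseteq> arr V del" by (rule arr_LC_subset)
  have "Z i \<inter> arr V (LC W) = {}" if i: "i + card W \<le> rk (arr V \<Gamma>)" for i
  proof (cases i)
    case 0
    then show ?thesis using Z(1) by (simp add: rank_flag_def)
  next
    case (Suc k)
    then have "k + card W \<le> rk (arr V del)" using i simplicial_modular(2)[OF False] by simp
    then show ?thesis using Z(2)[rule_format, of k] Y(2)[of k] WT Suc by auto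
  qed
  then show ?thesis using Z(1) by (auto simp: flag_avoiding_def)
qed

text \<open>Contracting the hyperplane of the edge \<open>uv\<close> replaces \<open>v\<close> by \<open>u\<close> in the looped complete subgraph.\<close>

lemma flag_avoiding_simplicial_exchange:
  assumes W: "looped_complete_in \<Gamma> W" "v \<in> W" and u: "gedge u v g \<in> gedges \<Gamma>" "u \<notin> W"
  defines "W' \<equiv> insert u (W - {v})"
  assumes f: "looped_complete_in del W' \<Longrightarrow> flag_avoiding del W'"
  shows "flag_avoiding \<Gamma> W"
proof -
  interpret hyperplane_arrangement V "arr V \<Gamma>" by (rule arr_arrangement[OF \<Gamma>])
  note ud = edgeD[OF \<Gamma> u(1)] and Ws = looped_complete_sub[OF \<Gamma> W(1)]
  have vloop: "v \<in> gloops \<Gamma>" using W by (auto simp: looped_complete_in_def)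
  \<comment> \<open>\<open>g\<close> times the gain \<open>inverse g * h\<close> is
    \<open>h\<close>, so simpliciality at \<open>v\<close> yields every gain between
    \<open>u\<close> and \<open>w\<close>.\<close>
  have uw: "gedge u w h \<in> gedges \<Gamma>" if "w \<in> W - {v}" "h \<in> G" for w h
  proof -
    have "inverse g * h \<in> G" using ud that G by blast
    then have "gedge v w (inverse g * h) \<in> gedges \<Gamma>"
      using W that by (auto simp: looped_complete_in_def)
    moreover have "u \<noteq> w" using that u by auto
    ultimately have "gedge u w (g * (inverse g * h)) \<in> gedges \<Gamma>" using simplicialD(1)[OF u(1)] by simp
    then show ?thesis using ud by (simp add: mult.assoc[symmetric])
  qed
  have wu: "gedge w u h \<in> gedges \<Gamma>" if "w \<in> W - {v}" "h \<in> G" for w h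
    using uw[of w "inverse h"] that G(4) gedge_flip[of w u h] by simp
  have lcW': "looped_complete_in del W'"
    unfolding looped_complete_in_def
  proof (intro conjI ballI impI)
    show "W' \<subseteq> gloops del"
      using W Ws ud simplicialD(3)[OF u(1) vloop] by (auto simp: W'_def looped_complete_in_def)
    fix a b h assume ab: "a \<in> W'" "b \<in> W'" "h \<in> G" "a \<noteq> b"
    then have "gedge a b h \<in> gedges \<Gamma>"
      using uw wu W by (auto simp: W'_def looped_complete_in_def)
    then show "gedge a b h \<in> gedges del" using edgeD[OF \<Gamma>, of a b h] ab u ud by (auto simp: W'_def)
  qed
  have "card W' = card W"
    using card.remove[OF Ws(3) W(2)] Ws(3) u(2) unfolding W'_def by (subst card_insert_disjoint) auto
  let ?H = "hyp V u v g"
  have H: "?H \<in> arr V \<Gamma> - arr V del"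
  proof
    show "?H \<in> arr V \<Gamma>" using u(1) by (rule arr_edge)
    have "unit_vec v \<notin> ?H" using ud by (simp add: unit_vec_hyp)
    then show "?H \<notin> arr V del" using unit_vec_arr[OF graph_in_del, of ?H v] ud by auto
  qed
  then have ne: "arr V del \<noteq> arr V \<Gamma>" by auto
  obtain Y where Y: "rank_flag (arr V del) rk Y"
    "\<And>i. i + card W' \<le> rk (arr V del) \<Longrightarrow> Y i \<inter> arr V (LC W') = {}"
    using f[OF lcW'] by (auto simp: flag_avoiding_def)
  obtain Z where Z: "rank_flag (arr V \<Gamma>) rk Z"
    "\<forall>i\<le>rk (arr V del). Z (Suc i) \<inter> arr V del = Y i \<and> ?H \<in> Z (Suc i)"
    using simplicial_flag[OF Y(1) H] by blast
  have W'T: "arr V (LC W') \<subseteq> arr V del" by (rule arr_LC_subset[OF lcW'])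
  \<comment> \<open>On \<open>?H\<close> the coordinate of \<open>v\<close> is a multiple of that of
    \<open>u\<close>, so each equation for \<open>W\<close> turns into one for
    \<open>W'\<close>.\<close>
  have line: "\<exists>K'\<in>arr V (LC W'). ?H \<inter> K \<subseteq> K'" if K: "K \<in> arr V (LC W)" for K
  proof -
    have edge: "\<exists>K'\<in>arr V (LC W'). ?H \<inter> hyp V w v h \<subseteq> K'" if "w \<in> W" "w \<noteq> v" "h \<in> G" for w h
    proof
      show "hyp V u w (g * inverse h) \<in> arr V (LC W')"
        using that u ud G by (intro arr_edge) (auto simp: W'_def)
      have "h \<noteq> 0" using that G(2) by auto
      then show "?H \<inter> hyp V w v h \<subseteq> hyp V u w (g * inverse h)"
        by (auto simp: hyp_def field_simps)
    qed
    from graph_in_LC[OF Ws(2)] K show ?thesis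
    proof (cases rule: arr_cases)
      case (edge i j h)
      consider "j = v" | "i = v" | "i \<noteq> v" "j \<noteq> v" by auto
      then show ?thesis
      proof cases
        case 1
        then show ?thesis using \<open>\<And>w h. w \<in> W \<Longrightarrow> w \<noteq> v \<Longrightarrow> h \<in> G \<Longrightarrow> _\<close>[of i h] edge by simp
      next
        case 2
        then show ?thesis
          using \<open>\<And>w h. w \<in> W \<Longrightarrow> w \<noteq> v \<Longrightarrow> h \<in> G \<Longrightarrow> _\<close>[of j "inverse h"] edge G(4) hyp_flip[of h V v j]
          by auto
      next
        case 3
        then have "K \<in> arr V (LC W')" using edge by (auto simp: W'_def intro!: arr_edge)
        then show ?thesis by blast
      qed
    next
      case (loop i)
      show ?thesis
      proof (cases "i = v")
        case True
        have "loop_hyp V u \<in> arr V (LC W')" by (rule arr_loop) (simp add: W'_def)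
        moreover have "?H \<inter> K \<subseteq> loop_hyp V u" using True loop by (auto simp: hyp_def loop_hyp_def)
        ultimately show ?thesis by blast
      next
        case False
        then have "K \<in> arr V (LC W')" using loop by (auto simp: W'_def intro!: arr_loop)
        then show ?thesis by blast
      qed
    qed
  qed
  have "Z i \<inter> arr V (LC W) = {}" if i: "i + card W \<le> rk (arr V \<Gamma>)" for i
  proof (cases i)
    case 0
    then show ?thesis using Z(1) by (simp add: rank_flag_def)
  next
    case (Suc k)
    then have k: "k + card W' \<le> rk (arr V del)"
      using i simplicial_modular(2)[OF ne] \<open>card W' = card W\<close> by simp
    \<comment> \<open>A flat containing \<open>?H\<close> and \<open>K\<close> also contains
      \<open>K'\<close>; its trace \<open>Y k\<close> would then meet the subgraph on
      \<open>W'\<close> below the bound.\<close>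
    have False if K: "K \<in> Z i" "K \<in> arr V (LC W)" for K
    proof -
      obtain K' where K': "K' \<in> arr V (LC W')" "?H \<inter> K \<subseteq> K'" using line[OF K(2)] by blast
      have "?H \<in> Z i" using Z(2)[rule_format, of k] k Suc by simp
      then have "sols V (Z i) \<subseteq> K'" using K(1) K'(2) by (auto simp: sols_def)
      moreover have "Z i \<in> rank_flats (arr V \<Gamma>) rk" using rank_flagD(3)[OF Z(1)] i by simp
      moreover have "K' \<in> arr V \<Gamma>" using K'(1) W'T arr_induced_subset by blast
      ultimately have "K' \<in> Z i" unfolding flat_iff by blast
      then have "K' \<in> Y k" using Z(2)[rule_format, of k] k K'(1) W'T Suc by auto
      then show False using Y(2)[OF k] K'(1) by blast
    qed
    then show ?thesis by blast
  qed
  then show ?thesis using Z(1) by (auto simp: flag_avoiding_def)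
qed

end

text \<open>Every vertex of a looped complete graph is bias-simplicial, so vertices can be removed
  one by one.\<close>

lemma flag_LC:
  assumes "W \<subseteq> V" shows "flag_avoiding (LC W) {}"
  using finite_subset[OF assms finite_V] assms
proof (induction W rule: finite_induct)
  case empty
  then show ?case using rank_flag_null by (auto simp: flag_avoiding_empty)
next
  case (insert v W)
  have g: "graph_in (LC (insert v W))" by (rule graph_in_LC[OF insert.prems])
  have lc: "looped_complete_in (LC (insert v W)) W" by (auto simp: looped_complete_in_def)
  have "bias_simplicial (LC (insert v W)) v"
    using G(3) by (auto simp: bias_simplicial_def)
  moreover have "insert v W - {v} = W" using insert.hyps by auto
  then have "induced_gain_graph (LC (insert v W)) (gverts (LC (insert v W)) - {v}) = LC W"
    using looped_complete_induced[OF g lc] by simp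
  ultimately show ?case
    using flag_avoiding_simplicial_notin[OF g, of v "{}"] insert
    by (simp add: looped_complete_in_def)
qed

text \<open>The rank equals \<open>card W\<close>, so the bound leaves only \<open>i = 0\<close>,
  where the flat is empty.\<close>

lemma flag_avoiding_LC:
  assumes "W \<subseteq> V" shows "flag_avoiding (LC W) W"
proof -
  obtain X where "rank_flag (arr V (LC W)) rk X"
    using flag_LC[OF assms] by (auto simp: flag_avoiding_empty)
  then show ?thesis
    unfolding flag_avoiding_def rank_LC[OF assms] by (auto simp: rank_flag_def)
qed

text \<open>If \<open>v\<close> belongs to \<open>W\<close>, the first hyperplane should be one at
  \<open>v\<close> outside the looped complete subgraph, which is an edge to some \<open>u\<close>
  not in \<open>W\<close>. Without such an edge all edges at \<open>v\<close> end in
  \<open>W\<close>, and the graph is a gluing of the rest with the subgraph on \<open>W\<close>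
  along \<open>W - {v}\<close>.\<close>

lemma flag_avoiding_simplicial:
  assumes \<Gamma>: "graph_in \<Gamma>" and v: "bias_simplicial \<Gamma> v"
    and f: "\<And>W. looped_complete_in (induced_gain_graph \<Gamma> (gverts \<Gamma> - {v})) W \<Longrightarrow>
      flag_avoiding (induced_gain_graph \<Gamma> (gverts \<Gamma> - {v})) W"
    and W: "looped_complete_in \<Gamma> W"
  shows "flag_avoiding \<Gamma> W"
proof -
  note Ws = looped_complete_sub[OF \<Gamma> W]
  have lc: "looped_complete_in (induced_gain_graph \<Gamma> (gverts \<Gamma> - {v})) (W - {v})"
    using W Ws by (auto simp: looped_complete_in_def)
  consider "v \<notin> W" | u g where "v \<in> W" "gedge u v g \<in> gedges \<Gamma>" "u \<notin> W"
    | "v \<in> W" "\<And>u g. gedge u v g \<in> gedges \<Gamma> \<Longrightarrow> u \<in> W" by blast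
  then show ?thesis
  proof cases
    case 1
    then show ?thesis using flag_avoiding_simplicial_notin[OF \<Gamma> v W 1] f[OF lc] by simp
  next
    case (2 u g)
    show ?thesis by (rule flag_avoiding_simplicial_exchange[OF \<Gamma> v W 2 f])
  next
    case 3
    have vG: "v \<in> gverts \<Gamma>" using 3 Ws by auto
    have Int: "(gverts \<Gamma> - {v}) \<inter> W = W - {v}" using Ws by auto
    show ?thesis
    proof (rule flag_avoiding_glue[OF \<Gamma> _ _ _ _ _ W subset_refl, of "gverts \<Gamma> - {v}"])
      show "gverts \<Gamma> = gverts \<Gamma> - {v} \<union> W" using vG 3(1) Ws by auto
      show "gedges \<Gamma> = gedges (induced_gain_graph \<Gamma> (gverts \<Gamma> - {v})) \<union> gedges (induced_gain_graph \<Gamma> W)"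
      proof (intro equalityI subsetI)
        fix e assume e: "e \<in> gedges \<Gamma>"
        then obtain i j g where ij: "e = gedge i j g" "gedge i j g \<in> gedges \<Gamma>"
          using \<Gamma> unfolding graph_in_def gain_graph_over_def by blast
        note d = edgeD[OF \<Gamma> ij(2)]
        have "gedge j i (inverse g) \<in> gedges \<Gamma>" using ij(2) gedge_flip[of i j g] by simp
        then have "i = v \<longrightarrow> j \<in> W" "j = v \<longrightarrow> i \<in> W" using 3(2) ij(2) by auto
        then show "e \<in> gedges (induced_gain_graph \<Gamma> (gverts \<Gamma> - {v})) \<union> gedges (induced_gain_graph \<Gamma> W)"
          using ij d 3(1) by (cases "i = v \<or> j = v") auto
      qed (auto simp: induced_gain_graph_def)
      show "looped_complete_in \<Gamma> ((gverts \<Gamma> - {v}) \<inter> W)"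
        using W by (auto simp: looped_complete_in_def)
      show "flag_avoiding (induced_gain_graph \<Gamma> (gverts \<Gamma> - {v})) ((gverts \<Gamma> - {v}) \<inter> W)"
        unfolding Int by (rule f[OF lc])
      show "flag_avoiding (induced_gain_graph \<Gamma> W) W"
        using looped_complete_induced[OF \<Gamma> W] flag_avoiding_LC[OF Ws(2)] by simp
    qed
  qed
qed

section \<open>Loopless base cases\<close>

definition pos_graph :: "('v \<Rightarrow> 'v \<Rightarrow> bool) \<Rightarrow> 'v set \<Rightarrow> ('v, 'k) gain_graph" where
  "pos_graph adj S =
     \<lparr> gverts = S, gedges = {gedge x y 1 | x y. x \<in> S \<and> y \<in> S \<and> adj x y}, gloops = {} \<rparr>"

lemma pos_graph_sel [simp]:
  "gverts (pos_graph adj S) = S" "gloops (pos_graph adj S) = {}"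
  by (simp_all add: pos_graph_def)

lemma pos_graph_edge:
  "symp adj \<Longrightarrow> gedge x y g \<in> gedges (pos_graph adj S) \<longleftrightarrow> x \<in> S \<and> y \<in> S \<and> adj x y \<and> g = 1"
  by (auto simp: pos_graph_def gedge_eq_iff dest: sympD)

lemma graph_in_pos:
  assumes "S \<subseteq> V" "irreflp adj" shows "graph_in (pos_graph adj S)"
proof -
  have "gedges (pos_graph adj S) \<subseteq> (\<lambda>(x, y). gedge x y 1) ` (S \<times> S)"
    by (auto simp: pos_graph_def)
  moreover have "finite S" using assms finite_subset[OF _ finite_V] by auto
  ultimately have "finite (gedges (pos_graph adj S))"
    by (meson finite_SigmaI finite_imageI finite_subset)
  moreover have "gedges (pos_graph adj S) \<subseteq> {gedge u v g | u v g. u \<in> S \<and> v \<in> S \<and> u \<noteq> v \<and> g \<in> G}"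
    using assms(2) G(1) unfolding pos_graph_def irreflp_def by auto metis
  ultimately show ?thesis
    using assms \<open>finite S\<close> unfolding graph_in_def gain_graph_over_def by simp
qed

text \<open>With a single gain and no loops, two of the three conditions for a bias-simplicial
  vertex hold vacuously, and the remaining one says that distinct neighbours are adjacent; so a
  simplicial vertex of the chordal graph can be removed.\<close>

lemma flag_pos_chordal:
  assumes "chordal adj" "symp adj" "irreflp adj" "S \<subseteq> V"
  shows "flag_avoiding (pos_graph adj S) {}"
  using assms(4)
proof (induction "card S" arbitrary: S)
  case 0
  then have "S = {}" using finite_subset[OF _ finite_V] by auto
  then have "arr V (pos_graph adj S) = {}" by (simp add: arr_def pos_graph_def)
  then show ?case using rank_flag_null by (auto simp: flag_avoiding_empty)
next
  case (Suc n)
  have fin: "finite S" "S \<noteq> {}" using Suc finite_subset[OF _ finite_V] by auto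
  obtain v where v: "simplicial_in adj S v"
    using chordal_simplicial_exists[OF assms(1,2) fin] .
  let ?\<Gamma> = "pos_graph adj S"
  have g: "graph_in ?\<Gamma>" by (rule graph_in_pos[OF Suc.prems assms(3)])
  have "v \<in> S" using v by (simp add: simplicial_in_def)
  moreover have "adj x y" if "x \<in> S" "y \<in> S" "adj x v" "adj v y" "x \<noteq> y" for x y
    using v that sympD[OF assms(2) that(3)] by (simp add: simplicial_in_def)
  ultimately have "bias_simplicial ?\<Gamma> v"
    by (auto simp: bias_simplicial_def pos_graph_edge[OF assms(2)])
  moreover have "induced_gain_graph ?\<Gamma> (gverts ?\<Gamma> - {v}) = pos_graph adj (S - {v})"
  proof -
    have "gedges (induced_gain_graph ?\<Gamma> (S - {v})) = gedges (pos_graph adj (S - {v}))"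
    proof (intro equalityI subsetI)
      fix e assume "e \<in> gedges (induced_gain_graph ?\<Gamma> (S - {v}))"
      then obtain i j g where "e = gedge i j g" "gedge i j g \<in> gedges ?\<Gamma>" "i \<in> S - {v}" "j \<in> S - {v}"
        by (auto simp: induced_gain_graph_def)
      then show "e \<in> gedges (pos_graph adj (S - {v}))"
        by (simp add: pos_graph_edge[OF assms(2)])
    next
      fix e assume "e \<in> gedges (pos_graph adj (S - {v}))"
      then obtain i j where "e = gedge i j 1" "i \<in> S - {v}" "j \<in> S - {v}" "adj i j"
        by (auto simp: pos_graph_def)
      then show "e \<in> gedges (induced_gain_graph ?\<Gamma> (S - {v}))"
        by (simp add: pos_graph_edge[OF assms(2)])
    qed
    then show ?thesis by (intro gain_graph.equality) (simp_all add: pos_graph_def)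
  qed
  moreover have "flag_avoiding (pos_graph adj (S - {v})) {}"
    using Suc v by (intro Suc.hyps(1)) (auto simp: simplicial_in_def)
  ultimately show ?case
    using flag_avoiding_simplicial_notin[OF g, of v "{}"] by (simp add: looped_complete_in_def)
qed

text \<open>The point \<open>z\<close>, which lies on all hyperplanes of \<open>T\<close> and on no
  other, certifies that \<open>T\<close> is a flat; the lines then make it a modular coatom.\<close>

lemma flag_add_coatom:
  assumes E: "hyperplane_arrangement V E" and "T \<subseteq> E" and Y: "rank_flag T rk Y"
    and z: "z \<in> sols V T" "\<And>H. H \<in> E - T \<Longrightarrow> z \<notin> H"
    and lines: "\<And>H H'. H \<in> E - T \<Longrightarrow> H' \<in> E - T \<Longrightarrow> H \<noteq> H' \<Longrightarrow> \<exists>K\<in>T. H \<inter> H' \<subseteq> K"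
  shows "\<exists>X. rank_flag E rk X"
proof (cases "T = E")
  case False
  interpret hyperplane_arrangement V E by (rule E)
  obtain H where H: "H \<in> E - T" using False assms(2) by blast
  have T: "T \<in> rank_flats E rk" using z assms(2) unfolding flat_iff by blast
  have m: "modular_flat E rk T" "rk E = Suc (rk T)"
    using modular_coatom_if_lines[OF T False lines] by auto
  obtain X where "rank_flag E rk X"
    using flag_coatom[OF m rank_singleton H Y] by blast
  then show ?thesis by blast
qed (use Y in blast)

lemma flag_pos_plus:
  assumes \<Gamma>: "graph_in \<Gamma>" and adj: "chordal adj" "symp adj" "irreflp adj" and S: "S \<subseteq> V"
    and sub: "arr V (pos_graph adj S) \<subseteq> arr V \<Gamma>"
    and rest: "\<And>H. H \<in> arr V \<Gamma> - arr V (pos_graph adj S) \<Longrightarrow> \<exists>i\<in>V. \<exists>j\<in>V. \<exists>g. g \<noteq> 1 \<and> H = hyp V i j g"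
    and lines: "\<And>H H'. H \<in> arr V \<Gamma> - arr V (pos_graph adj S) \<Longrightarrow>
      H' \<in> arr V \<Gamma> - arr V (pos_graph adj S) \<Longrightarrow> H \<noteq> H' \<Longrightarrow>
      \<exists>i j. i \<in> S \<and> j \<in> S \<and> adj i j \<and> H \<inter> H' \<subseteq> hyp V i j 1"
  shows "flag_avoiding \<Gamma> {}"
proof -
  \<comment> \<open>On \<open>V\<close> the all-ones vector satisfies \<open>x i = g * x j\<close>
    only for \<open>g = 1\<close>; it is \<open>0\<close> outside \<open>V\<close> in order to lie
    in \<open>coord_space V\<close>.\<close>
  define z where "z = (\<lambda>v. if v \<in> V then 1 else 0 :: 'k)"
  have zV: "z \<in> coord_space V" by (simp add: z_def coord_space_def)
  obtain Y where Y: "rank_flag (arr V (pos_graph adj S)) rk Y"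
    using flag_pos_chordal[OF adj S] by (auto simp: flag_avoiding_empty)
  have "\<exists>X. rank_flag (arr V \<Gamma>) rk X"
  proof (rule flag_add_coatom[OF arr_arrangement[OF \<Gamma>] sub Y])
    have "z \<in> H" if "H \<in> arr V (pos_graph adj S)" for H
      using graph_in_pos[OF S adj(3)] that
      by (cases rule: arr_cases) (use zV in \<open>auto simp: pos_graph_edge[OF adj(2)] hyp_def z_def\<close>)
    then show "z \<in> sols V (arr V (pos_graph adj S))" using zV by (auto simp: sols_def)
    show "z \<notin> H" if "H \<in> arr V \<Gamma> - arr V (pos_graph adj S)" for H
      using rest[OF that] by (auto simp: hyp_def z_def)
    show "\<exists>K\<in>arr V (pos_graph adj S). H \<inter> H' \<subseteq> K"
      if H: "H \<in> arr V \<Gamma> - arr V (pos_graph adj S)" "H' \<in> arr V \<Gamma> - arr V (pos_graph adj S)" "H \<noteq> H'"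
      for H H'
    proof -
      obtain i j where "i \<in> S" "j \<in> S" "adj i j" "H \<inter> H' \<subseteq> hyp V i j 1" using lines[OF H] by blast
      then show ?thesis using arr_edge[of i j 1 "pos_graph adj S"] pos_graph_edge[OF adj(2)] by blast
    qed
  qed
  then show ?thesis by (simp add: flag_avoiding_empty)
qed

lemma chordal_complete: "chordal (\<lambda>x y. x \<in> S \<and> y \<in> S \<and> x \<noteq> y)"
  unfolding chordal_def Let_def
proof (intro allI impI)
  fix xs :: "'a list"
  assume *: "4 \<le> length xs \<and> distinct xs \<and> (\<forall>i<length xs. xs ! i \<in> S \<and>
    xs ! (Suc i mod length xs) \<in> S \<and> xs ! i \<noteq> xs ! (Suc i mod length xs))"
  then have len: "0 < length xs" "2 < length xs" and "distinct xs" and S: "\<And>i. i < length xs \<Longrightarrow> xs ! i \<in> S"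
    by auto
  then have "xs ! 0 \<in> S" "xs ! 2 \<in> S" "xs ! 0 \<noteq> xs ! 2"
    using nth_eq_iff_index_eq[OF \<open>distinct xs\<close> len] by auto
  then show "\<exists>i<length xs. \<exists>j<length xs. i \<noteq> j \<and> j \<noteq> Suc i mod length xs \<and>
      i \<noteq> Suc j mod length xs \<and> xs ! i \<in> S \<and> xs ! j \<in> S \<and> xs ! i \<noteq> xs ! j"
    \<comment> \<open>Positions 0 and 2 of the cycle form a chord, as its length is at least
      4.\<close>
    using * by (intro exI[of _ 0] conjI exI[of _ 2]) auto
qed

lemma complete_sel [simp]:
  assumes "\<And>g. g \<in> H \<Longrightarrow> inverse g \<in> H"
  shows "gedge i j g \<in> gedges (complete_gain_graph H W) \<longleftrightarrow> i \<in> W \<and> j \<in> W \<and> i \<noteq> j \<and> g \<in> H"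
  using assms by (auto simp: complete_gain_graph_def gedge_eq_iff)

lemma complete_verts [simp]:
  "gverts (complete_gain_graph H W) = W" "gloops (complete_gain_graph H W) = {}"
  by (simp_all add: complete_gain_graph_def)

text \<open>Two hyperplanes between the same \<open>a\<close> and \<open>b\<close> with different
  gains meet where \<open>x a = x b = 0\<close>, hence inside the hyperplane of gain 1, which serves
  as the chordal part.\<close>

lemma flag_complete2:
  assumes "card W = 2" "W \<subseteq> V"
  shows "flag_avoiding (complete_gain_graph G W) {}"
proof -
  let ?\<Gamma> = "complete_gain_graph G W" and ?adj = "\<lambda>x y. x \<in> W \<and> y \<in> W \<and> x \<noteq> y"
  obtain a b where ab: "W = {a, b}" "a \<noteq> b" using assms(1) by (auto simp: card_2_iff)
  have \<Gamma>: "graph_in ?\<Gamma>"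
    using complete_over[of W G] assms finite_subset[OF _ finite_V] by (auto simp: graph_in_def)
  have adj: "symp ?adj" "irreflp ?adj" by (auto simp: symp_def irreflp_def)
  have edge: "gedge i j g \<in> gedges ?\<Gamma> \<longleftrightarrow> i \<in> W \<and> j \<in> W \<and> i \<noteq> j \<and> g \<in> G" for i j g
    using G(4) by simp
  have rest: "\<exists>g. g \<noteq> 1 \<and> H = hyp V a b g" if H: "H \<in> arr V ?\<Gamma> - arr V (pos_graph ?adj W)" for H
  proof -
    have "H \<in> arr V ?\<Gamma>" using H by simp
    with \<Gamma> show ?thesis
    proof (cases rule: arr_cases)
      case (edge i j g)
      then have "g \<noteq> 1"
        using H arr_edge[of i j 1 "pos_graph ?adj W"] pos_graph_edge[OF adj(1), of i j 1 W] by auto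
      moreover have "H = hyp V a b g \<or> H = hyp V a b (inverse g)"
        using edge ab hyp_flip[of g V i j] by auto
      ultimately show ?thesis by (metis inverse_eq_1_iff)
    qed simp
  qed
  show ?thesis
  proof (rule flag_pos_plus[OF \<Gamma> chordal_complete adj assms(2)])
    show "arr V (pos_graph ?adj W) \<subseteq> arr V ?\<Gamma>"
      using G(1) edge by (auto simp: arr_def pos_graph_edge[OF adj(1)])
    show "\<exists>i\<in>V. \<exists>j\<in>V. \<exists>g. g \<noteq> 1 \<and> H = hyp V i j g"
      if "H \<in> arr V ?\<Gamma> - arr V (pos_graph ?adj W)" for H
      using rest[OF that] ab assms(2) by auto
    fix H H' assume H: "H \<in> arr V ?\<Gamma> - arr V (pos_graph ?adj W)"
      "H' \<in> arr V ?\<Gamma> - arr V (pos_graph ?adj W)" "H \<noteq> H'"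
    obtain g h where "H = hyp V a b g" "H' = hyp V a b h" "g \<noteq> h"
      using rest[OF H(1)] rest[OF H(2)] H(3) by blast
    then have "H \<inter> H' \<subseteq> hyp V a b 1" by (auto simp: hyp_def)
    then show "\<exists>i j. i \<in> W \<and> j \<in> W \<and> (i \<in> W \<and> j \<in> W \<and> i \<noteq> j) \<and> H \<inter> H' \<subseteq> hyp V i j 1"
      using ab by blast
  qed
qed

text \<open>Common form of the two signed families. Two negative edges share an end
  \<open>a\<close>, and \<open>x a = - x b\<close> together with \<open>x a = - x c\<close> gives
  \<open>x b = x c\<close>, a hyperplane of gain 1 by \<open>closed\<close>.\<close>

lemma flag_signed:
  assumes \<Gamma>: "graph_in \<Gamma>" and signs: "\<And>i j g. gedge i j g \<in> gedges \<Gamma> \<Longrightarrow> g = 1 \<or> g = -1"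
    and loopless: "gloops \<Gamma> = {}" and chordal: "chordal (\<lambda>x y. gedge x y 1 \<in> gedges \<Gamma>)"
    and meet: "\<And>i j k l. gedge i j (-1) \<in> gedges \<Gamma> \<Longrightarrow> gedge k l (-1) \<in> gedges \<Gamma> \<Longrightarrow> {i, j} \<inter> {k, l} \<noteq> {}"
    and closed: "\<And>i j k. gedge i j (-1) \<in> gedges \<Gamma> \<Longrightarrow> gedge i k (-1) \<in> gedges \<Gamma> \<Longrightarrow> j \<noteq> k \<Longrightarrow>
      gedge j k 1 \<in> gedges \<Gamma>"
  shows "flag_avoiding \<Gamma> {}"
proof -
  let ?adj = "\<lambda>x y. gedge x y 1 \<in> gedges \<Gamma>" and ?S = "gverts \<Gamma>"
  have adj: "symp ?adj" "irreflp ?adj"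
    using edgeD(3)[OF \<Gamma>] by (auto simp: symp_def irreflp_def) (metis gedge_flip inverse_1)
  have S: "?S \<subseteq> V" using \<Gamma> by (simp add: graph_in_def)
  let ?T = "arr V (pos_graph ?adj ?S)"
  \<comment> \<open>The inequality \<open>-1 \<noteq> 1\<close> comes for free: in characteristic 2
    every edge has gain 1, and no hyperplane is left outside \<open>?T\<close>.\<close>
  have rest: "\<exists>i j. gedge i j (-1) \<in> gedges \<Gamma> \<and> (-1::'k) \<noteq> 1 \<and> H = hyp V i j (-1)"
    if H: "H \<in> arr V \<Gamma> - ?T" for H
  proof -
    have "H \<in> arr V \<Gamma>" using H by simp
    with \<Gamma> show ?thesis
    proof (cases rule: arr_cases)
      case (edge i j g)
      then have "g \<noteq> 1"
        using H arr_edge[of i j 1 "pos_graph ?adj ?S"] pos_graph_edge[OF adj(1), of i j 1 ?S] by auto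
      then show ?thesis using edge signs[OF edge(1)] by auto
    qed (simp add: loopless)
  qed
  have flip: "gedge i j (-1) = gedge j i (-1 :: 'k)" for i j :: 'v
    using gedge_flip[of i j "-1"] by simp
  have hflip: "hyp V i j (-1 :: 'k) = hyp V j i (-1)" for i j :: 'v
    using hyp_flip[of "-1" V i j] by simp
  show ?thesis
  proof (rule flag_pos_plus[OF \<Gamma> chordal adj S])
    show "?T \<subseteq> arr V \<Gamma>" by (auto simp: arr_def pos_graph_edge[OF adj(1)])
    show "\<exists>i\<in>V. \<exists>j\<in>V. \<exists>g. g \<noteq> 1 \<and> H = hyp V i j g" if "H \<in> arr V \<Gamma> - ?T" for H
      using rest[OF that] edgeD[OF \<Gamma>] by metis
    fix H H' assume H: "H \<in> arr V \<Gamma> - ?T" "H' \<in> arr V \<Gamma> - ?T" "H \<noteq> H'"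
    obtain i j where ij: "gedge i j (-1) \<in> gedges \<Gamma>" "H = hyp V i j (-1)" using rest[OF H(1)] by blast
    obtain k l where kl: "gedge k l (-1) \<in> gedges \<Gamma>" "H' = hyp V k l (-1)" using rest[OF H(2)] by blast
    have "\<exists>a b c. gedge a b (-1) \<in> gedges \<Gamma> \<and> gedge a c (-1) \<in> gedges \<Gamma> \<and>
      H = hyp V a b (-1) \<and> H' = hyp V a c (-1)"
    proof -
      have "i = k \<or> i = l \<or> j = k \<or> j = l" using meet[OF ij(1) kl(1)] by auto
      then show ?thesis using ij kl flip[of i j] flip[of k l] hflip[of i j] hflip[of k l] by metis
    qed
    then obtain a b c where abc: "gedge a b (-1) \<in> gedges \<Gamma>" "gedge a c (-1) \<in> gedges \<Gamma>"
      "H = hyp V a b (-1)" "H' = hyp V a c (-1)" by blast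
    then have "b \<noteq> c" using H(3) by auto
    then have "?adj b c" using closed abc by blast
    moreover have "H \<inter> H' \<subseteq> hyp V b c 1"
      unfolding abc by (auto simp: hyp_def) (metis add.commute add_left_imp_eq)
    ultimately show "\<exists>i j. i \<in> ?S \<and> j \<in> ?S \<and> ?adj i j \<and> H \<inter> H' \<subseteq> hyp V i j 1"
      using edgeD[OF \<Gamma>, of b c 1] by blast
  qed
qed

text \<open>Three vertices leave no room for two disjoint edges. Outside characteristic 2 this is
  the arrangement of type D_3, whose matroid is that of the braid arrangement A_3.\<close>

lemma flag_complete3:
  assumes "{1, -1} \<subseteq> G" "card W = 3" "W \<subseteq> V"
  shows "flag_avoiding (complete_gain_graph {1, -1} W) {}"
proof -
  let ?\<Gamma> = "complete_gain_graph {1, -1 :: 'k} W"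
  have edge: "gedge i j g \<in> gedges ?\<Gamma> \<longleftrightarrow> i \<in> W \<and> j \<in> W \<and> i \<noteq> j \<and> g \<in> {1, -1}" for i j g
    by (subst complete_sel) auto
  have "finite W" using assms finite_subset[OF _ finite_V] by auto
  then have "gain_graph_over G ?\<Gamma>"
    using gain_graph_over_mono[OF complete_over[of W "{1, -1}"]] assms(1) by blast
  then have \<Gamma>: "graph_in ?\<Gamma>" using assms by (simp add: graph_in_def)
  show ?thesis
  proof (rule flag_signed[OF \<Gamma>])
    show "chordal (\<lambda>x y. gedge x y 1 \<in> gedges ?\<Gamma>)" unfolding edge using chordal_complete[of W] by simp
    show "{i, j} \<inter> {k, l} \<noteq> {}"
      if "gedge i j (-1) \<in> gedges ?\<Gamma>" "gedge k l (-1) \<in> gedges ?\<Gamma>" for i j k l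
    proof
      assume "{i, j} \<inter> {k, l} = {}"
      then have "card {i, j, k, l} = 4" using that by (auto simp: edge)
      moreover have "card {i, j, k, l} \<le> card W"
        using that finite_subset[OF assms(3) finite_V] by (intro card_mono) (auto simp: edge)
      ultimately show False using assms(2) by simp
    qed
  qed (auto simp: edge)
qed

text \<open>Two negative edges meet in the centre \<open>u\<close>; if their other ends differ, the
  common vertex is \<open>u\<close> and these ends are leaves, joined by hypothesis.\<close>

lemma flag_chordal_star:
  assumes "{1, -1} \<subseteq> G" and over: "gain_graph_over {1, -1} \<Gamma>" "gverts \<Gamma> \<subseteq> V"
    and loopless: "gloops \<Gamma> = {}" and chordal: "chordal (\<lambda>x y. gedge x y 1 \<in> gedges \<Gamma>)"
    and star: "S \<subseteq> gverts \<Gamma> - {u}"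
      "{e \<in> gedges \<Gamma>. \<exists>x y. e = gedge x y (-1)} = (\<lambda>v. gedge u v (-1)) ` S"
    and clique: "\<forall>v\<in>S. \<forall>w\<in>S. v \<noteq> w \<longrightarrow> gedge v w 1 \<in> gedges \<Gamma>"
  shows "flag_avoiding \<Gamma> {}"
proof -
  have "gain_graph_over G \<Gamma>" using over(1) assms(1) by (rule gain_graph_over_mono)
  then have \<Gamma>: "graph_in \<Gamma>" using over by (simp add: graph_in_def)
  have neg: "i = u \<and> j \<in> S \<or> j = u \<and> i \<in> S" if "gedge i j (-1) \<in> gedges \<Gamma>" for i j
  proof -
    have "gedge i j (-1) \<in> {e \<in> gedges \<Gamma>. \<exists>x y. e = gedge x y (-1)}" using that by auto
    then have "gedge i j (-1 :: 'k) \<in> (\<lambda>v. gedge u v (-1)) ` S" unfolding star(2) .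
    then show ?thesis by (auto simp: gedge_eq_iff)
  qed
  show ?thesis
  proof (rule flag_signed[OF \<Gamma> _ loopless chordal])
    show "g = 1 \<or> g = -1" if e: "gedge i j g \<in> gedges \<Gamma>" for i j g
    proof -
      obtain a b h where "gedge i j g = gedge a b h" "h \<in> {1, -1}"
        using e over(1) unfolding gain_graph_over_def by blast
      then show ?thesis by (auto simp: gedge_eq_iff)
    qed
    show "{i, j} \<inter> {k, l} \<noteq> {}" if "gedge i j (-1) \<in> gedges \<Gamma>" "gedge k l (-1) \<in> gedges \<Gamma>" for i j k l
      using neg[OF that(1)] neg[OF that(2)] by auto
    show "gedge j k 1 \<in> gedges \<Gamma>"
      if "gedge i j (-1) \<in> gedges \<Gamma>" "gedge i k (-1) \<in> gedges \<Gamma>" "j \<noteq> k" for i j k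
      using neg[OF that(1)] neg[OF that(2)] that(3) clique star(1) by auto
  qed
qed

section \<open>Induction over the class\<close>

lemma gain_class_over:
  fixes \<Gamma> :: "('v, 'k) gain_graph"
  shows "gain_class G \<Gamma> \<Longrightarrow> gain_graph_over G \<Gamma>"
proof (induction rule: gain_class.induct)
  case null
  then show ?case by (simp add: gain_graph_over_def)
next
  case (complete2 W)
  then have "finite W" by (simp add: card_ge_0_finite)
  then show ?case by (rule complete_over[OF _ subset_refl])
next
  case (complete3 W)
  then have "finite W" by (simp add: card_ge_0_finite)
  then have "gain_graph_over {1, -1} (complete_gain_graph {1, -1 :: 'k} W)"
    using complete_over[of W "{1, -1}"] complete3 by simp
  then show ?case using complete3(1) by (rule gain_graph_over_mono)
next
  case (chordal_star \<Gamma> u S)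
  show ?case by (rule gain_graph_over_mono[OF chordal_star(2,1)])
qed

text \<open>\<open>W\<close> is arbitrary because the gluing step uses the induction hypothesis both
  for the common part and for \<open>W\<close>, and the simplicial step may use it for a modified
  \<open>W\<close>. The base cases have no loops, which forces \<open>W = {}\<close>.\<close>

lemma gain_class_flag_avoiding:
  "gain_class G \<Gamma> \<Longrightarrow> gverts \<Gamma> \<subseteq> V \<Longrightarrow> looped_complete_in \<Gamma> W \<Longrightarrow> flag_avoiding \<Gamma> W"
proof (induction arbitrary: W rule: gain_class.induct)
  case null
  then have "W = {}" by (simp add: looped_complete_in_def)
  then show ?case using rank_flag_null by (auto simp: flag_avoiding_empty arr_def)
next
  case (complete2 U)
  then have "W = {}" by (simp add: looped_complete_in_def)
  then show ?case using flag_complete2[of U] complete2 by simp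
next
  case (complete3 U)
  then have "W = {}" by (simp add: looped_complete_in_def)
  then show ?case using flag_complete3[of U] complete3 by simp
next
  case (chordal_star \<Gamma> u S)
  then have "W = {}" by (simp add: looped_complete_in_def)
  then show ?case using flag_chordal_star[of \<Gamma> S u] chordal_star by simp
next
  case (simplicial \<Gamma> v)
  have \<Gamma>: "graph_in \<Gamma>" using simplicial by (simp add: graph_in_def)
  have "gverts (induced_gain_graph \<Gamma> (gverts \<Gamma> - {v})) \<subseteq> V" using simplicial.prems by auto
  then show ?case
    using flag_avoiding_simplicial[OF \<Gamma> simplicial.hyps(2) simplicial.IH simplicial.prems(2)] by blast
next
  case (gluing \<Gamma> V1 V2)
  have \<Gamma>: "graph_in \<Gamma>" using gluing by (simp add: graph_in_def)
  have sub: "V1 \<subseteq> V" "V2 \<subseteq> V" using gluing by auto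
  have lc: "looped_complete_in \<Gamma> (V1 \<inter> V2)"
  proof -
    have "gedge i j g \<in> gedges \<Gamma>" if "i \<in> V1 \<inter> V2" "j \<in> V1 \<inter> V2" "i \<noteq> j" "g \<in> G" for i j g
    proof -
      have "gedge i j g \<in> gedges (LC (V1 \<inter> V2))" using that by simp
      then show ?thesis using gluing.hyps(6) induced_sel(3) by metis
    qed
    moreover have "V1 \<inter> V2 \<subseteq> gloops \<Gamma>"
      using arg_cong[OF gluing.hyps(6), of gloops] by auto
    ultimately show ?thesis by (auto simp: looped_complete_in_def)
  qed
  have lc1: "looped_complete_in (induced_gain_graph \<Gamma> V1) U" if "U \<subseteq> V1" "looped_complete_in \<Gamma> U" for U
    using that by (auto simp: looped_complete_in_def)
  have lc2: "looped_complete_in (induced_gain_graph \<Gamma> V2) U" if "U \<subseteq> V2" "looped_complete_in \<Gamma> U" for U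
    using that by (auto simp: looped_complete_in_def)
  note IH1 = gluing.IH(1)[unfolded induced_sel(1), OF sub(1) lc1]
    and IH2 = gluing.IH(2)[unfolded induced_sel(1), OF sub(2) lc2]
  \<comment> \<open>Otherwise two vertices of \<open>W\<close> on different sides would be joined by
    an edge that belongs to neither part.\<close>
  have "W \<subseteq> V1 \<or> W \<subseteq> V2"
  proof (rule ccontr)
    assume "\<not> (W \<subseteq> V1 \<or> W \<subseteq> V2)"
    then obtain a b where ab: "a \<in> W" "a \<notin> V1" "b \<in> W" "b \<notin> V2" by blast
    have "W \<subseteq> V1 \<union> V2" using looped_complete_sub(1)[OF \<Gamma> gluing.prems(2)] gluing.hyps(2) by simp
    then have "a \<noteq> b" using ab by auto
    then have "gedge a b 1 \<in> gedges \<Gamma>" using ab G(1) gluing.prems(2) by (auto simp: looped_complete_in_def)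
    then show False using gluing.hyps(5) ab induced_sel(3) by (metis Un_iff)
  qed
  then show ?case
  proof
    assume W: "W \<subseteq> V2"
    show ?thesis
      by (rule flag_avoiding_glue[OF \<Gamma> gluing.hyps(2,5) lc IH1[OF _ lc] IH2[OF W gluing.prems(2)]
            gluing.prems(2) W]) auto
  next
    \<comment> \<open>The gluing is symmetric, so here the two parts exchange their roles.\<close>
    assume W: "W \<subseteq> V1"
    have "gverts \<Gamma> = V2 \<union> V1"
      "gedges \<Gamma> = gedges (induced_gain_graph \<Gamma> V2) \<union> gedges (induced_gain_graph \<Gamma> V1)"
      using gluing.hyps by auto
    then show ?thesis
      using flag_avoiding_glue[of \<Gamma> V2 V1 W] \<Gamma> lc IH2[OF _ lc] IH1[OF W gluing.prems(2)]
        gluing.prems(2) W by (simp add: Int_commute)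
  qed
qed

end

theorem theorem4p11:
  fixes G :: "'k::field set" and \<Gamma> :: "('v, 'k) gain_graph"
  assumes "finite G" and "mult_subgroup G"
    and "gain_class G \<Gamma>"
  shows "divisionally_free (gverts \<Gamma>) (mult_arrangement \<Gamma>)"
proof -
  \<comment> \<open>\<open>gain_class_over\<close> does not depend on the ambient set, so the empty
    one serves to obtain the finiteness of the vertex set that the next interpretation
    requires.\<close>
  interpret null: gain_setting "{} :: 'v set" G using assms by unfold_locales auto
  have over: "gain_graph_over G \<Gamma>" by (rule null.gain_class_over[OF assms(3)])
  interpret gain_setting "gverts \<Gamma>" G
    using assms over by unfold_locales (auto simp: gain_graph_over_def)
  have "graph_in \<Gamma>" using over by (simp add: graph_in_def)
  then interpret hyperplane_arrangement "gverts \<Gamma>" "arr (gverts \<Gamma>) \<Gamma>" by (rule arr_arrangement)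
  have "flag_avoiding \<Gamma> {}"
    by (rule gain_class_flag_avoiding[OF assms(3)]) (auto simp: looped_complete_in_def)
  then obtain X where "rank_flag (arr (gverts \<Gamma>) \<Gamma>) (hyp_rank (gverts \<Gamma>)) X"
    by (auto simp: flag_avoiding_empty)
  then have "divisionally_free (gverts \<Gamma>) (arr (gverts \<Gamma>) \<Gamma>)" by (rule divisionally_free_if_flag)
  moreover have "arr (gverts \<Gamma>) \<Gamma> = mult_arrangement \<Gamma>"
    by (auto simp: arr_def mult_arrangement_def hyp_def loop_hyp_def)
  ultimately show ?thesis by simp
qed

end
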